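(* Let $\mathcal X$ be a Lévy process as described in the context, in Case B (i.e. $c>0$, $\gamma=0$ and $\mathcal S$ a driftless subordinator), and let $q>0$. Let $\overline\chi_{q,\mathcal S}(u)=\int_u^\infty\chi_{q,\mathcal S}(x)dx$ and $\widehat\chi_{q,\mathcal S}(0)=\int_0^\infty\chi_{q,\mathcal S}(x)dx$. If $u\mapsto 1-\overline\chi_{q,\mathcal S}(u)/\widehat\chi_{q,\mathcal S}(0)$ is a subexponential distribution function, then, with $F_{I_{e_q}}(-u)=\mathbb P[I_{e_q}<-u]$, $$\lim_{u\to\infty}\frac{F_{I_{e_q}}(-u)}{\overline\chi_{q,\mathcal S}(u)}=\frac{\kappa(q,0)}{q}.$$
   Context: Process (Case B). $\mathcal X(t)=ct+\mathcal Z(t)-\mathcal S(t)$, $t\ge0$, with independent components: $c>0$; $\mathcal Z$ is a compound Poisson process with Lévy measure $\lambda_1f_1(x)dx$, $\lambda_1>0$, where $f_1$ is a probability density on $(0,\infty)$ with Laplace transform $\widehat f_1(r)=Q(r)/\prod_{i=1}^N(\alpha_i+r)^{n_i}$, $0<\alpha_1<\dots<\alpha_N$ real, $n_i\in\mathbb N$, $n_1+\dots+n_N=m$, $Q$ a polynomial of degree at most $m-1$; $\mathcal S$ is a driftless subordinator with Lévy measure $\nu_{\mathcal S}$ and $G_{\mathcal S}(r)=-\log\mathbb E[e^{-r\mathcal S(1)}]=\int_{0+}^\infty(1-e^{-rx})\nu_{\mathcal S}(dx)$. Put $$\Psi_{\mathcal X}(r)=cr+\lambda_1\Bigl(\frac{Q(-r)}{\prod_{j=1}^N(\alpha_j-r)^{n_j}}-1\Bigr)-G_{\mathcal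 S}(r).$$ Roots. For $q>0$, let $\beta_1(q),\dots,\beta_R(q)$ be the distinct roots of $\Psi_{\mathcal X}(r)-q=0$ in $\{\mathrm{Re}\,z>0\}$ ($\Psi_{\mathcal X}$ being continued meromorphically there), with multiplicities $k_1,\dots,k_R$, $\sum_jk_j=m+1$; $\beta_1(q)$ is the unique real root in $(0,\alpha_1)$ and $k_1=1$. Notation. $I_t=\inf_{0\le s\le t}\mathcal X(s)$; $e_q$ is exponential with parameter $q$, independent of $\mathcal X$. $\kappa(q,r)=\prod_{j=1}^R(\beta_j(q)+r)^{k_j}\big/\prod_{l=1}^N(\alpha_l+r)^{n_l}$; it is known (Lewis and Mordecki) that $S_{e_q}=\sup_{0\le s\le e_q}\mathcal X(s)$ satisfies $\mathbb E[e^{-rS_{e_q}}]=\kappa(q,0)/\kappa(q,r)$, $r\ge0$. For $1\le j\le R$, $0\le a\le k_j-1$, let $$E(j,a,q)=\binom{k_j-1}a\frac{(-1)^{1-k_j+a}}{(k_j-1)!}\frac{\partial^{k_j-1-a}}{\partial s^{k_j-1-a}}\left[\frac{\prod_{l=1}^N(\alpha_l-s)^{n_l}(\beta_j(q)-s)^{k_j}}{\prod_{l=1}^R(\beta_l(q)-s)^{k_l}}\right]_{s=\beta_j(q)}.$$ In Case B the measure $\chi_{q,\mathcal S}$ has the density $$\chi_{q,\mathcal S}(u)=\sum_{j=1}^R\sum_{a=0}^{k_j-1}E(j,a,q)\int_u^\infty(y-u)^ae^{-\beta_j(q)(y-u)}\nu_{\mathcal S}(dy),\quad u>0.$$ A distribution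 $F$ on $[0,\infty)$ with tail $\overline F=1-F$ is subexponential if $\overline{F^{*2}}(x)/\overline F(x)\to2$ as $x\to\infty$. *)

theory Defs
  imports "HOL-Probability.Probability" "HOL-Complex_Analysis.Complex_Analysis"
begin

definition cadlag :: "(real \<Rightarrow> real) \<Rightarrow> bool" where
  "cadlag x \<longleftrightarrow>
     (\<forall>t\<ge>0. continuous (at_right t) x) \<and> (\<forall>t>0. \<exists>l. (x \<longlongrightarrow> l) (at_left t))"

text \<open>The space of values of a process indexed by \<open>[0, \<infinity>)\<close>, and the process as one random
  element of it; values at negative times are ignored throughout.\<close>

abbreviation path_space :: "(real \<Rightarrow> real) measure" where
  "path_space \<equiv> PiM {0..} (\<lambda>_. borel)"

abbreviation path_of :: "(real \<Rightarrow> 'a \<Rightarrow> real) \<Rightarrow> 'a \<Rightarrow> real \<Rightarrow> real" where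
  "path_of X \<equiv> \<lambda>\<omega>. \<lambda>t\<in>{0..}. X t \<omega>"

text \<open>\<open>indep_var\<close> of the library needs both random elements to have the same type of values.\<close>

definition indep_rvs :: "'a measure \<Rightarrow> 'b measure \<Rightarrow> ('a \<Rightarrow> 'b) \<Rightarrow> 'c measure \<Rightarrow> ('a \<Rightarrow> 'c) \<Rightarrow> bool" where
  "indep_rvs M A f B g \<longleftrightarrow>
     f \<in> measurable M A \<and> g \<in> measurable M B \<and>
     prob_space.indep_set M
       {f -` a \<inter> space M | a. a \<in> sets A} {g -` b \<inter> space M | b. b \<in> sets B}"

text \<open>Paths are cadlag for every \<open>\<omega>\<close>, not just almost surely, so that running infima are
  measurable without completing the probability space. Stochastic continuity follows from
  right-continuity and stationarity.\<close>

definition levy_process :: "'a measure \<Rightarrow> (real \<Rightarrow> 'a \<Rightarrow> real) \<Rightarrow> bool" where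
  "levy_process M X \<longleftrightarrow>
     prob_space M \<and>
     (\<forall>t\<ge>0. X t \<in> borel_measurable M) \<and>
     (AE \<omega> in M. X 0 \<omega> = 0) \<and>
     (\<forall>\<omega>\<in>space M. cadlag (\<lambda>t. X t \<omega>)) \<and>
     (\<forall>s\<ge>0. \<forall>t\<ge>0. distr M borel (\<lambda>\<omega>. X (s + t) \<omega> - X s \<omega>) = distr M borel (X t)) \<and>
     (\<forall>(\<tau> :: nat \<Rightarrow> real) n. 0 \<le> \<tau> 0 \<longrightarrow> strict_mono \<tau> \<longrightarrow>
        prob_space.indep_vars M (\<lambda>_. borel) (\<lambda>i \<omega>. X (\<tau> (Suc i)) \<omega> - X (\<tau> i) \<omega>) {..<n})"

definition poisson_process :: "'a measure \<Rightarrow> real \<Rightarrow> (real \<Rightarrow> 'a \<Rightarrow> nat) \<Rightarrow> bool" where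
  "poisson_process M rate K \<longleftrightarrow>
     levy_process M (\<lambda>t \<omega>. real (K t \<omega>)) \<and>
     (\<forall>t>0. distr M (count_space UNIV) (K t) = measure_pmf (poisson_pmf (rate * t)))"

text \<open>Compound Poisson process with Levy measure \<open>rate * f(x) dx\<close>, where \<open>f\<close> is a
  probability density: jumps arrive at rate \<open>rate\<close> and have density \<open>f\<close>.\<close>

definition compound_poisson_process ::
    "'a measure \<Rightarrow> real \<Rightarrow> (real \<Rightarrow> real) \<Rightarrow> (real \<Rightarrow> 'a \<Rightarrow> real) \<Rightarrow> bool" where
  "compound_poisson_process M rate f Z \<longleftrightarrow>
     (\<exists>(K :: real \<Rightarrow> 'a \<Rightarrow> nat) (J :: nat \<Rightarrow> 'a \<Rightarrow> real).
        poisson_process M rate K \<and>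
        (\<forall>i. distributed M lborel (J i) (\<lambda>x. ennreal (f x))) \<and>
        prob_space.indep_vars M (\<lambda>_. borel) J UNIV \<and>
        indep_rvs M
          path_space (path_of (\<lambda>t \<omega>. real (K t \<omega>)))
          (PiM UNIV (\<lambda>_. borel)) (\<lambda>\<omega> i. J i \<omega>) \<and>
        (\<forall>t\<ge>0. \<forall>\<omega>\<in>space M. Z t \<omega> = (\<Sum>i<K t \<omega>. J i \<omega>)))"

definition subordinator_levy_measure :: "real measure \<Rightarrow> bool" where
  "subordinator_levy_measure \<nu> \<longleftrightarrow>
     sets \<nu> = sets borel \<and> emeasure \<nu> {..0} = 0 \<and>
     (\<integral>\<^sup>+ x. ennreal (min 1 x) \<partial>\<nu>) < \<infinity>"

text \<open>The exponent \<open>G\<close> of a driftless subordinator, used for real and for complex arguments.\<close>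

definition subordinator_exponent ::
    "real measure \<Rightarrow> 'a \<Rightarrow> 'a :: {real_normed_field, banach, second_countable_topology}" where
  "subordinator_exponent \<nu> r = (LINT x|\<nu>. 1 - exp (- (r * of_real x)))"

definition driftless_subordinator ::
    "'a measure \<Rightarrow> real measure \<Rightarrow> (real \<Rightarrow> 'a \<Rightarrow> real) \<Rightarrow> bool" where
  "driftless_subordinator M \<nu> S \<longleftrightarrow>
     levy_process M S \<and>
     (\<forall>\<omega>\<in>space M. mono_on {0..} (\<lambda>t. S t \<omega>)) \<and>
     subordinator_levy_measure \<nu> \<and>
     (\<forall>r\<ge>0. - ln (LINT \<omega>|M. exp (- (r * S 1 \<omega>))) = subordinator_exponent \<nu> r)"

text \<open>The meromorphic function \<open>\<Psi>\<close> on the right half-plane. Its value at the points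
  \<open>\<alpha> j\<close> is an artefact of division by zero and must not be used.\<close>

definition Psi ::
    "real \<Rightarrow> real \<Rightarrow> real poly \<Rightarrow> nat \<Rightarrow> (nat \<Rightarrow> real) \<Rightarrow> (nat \<Rightarrow> nat) \<Rightarrow> real measure
      \<Rightarrow> complex \<Rightarrow> complex" where
  "Psi c \<mu> Q N \<alpha> n \<nu> r =
     of_real c * r
     + of_real \<mu> * (poly (map_poly of_real Q) (- r) / (\<Prod>j=1..N. (of_real (\<alpha> j) - r) ^ n j) - 1)
     - subordinator_exponent \<nu> r"

definition kappa ::
    "nat \<Rightarrow> (nat \<Rightarrow> real) \<Rightarrow> (nat \<Rightarrow> nat) \<Rightarrow> nat \<Rightarrow> (nat \<Rightarrow> complex) \<Rightarrow> (nat \<Rightarrow> nat)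
      \<Rightarrow> complex \<Rightarrow> complex" where
  "kappa N \<alpha> n R \<beta> k r =
     (\<Prod>j=1..R. (\<beta> j + r) ^ k j) / (\<Prod>l=1..N. (of_real (\<alpha> l) + r) ^ n l)"

text \<open>In the bracket differentiated here, the factor \<open>(\<beta> j - s) ^ k j\<close> has been cancelled
  against the \<open>j\<close>-th factor of the denominator: uncancelled, the quotient is \<open>0 / 0\<close> at
  \<open>s = \<beta> j\<close>, where the derivative is taken.\<close>

definition E_coeff ::
    "nat \<Rightarrow> (nat \<Rightarrow> real) \<Rightarrow> (nat \<Rightarrow> nat) \<Rightarrow> nat \<Rightarrow> (nat \<Rightarrow> complex) \<Rightarrow> (nat \<Rightarrow> nat)
      \<Rightarrow> nat \<Rightarrow> nat \<Rightarrow> complex" where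
  "E_coeff N \<alpha> n R \<beta> k j a =
     of_nat ((k j - 1) choose a) * ((- 1) powi (1 - int (k j) + int a) / fact (k j - 1)) *
     (deriv ^^ (k j - 1 - a))
       (\<lambda>s. (\<Prod>l=1..N. (of_real (\<alpha> l) - s) ^ n l) / (\<Prod>l\<in>{1..R} - {j}. (\<beta> l - s) ^ k l))
       (\<beta> j)"

text \<open>The sum is real when the \<open>\<beta> j\<close> come in conjugate pairs of equal multiplicity, as the
  roots of \<open>\<Psi> - q\<close> do; \<open>Re\<close> only changes the type. The inner
  integral omits \<open>y = u\<close>; an atom of \<open>\<nu>\<close> there affects countably many \<open>u\<close> only.\<close>

definition chi ::
    "nat \<Rightarrow> (nat \<Rightarrow> real) \<Rightarrow> (nat \<Rightarrow> nat) \<Rightarrow> nat \<Rightarrow> (nat \<Rightarrow> complex) \<Rightarrow> (nat \<Rightarrow> nat) \<Rightarrow> real measure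
      \<Rightarrow> real \<Rightarrow> real" where
  "chi N \<alpha> n R \<beta> k \<nu> u =
     Re (\<Sum>j=1..R. \<Sum>a=0..k j - 1. E_coeff N \<alpha> n R \<beta> k j a *
       (LINT y:{u<..}|\<nu>. of_real (y - u) ^ a * exp (- (\<beta> j * of_real (y - u)))))"

text \<open>\<open>F\<close> is the distribution function of a subexponential law on \<open>[0, \<infinity>)\<close>. Since \<open>x / 0 = 0\<close>,
  the limit forces the tail \<open>1 - F\<close> to be positive everywhere.\<close>

definition subexponential_df :: "(real \<Rightarrow> real) \<Rightarrow> bool" where
  "subexponential_df F \<longleftrightarrow>
     (\<exists>D. real_distribution D \<and> measure D {..<0} = 0 \<and> cdf D = F \<and>
        ((\<lambda>x. (1 - cdf (D \<star> D) x) / (1 - F x)) \<longlongrightarrow> 2) at_top)"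

end

theory Submission
  imports Defs
begin

text \<open>
  Write \<open>P\<close> and \<open>B\<close> for the polynomials with zeros \<open>\<alpha>\<^sub>l\<close> and \<open>\<beta>\<^sub>j\<close>. Partial fractions of \<open>P / B\<close>
  turn the transform of \<open>\<chi>\<close> into a combination of values of the exponent of \<open>\<S>\<close>, and counting zeros
  gives \<open>(q - \<Psi>) P = (c - hat \<chi>) B\<close> on the right half-plane. On the other side, sampling the infimum
  \<open>I\<close> on a grid turns exponential killing into geometric killing, under which the law of the discrete
  minimum is a fixed point of one Lindley step. In the limit of fine grids, with \<open>J\<close> a jump of \<open>\<Z>\<close>
  independent of \<open>I\<close>, there is a constant \<open>d\<close> such that
  \<open>(q - \<Psi>(z)) E[exp (z I)] = q - d z + \<lambda> E[1 - exp (z max(0, J + I))]\<close> on the imaginary axis.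
  There the function \<open>(c - hat \<chi>(z)) E[exp (z I)]\<close>, bounded and holomorphic on the right half-plane,
  equals \<open>P / B\<close> times the right-hand side, which extends to the left half-plane as a bounded function.
  By Liouville it is constant, so \<open>- I\<close> is a geometric compound with ladder height density
  proportional to \<open>\<chi>\<close>. The renewal equation of such a compound determines its tail when the ladder
  height law is subexponential.
\<close>

section \<open>Defective renewal equations with subexponential input\<close>

text \<open>Two quantities are never identified directly. The constant \<open>d\<close> measures how
  strongly steps without a jump push the walk above 0. No limit theorem is at hand for it, but it
  enters with a factor \<open>z\<close> and all other terms converge, so the identity at one point
  yields its existence. It does no harm afterwards: \<open>B\<close> has one zero more than
  \<open>P\<close>, so \<open>P / B\<close> absorbs the linear growth, and at 0 the term vanishes.
  The other is the sign of \<open>\<chi>\<close>, a combination of complex exponential integrals.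
  That \<open>\<chi>\<close> is a density up to a factor is read off from the subexponential law
  whose tail it generates; that its mass lies between 0 and \<open>c\<close> follows by letting
  \<open>z\<close> tend to infinity, which exhibits \<open>1 - hat \<chi>(0) / c\<close> as the
  probability of \<open>I = 0\<close>. The value of the limit: the compound has parameter
  \<open>p = hat \<chi>(0) / c\<close> and ratio \<open>p / (1 - p)\<close> against the normalised
  tail, that is \<open>1 / (c - hat \<chi>(0))\<close> against the tail of \<open>\<chi>\<close>,
  and the identity at 0 gives \<open>c - hat \<chi>(0) = q P(0) / B(0)\<close>.\<close>

lemma convolution_tail:
  fixes M D :: "real measure"
  assumes "real_distribution M" "real_distribution D"
  shows "measure (M \<star> D) {u<..} = (LINT y|D. measure M {u - y<..})"
proof -
  interpret M: real_distribution M by fact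
  interpret D: real_distribution D by fact
  interpret P: pair_prob_space M D ..
  interpret P': pair_prob_space D M ..
  have [measurable_cong]: "sets M = sets borel" "sets D = sets borel" by auto
  have "emeasure (M \<star> D) {u<..} = emeasure (D \<star> M) {u<..}"
    by (subst convolution_commutative) (auto intro: M.finite_measure_axioms D.finite_measure_axioms)
  also have "\<dots> = (\<integral>\<^sup>+ y. emeasure M {a. a + y \<in> {u<..}} \<partial>D)"
    by (subst convolution_emeasure) (auto intro: M.finite_measure_axioms D.finite_measure_axioms)
  also have "\<dots> = (\<integral>\<^sup>+ y. ennreal (measure M {u - y<..}) \<partial>D)"
    by (intro nn_integral_cong) (auto simp: M.emeasure_eq_measure intro!: arg_cong[where f="measure M"])
  finally have *: "emeasure (M \<star> D) {u<..} = (\<integral>\<^sup>+ y. ennreal (measure M {u - y<..}) \<partial>D)" .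
  have "(\<lambda>u. measure M {u<..}) \<in> borel_measurable borel"
    by (rule borel_measurable_uminus_eq[THEN iffD1], rule borel_measurable_mono)
       (auto intro!: monoI M.finite_measure_mono)
  then have "(\<lambda>y. measure M {u - y<..}) \<in> borel_measurable D"
    by measurable
  then show ?thesis
    unfolding measure_def * by (subst integral_eq_nn_integral) (auto simp: measure_def)
qed

text \<open>\<open>m\<close> stands for the tail of the geometric compound of \<open>D\<close>. The
  form of \<open>subexp\<close> comes from splitting the tail of \<open>D \<star> D\<close> at
  \<open>u\<close> into \<open>f u\<close> and the integral over \<open>y \<le> u\<close>, which
  turns the limit 2 into 1.\<close>

locale defective_renewal =
  fixes f m :: "real \<Rightarrow> real" and D :: "real measure" and p :: real
  assumes D: "real_distribution D"
    and f_def: "f = (\<lambda>u. measure D {u<..})"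
    and D_nonneg: "measure D {..<0} = 0"
    and f_pos: "\<And>u. 0 < f u"
    and m_antimono: "antimono m" and m_nonneg: "\<And>u. 0 \<le> m u" and m_le_1: "\<And>u. m u \<le> 1"
    and p: "0 < p" "p < 1"
    and renewal: "\<And>u. 0 \<le> u \<Longrightarrow> m u = p * (f u + (LINT y|D. indicator {..u} y * m (u - y)))"
    and subexp: "((\<lambda>u. (LINT y|D. indicator {..u} y * f (u - y)) / f u) \<longlongrightarrow> 1) at_top"
begin

sublocale D: real_distribution D by (rule D)

lemma f_antimono: "antimono f"
  unfolding f_def by (intro antimonoI D.finite_measure_mono) auto

lemma f_le_1: "f u \<le> 1"
  unfolding f_def by simp

lemma measurable_antimono: "antimono g \<Longrightarrow> g \<in> borel_measurable borel" for g :: "real \<Rightarrow> real"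
  by (rule borel_measurable_uminus_eq[THEN iffD1], rule borel_measurable_mono)
     (auto simp: monotone_def)

lemma integrable_reflected:
  assumes "antimono g" "\<And>u. 0 \<le> g u" "\<And>u. g u \<le> 1" "A \<in> sets borel"
  shows "integrable D (\<lambda>y. indicator A y * g (u - y) :: real)"
proof (rule D.integrable_const_bound[where B=1])
  have [measurable]: "g \<in> borel_measurable borel" "A \<in> sets borel" using assms measurable_antimono by auto
  show "(\<lambda>y. indicator A y * g (u - y) :: real) \<in> borel_measurable D" by measurable
  show "AE x in D. norm (indicator A x * g (u - x)) \<le> 1"
    using assms by (auto simp: indicator_def)
qed

lemmas m_int = integrable_reflected[OF m_antimono m_nonneg m_le_1]
lemmas f_int = integrable_reflected[OF f_antimono less_imp_le[OF f_pos] f_le_1]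

lemma measure_Ioc: "a \<le> b \<Longrightarrow> measure D {a<..b} = f a - f b"
proof -
  assume "a \<le> b"
  then have "{a<..} = {a<..b} \<union> {b<..}" by auto
  then have "f a = measure D ({a<..b} \<union> {b<..})" by (simp add: f_def)
  also have "\<dots> = measure D {a<..b} + f b"
    unfolding f_def by (rule D.finite_measure_Union) auto
  finally have "f a = measure D {a<..b} + f b" .
  then show ?thesis by simp
qed

lemma measure_atMost: "measure D {..v} = 1 - f v"
proof -
  have "{..v} = UNIV - {v<..}" by auto
  then show ?thesis unfolding f_def using D.prob_compl[of "{v<..}"] by simp
qed

lemma AE_D_nonneg: "AE y in D. 0 \<le> y"
  by (rule AE_I'[of "{..<0}"]) (auto simp: null_sets_def D.emeasure_eq_measure D_nonneg)

lemma f_tendsto_0: "(f \<longlongrightarrow> 0) at_top"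
proof -
  have "((\<lambda>u. 1 - cdf D u) \<longlongrightarrow> 1 - 1) at_top" by (intro tendsto_intros D.cdf_lim_at_top_prob)
  then show ?thesis by (simp add: cdf_def measure_atMost)
qed

definition "T u = (LINT y|D. indicator {..u} y * f (u - y)) / f u"

text \<open>Subexponentiality forces insensitivity to shifts. In the integral behind
  \<open>T u\<close>, \<open>f (u - y)\<close> is at least \<open>f u\<close> for
  \<open>y \<le> v\<close> and at least \<open>f (u - v)\<close> for \<open>v < y \<le> u\<close>;
  solving for \<open>f (u - v) / f u\<close> gives an upper bound that tends to
  \<open>f v / f v\<close>.\<close>

lemma long_tailed:
  assumes "0 \<le> v" shows "((\<lambda>u. f (u - v) / f u) \<longlongrightarrow> 1) at_top"
proof (rule tendsto_sandwich)
  show "\<forall>\<^sub>F u in at_top. 1 \<le> f (u - v) / f u"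
    using assms f_pos antimonoD[OF f_antimono] by (intro always_eventually) (auto simp: field_simps)
  have lt: "\<forall>\<^sub>F u in at_top. f u < f v"
    using order_tendstoD(2)[OF f_tendsto_0 f_pos] .
  show "\<forall>\<^sub>F u in at_top. f (u - v) / f u \<le> (T u - (1 - f v)) / (f v - f u)"
    using lt eventually_ge_at_top[of v]
  proof eventually_elim
    case (elim u)
    have "(LINT y|D. indicator {..v} y * f u + indicator {v<..u} y * f (u - v))
        \<le> (LINT y|D. indicator {..u} y * f (u - y))"
    proof (rule integral_mono_AE)
      show "integrable D (\<lambda>y. indicat_real {..u} y * f (u - y))" by (rule f_int) auto
      show "integrable D (\<lambda>y. indicat_real {..v} y * f u + indicat_real {v<..u} y * f (u - v))"
        by (auto intro!: Bochner_Integration.integrable_add integrable_mult_left D.emeasure_finite simp: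
            less_top[symmetric])
      show "AE y in D. indicat_real {..v} y * f u + indicat_real {v<..u} y * f (u - v)
         \<le> indicat_real {..u} y * f (u - y)"
        using AE_D_nonneg
      proof eventually_elim
        case (elim y)
        have "y \<le> v \<or> v < y \<and> y \<le> u \<or> u < y" using \<open>v \<le> u\<close> by auto
        then show ?case using elim \<open>v \<le> u\<close> assms
          by (auto simp: indicator_def intro!: antimonoD[OF f_antimono])
      qed
    qed
    also have "(LINT y|D. indicator {..v} y * f u + indicator {v<..u} y * f (u - v))
       = (1 - f v) * f u + (f v - f u) * f (u - v)"
      by (subst Bochner_Integration.integral_add)
         (auto intro!: integrable_mult_left D.emeasure_finite simp: less_top[symmetric] measure_Ioc
             measure_atMost elim)
    finally have "(1 - f v) * f u + (f v - f u) * f (u - v) \<le> T u * f u"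
      using f_pos[of u] by (simp add: T_def)
    then show ?case using f_pos[of u] elim by (simp add: field_simps)
  qed
  have "((\<lambda>u. (T u - (1 - f v)) / (f v - f u)) \<longlongrightarrow> (1 - (1 - f v)) / (f v - 0)) at_top"
    using f_pos[of v] by (intro tendsto_intros f_tendsto_0 subexp[folded T_def]) auto
  then show "((\<lambda>u. (T u - (1 - f v)) / (f v - f u)) \<longlongrightarrow> 1) at_top" using f_pos[of v] by simp
qed simp

text \<open>The part of \<open>T\<close> in which the argument \<open>u - y\<close> stays at least
  \<open>v\<close>, so that a bound for \<open>m / f\<close> valid beyond \<open>v\<close> may be
  inserted under the integral.\<close>

definition "Tv v u = (LINT y|D. indicator {..u - v} y * f (u - y)) / f u"

lemma integral_split:
  assumes "antimono g" "\<And>u. 0 \<le> g u" "\<And>u. g u \<le> 1" "0 \<le> v"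
  shows "(LINT y|D. indicator {..u} y * g (u - y)) =
    (LINT y|D. indicator {..u - v} y * g (u - y)) + (LINT y|D. indicator {u - v<..u} y * g (u - y) :: real)"
proof -
  note int = integrable_reflected[OF assms(1-3)]
  show ?thesis
    using assms(4)
    by (subst Bochner_Integration.integral_add[symmetric, OF int int])
       (auto intro!: Bochner_Integration.integral_cong simp: indicator_def)
qed

text \<open>On the strip \<open>u - v < y \<le> u\<close> a constant bound for
  \<open>g (u - y)\<close> is enough: its \<open>D\<close>-mass \<open>f (u - v) - f u\<close> is
  negligible against \<open>f u\<close> by \<open>long_tailed\<close>.\<close>

lemma strip_bounds:
  assumes "antimono g" "\<And>u. 0 \<le> g u" "\<And>u. g u \<le> C * f u" "\<And>u. g u \<le> 1" "0 \<le> v" "0 \<le> C"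
  shows "0 \<le> (LINT y|D. indicator {u - v<..u} y * g (u - y) :: real)" (is ?A)
    "(LINT y|D. indicator {u - v<..u} y * g (u - y)) \<le> C * (f (u - v) - f u)" (is ?B)
proof -
  show ?A using assms by (intro integral_nonneg_AE) auto
  have "(LINT y|D. indicator {u - v<..u} y * g (u - y)) \<le> (LINT y|D. C * indicator {u - v<..u} y)"
  proof (rule integral_mono)
    fix y
    have "g (u - y) \<le> C * 1" using assms(3)[of "u - y"] mult_left_mono[OF f_le_1 assms(6), of "u - y"]
        by linarith
    then show "indicator {u - v<..u} y * g (u - y) \<le> C * indicator {u - v<..u} y"
        by (auto simp: indicator_def)
  qed (use assms in \<open>auto intro!: integrable_reflected[OF assms(1,2,4)] integrable_mult_right
      D.emeasure_finite simp: less_top[symmetric]\<close>)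
  also have "\<dots> = C * (f (u - v) - f u)" using assms by (simp add: measure_Ioc)
  finally show ?B .
qed

lemma Tv_tendsto: assumes "0 \<le> v" shows "(Tv v \<longlongrightarrow> 1) at_top"
proof (rule tendsto_sandwich)
  define s where "s u = (LINT y|D. indicator {u - v<..u} y * f (u - y))" for u
  have s: "0 \<le> s u" "s u \<le> f (u - v) - f u" for u
    unfolding s_def
    using strip_bounds[OF f_antimono less_imp_le[OF f_pos] _ f_le_1 assms, of 1] by auto
  have T: "T u = Tv v u + s u / f u" for u
    unfolding T_def Tv_def s_def
    by (simp only: integral_split[OF f_antimono less_imp_le[OF f_pos] f_le_1 assms] add_divide_distrib)
  have "s u / f u \<le> (f (u - v) - f u) / f u" for u
    using s f_pos[of u] by (intro divide_right_mono) auto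
  then have "s u / f u \<le> f (u - v) / f u - 1" for u
    by (simp add: diff_divide_distrib less_imp_neq[OF f_pos, symmetric])
  then have "T u - (f (u - v) / f u - 1) \<le> Tv v u" for u
    unfolding T by (smt (verit))
  then show "\<forall>\<^sub>F u in at_top. T u - (f (u - v) / f u - 1) \<le> Tv v u"
    by (intro always_eventually allI)
  show "\<forall>\<^sub>F u in at_top. Tv v u \<le> T u"
    using s f_pos by (intro always_eventually allI) (simp add: T less_imp_le)
  have "((\<lambda>u. T u - (f (u - v) / f u - 1)) \<longlongrightarrow> 1 - (1 - 1)) at_top"
    by (intro tendsto_intros subexp[folded T_def] long_tailed assms)
  then show "((\<lambda>u. T u - (f (u - v) / f u - 1)) \<longlongrightarrow> 1) at_top" by simp
qed (rule subexp[folded T_def])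

text \<open>An a priori bound, without which the strip could not be discarded for \<open>m\<close>.
  The renewal equation bounds the supremum of \<open>m / f\<close> over \<open>u \<le> U\<close> by
  an affine function of itself with slope \<open>p (1 + \<epsilon>) < 1\<close>. That supremum is
  finite because \<open>f U\<close> is positive, and the bound so obtained does not depend on
  \<open>U\<close>.\<close>

lemma ratio_bounded: "\<exists>C\<ge>1. \<forall>u. m u \<le> C * f u"
proof -
  \<comment> \<open>This makes \<open>p (1 + \<epsilon>)\<close> the midpoint of \<open>p\<close>
    and 1.\<close>
  define \<epsilon> where "\<epsilon> = (1 / p - 1) / 2"
  have e: "0 < \<epsilon>" "p * (1 + \<epsilon>) < 1" using p by (auto simp: \<epsilon>_def field_simps)
  have "\<forall>\<^sub>F u in at_top. T u < 1 + \<epsilon>"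
    using order_tendstoD(2)[OF subexp[folded T_def]] e by auto
  then obtain u0 where u0: "\<And>u. u0 \<le> u \<Longrightarrow> T u \<le> 1 + \<epsilon>"
    unfolding eventually_at_top_linorder by (meson less_imp_le)
  define u1 where "u1 = max u0 0"
  \<comment> \<open>The first entry serves \<open>u \<le> u1\<close>, where only
    \<open>m \<le> 1\<close> is used; the second is the fixed point of
    \<open>S = p (1 + S (1 + \<epsilon>))\<close>.\<close>
  define C where "C = max (1 / f u1) (p / (1 - p * (1 + \<epsilon>)))"
  have C1: "1 \<le> C" using f_le_1[of u1] f_pos[of u1]
      by (auto simp: C_def field_simps intro!: max.coboundedI1)
  have small: "m u \<le> C * f u" if "u \<le> u1" for u
  proof -
    have "m u \<le> 1" by (rule m_le_1)
    also have "1 \<le> C * f u1" using f_pos[of u1] by (simp add: C_def field_simps max_def)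
    also have "\<dots> \<le> C * f u" using C1 that antimonoD[OF f_antimono] by (intro mult_left_mono) auto
    finally show ?thesis .
  qed
  have "m U \<le> C * f U" for U
  proof (cases "U \<le> u1")
    case False
    define S where "S = (SUP u\<in>{..U}. m u / f u)"
    have bdd: "bdd_above ((\<lambda>u. m u / f u) ` {..U})"
    proof (rule bdd_aboveI2)
      fix u assume "u \<in> {..U}"
      then have "f U \<le> f u" using antimonoD[OF f_antimono] by auto
      then have "m u / f u \<le> 1 / f U" using f_pos m_le_1[of u] m_nonneg[of u] by (intro frac_le) auto
      then show "m u / f u \<le> 1 / f U" .
    qed
    have le: "m u \<le> S * f u" if "u \<le> U" for u
      using cSUP_upper[OF _ bdd, of u] that f_pos[of u] by (simp add: S_def field_simps)
    have S0: "0 \<le> S" using le[of U] m_nonneg[of U] f_pos[of U]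
        by (metis le_less_trans linorder_not_le mult_neg_pos order.refl)
    have "S \<le> max C (p * (1 + S * (1 + \<epsilon>)))"
      unfolding S_def
    proof (rule cSUP_least)
      fix u assume u: "u \<in> {..U}"
      show "m u / f u \<le> max C (p * (1 + (SUP u\<in>{..U}. m u / f u) * (1 + \<epsilon>)))"
      proof (cases "u \<le> u1")
        case True
        then show ?thesis using small[OF True] f_pos[of u]
          by (intro max.coboundedI1) (simp add: divide_le_eq)
      next
        case F: False
        then have "0 \<le> u" by (simp add: u1_def)
        have "(LINT y|D. indicator {..u} y * m (u - y)) \<le> (LINT y|D. S * (indicator {..u} y * f (u - y)))"
        proof (rule integral_mono_AE)
          show "AE y in D. indicator {..u} y * m (u - y) \<le> S * (indicator {..u} y * f (u - y))"
            using AE_D_nonneg by eventually_elim (use u in \<open>auto simp: indicator_def intro!: le\<close>)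
        qed (auto intro!: m_int f_int integrable_mult_right)
        also have "\<dots> = S * (T u * f u)" using f_pos[of u] by (simp add: T_def)
        also have "\<dots> \<le> S * ((1 + \<epsilon>) * f u)"
          using F S0 f_pos[of u] u0
              by (intro mult_left_mono mult_right_mono) (auto simp: u1_def intro: less_imp_le)
        finally have "m u \<le> p * (f u + S * ((1 + \<epsilon>) * f u))"
          using p renewal[OF \<open>0 \<le> u\<close>] by simp
        then have "m u / f u \<le> p * (1 + S * (1 + \<epsilon>))"
          using f_pos[of u] by (simp add: field_simps)
        then show ?thesis by (simp add: S_def max.coboundedI2)
      qed
    qed simp
    then have "S \<le> C"
    proof (cases "S \<le> C")
      case False
      then have "S \<le> p * (1 + S * (1 + \<epsilon>))" using \<open>S \<le> max _ _\<close> by auto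
      then have "S * (1 - p * (1 + \<epsilon>)) \<le> p" by (simp add: algebra_simps)
      then have "S \<le> p / (1 - p * (1 + \<epsilon>))" using e by (simp add: pos_le_divide_eq)
      then show ?thesis by (simp add: C_def)
    qed
    then show ?thesis using le[of U] f_pos[of U]
        by (meson less_imp_le mult_right_mono order.refl order_trans)
  qed (rule small)
  then show ?thesis using C1 by auto
qed

text \<open>Inserting an eventual bound \<open>b\<close> into the renewal equation replaces it by
  \<open>p (1 + b)\<close>: the main part \<open>Tv v u\<close> tends to 1 and the strip disappears
  in the limit; \<open>\<epsilon>\<close> pays for both limits. In the lower counterpart the strip
  is dropped because it is nonnegative.\<close>

lemma ratio_upper_step:
  assumes b: "\<forall>\<^sub>F u in at_top. m u / f u \<le> b" and "0 < \<epsilon>"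
  shows "\<forall>\<^sub>F u in at_top. m u / f u \<le> p * (1 + b) + \<epsilon>"
proof -
  obtain C where C: "1 \<le> C" "\<And>u. m u \<le> C * f u" using ratio_bounded by auto
  obtain v where v: "0 \<le> v" "\<And>u. v \<le> u \<Longrightarrow> m u \<le> b * f u"
  proof -
    obtain v0 where "\<And>u. v0 \<le> u \<Longrightarrow> m u / f u \<le> b" using b unfolding eventually_at_top_linorder by auto
    then have "\<And>u. max 0 v0 \<le> u \<Longrightarrow> m u \<le> b * f u" using f_pos by (simp add: field_simps)
    then show ?thesis using that[of "max 0 v0"] by auto
  qed
  have "((\<lambda>u. p * (1 + b * Tv v u + C * (f (u - v) / f u - 1))) \<longlongrightarrow> p * (1 + b * 1 + C * (1 - 1))) at_top"
    by (intro tendsto_intros Tv_tendsto long_tailed v)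
  from order_tendstoD(2)[OF this, of "p * (1 + b) + \<epsilon>"] \<open>0 < \<epsilon>\<close>
  have "\<forall>\<^sub>F u in at_top. p * (1 + b * Tv v u + C * (f (u - v) / f u - 1)) < p * (1 + b) + \<epsilon>" by simp
  then show ?thesis using eventually_ge_at_top[of 0]
  proof eventually_elim
    case (elim u)
    have "(LINT y|D. indicator {..u - v} y * m (u - y)) \<le>
        (LINT y|D. b * (indicator {..u - v} y * f (u - y)))"
      by (rule integral_mono[OF m_int integrable_mult_right[OF f_int]]) (auto intro!: v simp: indicator_def)
    then have "(LINT y|D. indicator {..u - v} y * m (u - y)) \<le> b * (Tv v u * f u)"
      using f_pos[of u] by (simp add: Tv_def)
    then have "m u \<le> p * (f u + (b * (Tv v u * f u) + C * (f (u - v) - f u)))"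
      using renewal[OF elim(2)] integral_split[OF m_antimono m_nonneg m_le_1 v(1), of u]
        strip_bounds(2)[OF m_antimono m_nonneg C(2) m_le_1 v(1), of u] C(1) p by simp
    then have "m u / f u \<le> p * (1 + b * Tv v u + C * (f (u - v) / f u - 1))"
      using f_pos[of u] by (simp add: field_simps)
    then show ?case using elim by simp
  qed
qed

lemma ratio_lower_step:
  assumes b: "\<forall>\<^sub>F u in at_top. b \<le> m u / f u" and "0 < \<epsilon>"
  shows "\<forall>\<^sub>F u in at_top. p * (1 + b) - \<epsilon> \<le> m u / f u"
proof -
  obtain C where C: "1 \<le> C" "\<And>u. m u \<le> C * f u" using ratio_bounded by auto
  obtain v where v: "0 \<le> v" "\<And>u. v \<le> u \<Longrightarrow> b * f u \<le> m u"
  proof -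
    obtain v0 where "\<And>u. v0 \<le> u \<Longrightarrow> b \<le> m u / f u" using b unfolding eventually_at_top_linorder by auto
    then have "\<And>u. max 0 v0 \<le> u \<Longrightarrow> b * f u \<le> m u" using f_pos by (simp add: field_simps)
    then show ?thesis using that[of "max 0 v0"] by auto
  qed
  have "((\<lambda>u. p * (1 + b * Tv v u)) \<longlongrightarrow> p * (1 + b * 1)) at_top"
    by (intro tendsto_intros Tv_tendsto v)
  from order_tendstoD(1)[OF this, of "p * (1 + b) - \<epsilon>"] \<open>0 < \<epsilon>\<close>
  have "\<forall>\<^sub>F u in at_top. p * (1 + b) - \<epsilon> < p * (1 + b * Tv v u)" by simp
  then show ?thesis using eventually_ge_at_top[of 0]
  proof eventually_elim
    case (elim u)
    have "(LINT y|D. b * (indicator {..u - v} y * f (u - y))) \<le>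
        (LINT y|D. indicator {..u - v} y * m (u - y))"
      by (rule integral_mono[OF integrable_mult_right[OF f_int] m_int]) (auto intro!: v simp: indicator_def)
    then have "b * (Tv v u * f u) \<le> (LINT y|D. indicator {..u - v} y * m (u - y))"
      using f_pos[of u] by (simp add: Tv_def)
    then have "p * (f u + b * (Tv v u * f u)) \<le> m u"
      using renewal[OF elim(2)] integral_split[OF m_antimono m_nonneg m_le_1 v(1), of u]
        strip_bounds(1)[OF m_antimono m_nonneg C(2) m_le_1 v(1), of u] C(1) p by simp
    then have "p * (1 + b * Tv v u) \<le> m u / f u"
      using f_pos[of u] by (simp add: field_simps)
    then show ?case using elim by simp
  qed
qed

text \<open>\<open>Inf U\<close> and \<open>Sup L\<close> are the limsup and liminf, real because
  the ratio stays in \<open>[0, C]\<close>. The two steps give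
  \<open>Inf U \<le> p (1 + Inf U)\<close> and \<open>p (1 + Sup L) \<le> Sup L\<close>, and the
  contraction \<open>b \<mapsto> p (1 + b)\<close> has \<open>p / (1 - p)\<close> as its only fixed
  point.\<close>

theorem ratio_tendsto: "((\<lambda>u. m u / f u) \<longlongrightarrow> p / (1 - p)) at_top"
proof (rule order_tendstoI)
  obtain C where C: "1 \<le> C" "\<And>u. m u \<le> C * f u" using ratio_bounded by auto
  have r0: "0 \<le> m u / f u" and rC: "m u / f u \<le> C" for u
    using C f_pos[of u] m_nonneg[of u] by (auto simp: field_simps)
  define U where "U = {b. \<forall>\<^sub>F u in at_top. m u / f u \<le> b}"
  define L where "L = {b. \<forall>\<^sub>F u in at_top. b \<le> m u / f u}"
  have "C \<in> U" "0 \<in> L" using r0 rC by (auto simp: U_def L_def)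
  have U: "bdd_below U"
  proof (rule bdd_belowI[of _ 0])
    fix b assume "b \<in> U"
    then obtain u where "m u / f u \<le> b" unfolding U_def
        using eventually_happens'[OF trivial_limit_at_top_linorder] by blast
    then show "0 \<le> b" using r0[of u] by linarith
  qed
  have L: "bdd_above L"
  proof (rule bdd_aboveI[of _ C])
    fix b assume "b \<in> L"
    then obtain u where "b \<le> m u / f u" unfolding L_def
        using eventually_happens'[OF trivial_limit_at_top_linorder] by blast
    then show "b \<le> C" using rC[of u] by linarith
  qed
  have "Inf U \<le> p * (1 + b) + \<epsilon>" if "b \<in> U" "0 < \<epsilon>" for b \<epsilon>
    using cInf_lower[OF _ U] ratio_upper_step[of b \<epsilon>] that unfolding U_def by auto
  then have "Inf U \<le> p * (1 + b)" if "b \<in> U" for b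
    using that by (meson field_le_epsilon)
  then have "(Inf U - p) / p \<le> b" if "b \<in> U" for b using that p by (simp add: field_simps)
  then have "(Inf U - p) / p \<le> Inf U" using \<open>C \<in> U\<close> by (intro cInf_greatest) auto
  then have infU: "Inf U \<le> p / (1 - p)" using p by (simp add: field_simps)
  have "p * (1 + b) - \<epsilon> \<le> Sup L" if "b \<in> L" "0 < \<epsilon>" for b \<epsilon>
    using cSup_upper[OF _ L] ratio_lower_step[of b \<epsilon>] that unfolding L_def by auto
  then have "p * (1 + b) \<le> Sup L" if "b \<in> L" for b
    using that field_le_epsilon[of "p * (1 + b)" "Sup L"] by (metis diff_le_eq)
  then have "b \<le> (Sup L - p) / p" if "b \<in> L" for b using that p by (simp add: field_simps)
  then have "Sup L \<le> (Sup L - p) / p" using \<open>0 \<in> L\<close> by (intro cSup_least) auto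
  then have supL: "p / (1 - p) \<le> Sup L" using p by (simp add: field_simps)
  show "\<forall>\<^sub>F u in at_top. a < m u / f u" if a: "a < p / (1 - p)" for a
  proof -
    obtain b where b: "b \<in> L" "a < b" using less_cSup_iff[of L a] \<open>0 \<in> L\<close> L a supL by fastforce
    then have "\<forall>\<^sub>F u in at_top. b \<le> m u / f u" by (simp add: L_def)
    then show ?thesis by eventually_elim (use b in simp)
  qed
  show "\<forall>\<^sub>F u in at_top. m u / f u < a" if a: "p / (1 - p) < a" for a
  proof -
    obtain b where b: "b \<in> U" "b < a" using cInf_less_iff[of U a] \<open>C \<in> U\<close> U a infU by fastforce
    then have "\<forall>\<^sub>F u in at_top. m u / f u \<le> b" by (simp add: U_def)
    then show ?thesis by eventually_elim (use b in simp)
  qed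
qed

end

text \<open>Below 0 the tail of a law on the nonnegative half-line is 1, so in the tail of a
  convolution with \<open>D\<close> the values \<open>y > u\<close> contribute exactly the tail of
  \<open>D\<close>. This turns the convolutions into the one-sided integrals of the locale.\<close>

theorem compound_geometric_tail_asymptotics:
  fixes M D :: "real measure"
  assumes M: "real_distribution M" and D: "real_distribution D"
    and M0: "measure M {..<0} = 0" and D0: "measure D {..<0} = 0"
    and p: "0 < p" "p < 1"
    and renewal: "\<And>u. 0 \<le> u \<Longrightarrow> measure M {u<..} = p * measure (M \<star> D) {u<..}"
    and subexp: "((\<lambda>u. (1 - cdf (D \<star> D) u) / (1 - cdf D u)) \<longlongrightarrow> 2) at_top"
  shows "((\<lambda>u. measure M {u<..} / measure D {u<..}) \<longlongrightarrow> p / (1 - p)) at_top"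
proof -
  interpret M: real_distribution M by fact
  interpret D: real_distribution D by fact
  interpret DD: real_distribution "D \<star> D"
    unfolding convolution_def
  proof -
    interpret pair_prob_space D D ..
    show "real_distribution (distr (D \<Otimes>\<^sub>M D) borel (\<lambda>(x, y). x + y))"
      by (rule real_distribution_distr) simp
  qed
  have cd: "1 - cdf N u = measure N {u<..}" if "real_distribution N" for N u
  proof -
    interpret N: real_distribution N by fact
    have "{u<..} = UNIV - {..u}" by auto
    then show ?thesis using N.prob_compl[of "{..u}"] by (simp add: cdf_def)
  qed
  have neg: "measure N {u<..} = 1" if "real_distribution N" "measure N {..<0} = 0" "u < 0" for N u
  proof -
    interpret N: real_distribution N by fact
    have "{..u} \<subseteq> {..<0}" using that by auto
    then have "measure N {..u} = 0" using that(2) N.finite_measure_mono[of "{..u}" "{..<0}"]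
        by (simp add: measure_le_0_iff)
    then show ?thesis using cd[OF that(1), of u] by (simp add: cdf_def)
  qed
  have conv: "measure (N \<star> D) {u<..} =
      measure D {u<..} + (LINT y|D. indicator {..u} y * measure N {u - y<..})"
    if N: "real_distribution N" "measure N {..<0} = 0" for N u
  proof -
    interpret N: real_distribution N by fact
    have meas: "(\<lambda>u. measure N {u<..}) \<in> borel_measurable borel"
      by (rule borel_measurable_uminus_eq[THEN iffD1], rule borel_measurable_mono)
         (auto intro!: monoI N.finite_measure_mono)
    have "measure (N \<star> D) {u<..} =
        (LINT y|D. indicator {u<..} y + indicator {..u} y * measure N {u - y<..})"
      unfolding convolution_tail[OF N(1) D]
      by (intro Bochner_Integration.integral_cong refl) (auto simp: indicator_def neg[OF N])
    also have "\<dots> = measure D {u<..} + (LINT y|D. indicator {..u} y * measure N {u - y<..})"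
      by (subst Bochner_Integration.integral_add)
         (use meas in \<open>auto intro!: D.integrable_const_bound[where B=1] D.emeasure_finite simp:
             less_top[symmetric] indicator_def\<close>)
    finally show ?thesis .
  qed
  have f_pos: "0 < measure D {u<..}" for u
  proof -
    \<comment> \<open>A vanishing denominator would make the quotient 0, so the limit 2 forces the
      tail to be positive far out; monotonicity carries this to every \<open>u\<close>.\<close>
    have "\<forall>\<^sub>F u in at_top. 1 < (1 - cdf (D \<star> D) u) / (1 - cdf D u)"
      using order_tendstoD(1)[OF subexp, of 1] by simp
    then have "\<forall>\<^sub>F v in at_top. 0 < measure D {v<..}"
      by eventually_elim (use cd[OF D] in \<open>auto simp: zero_less_measure_iff\<close>)
    then obtain v where v: "u \<le> v" "0 < measure D {v<..}"
      unfolding eventually_at_top_linorder by (metis linorder_le_cases order.refl)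
    then have "measure D {v<..} \<le> measure D {u<..}" by (intro D.finite_measure_mono) auto
    then show ?thesis using v by simp
  qed
  have "((\<lambda>u. (1 - cdf (D \<star> D) u) / (1 - cdf D u) - 1) \<longlongrightarrow> 2 - 1) at_top"
    by (intro tendsto_intros subexp)
  also have "(\<lambda>u. (1 - cdf (D \<star> D) u) / (1 - cdf D u) - 1) =
     (\<lambda>u. (LINT y|D. indicator {..u} y * measure D {u - y<..}) / measure D {u<..})"
    using f_pos by (intro ext) (simp add: cd[OF D] cd[OF DD.real_distribution_axioms] conv[OF D D0]
        field_simps less_imp_neq[symmetric])
  finally have se: "((\<lambda>u. (LINT y|D. indicator {..u} y * measure D {u - y<..}) / measure D {u<..}) \<longlongrightarrow>
      1) at_top"
    by simp
  interpret defective_renewal "\<lambda>u. measure D {u<..}" "\<lambda>u. measure M {u<..}" D p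
    by unfold_locales
       (use D0 f_pos p renewal se in \<open>auto simp: conv[OF M M0] intro!: antimonoI M.finite_measure_mono\<close>)
  show ?thesis by (rule ratio_tendsto)
qed

section \<open>Parametric integrals and functions on two half-planes\<close>

lemma norm_exp_minus_1_le:
  assumes "Re z \<le> 0"
  shows "norm (exp z - 1) \<le> norm z" "norm (exp z - 1) \<le> 2"
proof -
  have "norm (exp z - exp 0) \<le> 1 * norm (z - 0)"
  proof (rule field_differentiable_bound[where S="{z. Re z \<le> 0}" and f'=exp])
    show "convex {z. Re z \<le> 0}" by (rule convex_halfspace_Re_le)
    show "(exp has_field_derivative exp w) (at w within {z. Re z \<le> 0})" for w
      by (intro DERIV_subset[OF DERIV_exp]) auto
  qed (use assms in auto)
  then show "norm (exp z - 1) \<le> norm z" by simp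
  have "norm (exp z - 1) \<le> norm (exp z) + norm (1 :: complex)" by (rule norm_triangle_ineq4)
  also have "\<dots> \<le> 1 + 1" using assms by (intro add_mono) auto
  finally show "norm (exp z - 1) \<le> 2" by simp
qed

lemma continuous_on_parametric_integral:
  fixes f :: "'b::metric_space \<Rightarrow> 'a \<Rightarrow> 'c::{banach, second_countable_topology}"
  assumes meas: "\<And>z. z \<in> U \<Longrightarrow> f z \<in> borel_measurable M"
    and cont: "\<And>x. x \<in> space M \<Longrightarrow> continuous_on U (\<lambda>z. f z x)"
    and g: "integrable M g"
    and bound: "AE x in M. \<forall>z\<in>U. norm (f z x) \<le> g x"
  shows "continuous_on U (\<lambda>z. LINT x|M. f z x)"
  unfolding continuous_on_sequentially comp_def
proof (intro allI ballI impI)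
  fix X a assume a: "a \<in> U" and X: "(\<forall>n. X n \<in> U) \<and> X \<longlonglongrightarrow> a"
  show "(\<lambda>n. LINT x|M. f (X n) x) \<longlonglongrightarrow> (LINT x|M. f a x)"
  proof (rule integral_dominated_convergence[OF _ _ g])
    show "AE x in M. (\<lambda>n. f (X n) x) \<longlonglongrightarrow> f a x"
      using cont a X unfolding continuous_on_sequentially comp_def by (intro AE_I2) blast
    show "AE x in M. norm (f (X n) x) \<le> g x" for n
      using bound by eventually_elim (use X in auto)
  qed (use meas a X in auto)
qed

text \<open>Dominated convergence for difference quotients. A bound for \<open>f z x\<close> on an
  open set controls the derivative on a smaller disc by Cauchy's inequality, so that a multiple of
  \<open>g\<close> itself dominates the quotients and no separate bound on derivatives has to be
  supplied.\<close>

lemma holomorphic_on_parametric_integral: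
  fixes f :: "complex \<Rightarrow> 'a \<Rightarrow> complex"
  assumes U: "open U"
    and meas: "\<And>z. z \<in> U \<Longrightarrow> f z \<in> borel_measurable M"
    and hol: "\<And>x. x \<in> space M \<Longrightarrow> (\<lambda>z. f z x) holomorphic_on U"
    and g: "integrable M g"
    and bound: "AE x in M. \<forall>z\<in>U. norm (f z x) \<le> g x"
  shows "(\<lambda>z. LINT x|M. f z x) holomorphic_on U"
proof -
  have int: "integrable M (f z)" if "z \<in> U" for z
    by (rule Bochner_Integration.integrable_bound[OF g meas[OF that]])
       (use bound in eventually_elim, use that in force)
  have "\<exists>D. ((\<lambda>z. LINT x|M. f z x) has_field_derivative D) (at z0)" if z0: "z0 \<in> U" for z0
  proof -
    obtain e where e: "0 < e" "cball z0 e \<subseteq> U" using U z0 open_contains_cball by blast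
    \<comment> \<open>Half the radius, so that closed discs of radius \<open>d\<close> about points
      of \<open>ball z0 d\<close> remain inside \<open>cball z0 e\<close>.\<close>
    define d where "d = e / 2"
    have d: "0 < d" and dU: "\<And>z. z \<in> ball z0 d \<Longrightarrow> cball z d \<subseteq> U"
    proof -
      show "0 < d" using e by (simp add: d_def)
      fix z assume "z \<in> ball z0 d"
      then have "cball z d \<subseteq> cball z0 e"
        by (subst cball_subset_cball_iff) (auto simp: d_def dist_commute)
      then show "cball z d \<subseteq> U" using e by auto
    qed
    define f' where "f' x = deriv (\<lambda>z. f z x) z0" for x
    have quot: "(\<lambda>n. (f (z0 + X n) x - f z0 x) / X n) \<longlonglongrightarrow> f' x"
      if x: "x \<in> space M" and X: "X \<longlonglongrightarrow> 0" "\<And>n. X n \<noteq> 0" for x X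
    proof -
      have "((\<lambda>z. f z x) has_field_derivative f' x) (at z0)"
        unfolding f'_def by (rule holomorphic_derivI[OF hol[OF x] U z0])
      then have "(\<lambda>h. (f (z0 + h) x - f z0 x) / h) \<midarrow>0\<rightarrow> f' x" by (simp add: DERIV_def)
      then show ?thesis using X by (auto simp: tendsto_at_iff_sequentially comp_def)
    qed
    \<comment> \<open>One fixed sequence of increments, which exhibits \<open>f'\<close> as a
      pointwise limit of measurable quotients. Starting at \<open>d / 2\<close> keeps
      \<open>z0 + h0 n\<close> inside the disc.\<close>
    define h0 where "h0 n = complex_of_real (d / (real n + 2))" for n
    have h0: "h0 \<longlonglongrightarrow> 0" "h0 n \<noteq> 0" "z0 + h0 n \<in> U" for n
    proof -
      have "(\<lambda>n. d / (real n + 2)) \<longlonglongrightarrow> 0" by real_asymp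
      then show "h0 \<longlonglongrightarrow> 0" unfolding h0_def by (metis of_real_0 tendsto_of_real)
      show "h0 n \<noteq> 0" using d unfolding h0_def of_real_eq_0_iff by simp
      have "norm (h0 n) \<le> d" using d unfolding h0_def norm_of_real by (simp add: field_simps)
      then have "z0 + h0 n \<in> cball z0 d" by (simp add: dist_norm)
      then show "z0 + h0 n \<in> U" using dU[of z0] d by auto
    qed
    have f'_meas: "f' \<in> borel_measurable M"
    proof (rule borel_measurable_LIMSEQ_metric)
      show "(\<lambda>n. (f (z0 + h0 n) x - f z0 x) / h0 n) \<longlonglongrightarrow> f' x" if "x \<in> space M" for x
        by (rule quot[OF that h0(1,2)])
      show "(\<lambda>x. (f (z0 + h0 n) x - f z0 x) / h0 n) \<in> borel_measurable M" for n
        using meas[OF h0(3)] meas[OF z0] by measurable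
    qed
    have lip: "AE x in M. \<forall>h. norm h < d \<longrightarrow> norm (f (z0 + h) x - f z0 x) \<le> g x / d * norm h"
      using bound AE_space
    proof eventually_elim
      case (elim x)
      show ?case
      proof (intro allI impI)
        fix h :: complex assume h: "norm h < d"
        have "norm ((\<lambda>z. f z x) (z0 + h) - (\<lambda>z. f z x) z0) \<le> g x / d * norm (z0 + h - z0)"
        proof (rule field_differentiable_bound[where S="ball z0 d" and f'="deriv (\<lambda>z. f z x)"])
          fix z assume z: "z \<in> ball z0 d"
          then have zU: "z \<in> U" using dU[OF z] d by auto
          show "((\<lambda>z. f z x) has_field_derivative deriv (\<lambda>z. f z x) z) (at z within ball z0 d)"
            by (rule has_field_derivative_at_within[OF holomorphic_derivI[OF hol U zU]]) (use elim in auto)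
          have "norm ((deriv ^^ 1) (\<lambda>z. f z x) z) \<le> fact 1 * g x / d ^ 1"
          proof (rule Cauchy_inequality)
            show "(\<lambda>z. f z x) holomorphic_on ball z d"
              by (rule holomorphic_on_subset[OF hol]) (use elim dU[OF z] in auto)
            show "continuous_on (cball z d) (\<lambda>z. f z x)"
              by (rule continuous_on_subset[OF holomorphic_on_imp_continuous_on[OF hol]])
                  (use elim dU[OF z] in auto)
            show "norm (f w x) \<le> g x" if "norm (z - w) = d" for w
              using elim that dU[OF z] by (auto simp: dist_norm subset_iff)
          qed (rule d)
          then show "norm (deriv (\<lambda>z. f z x) z) \<le> g x / d" by simp
        qed (use h d in \<open>auto simp: dist_norm\<close>)
        then show "norm (f (z0 + h) x - f z0 x) \<le> g x / d * norm h" by simp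
      qed
    qed
    have "((\<lambda>h. ((LINT x|M. f (z0 + h) x) - (LINT x|M. f z0 x)) / h) \<longlongrightarrow> (LINT x|M. f' x)) (at 0)"
      unfolding tendsto_at_iff_sequentially comp_def
    proof (intro allI impI)
      fix X :: "nat \<Rightarrow> complex" assume X: "\<forall>i. X i \<in> UNIV - {0}" "X \<longlonglongrightarrow> 0"
      have "\<forall>\<^sub>F n in sequentially. norm (X n) < d"
        by (rule order_tendstoD(2)[OF tendsto_norm_zero[OF X(2)] d])
      then obtain n0 where n0: "\<And>n. n0 \<le> n \<Longrightarrow> norm (X n) < d" unfolding eventually_sequentially by auto
      define Y where "Y n = X (n + n0)" for n
      have Y: "norm (Y n) < d" "Y n \<noteq> 0" "z0 + Y n \<in> U" for n
        using n0[of "n + n0"] X(1) dU[of z0] d by (auto simp: Y_def dist_norm intro!: subsetD[OF dU[of z0]])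
      have "Y \<longlonglongrightarrow> 0" unfolding Y_def by (rule LIMSEQ_ignore_initial_segment[OF X(2)])
      have "(\<lambda>n. LINT x|M. (f (z0 + Y n) x - f z0 x) / Y n) \<longlonglongrightarrow> (LINT x|M. f' x)"
      proof (rule integral_dominated_convergence[where w="\<lambda>x. g x / d"])
        show "AE x in M. (\<lambda>n. (f (z0 + Y n) x - f z0 x) / Y n) \<longlonglongrightarrow> f' x"
          using quot[OF _ \<open>Y \<longlonglongrightarrow> 0\<close> Y(2)] by (intro AE_I2)
        show "AE x in M. norm ((f (z0 + Y n) x - f z0 x) / Y n) \<le> g x / d" for n
          using lip by eventually_elim (use Y in \<open>auto simp: norm_divide divide_le_eq\<close>)
        show "(\<lambda>x. (f (z0 + Y n) x - f z0 x) / Y n) \<in> borel_measurable M" for n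
          using meas[OF Y(3)] meas[OF z0] by measurable
      qed (use g f'_meas in auto)
      also have "(\<lambda>n. LINT x|M. (f (z0 + Y n) x - f z0 x) / Y n) =
          (\<lambda>n. ((LINT x|M. f (z0 + Y n) x) - (LINT x|M. f z0 x)) / Y n)"
        using int[OF z0] int[OF Y(3)] by simp
      finally show "(\<lambda>n. ((LINT x|M. f (z0 + X n) x) - (LINT x|M. f z0 x)) / X n) \<longlonglongrightarrow> (LINT x|M. f' x)"
        unfolding Y_def by (rule LIMSEQ_offset)
    qed
    then show ?thesis by (auto simp: DERIV_def)
  qed
  then show ?thesis
    using U by (auto simp: holomorphic_on_open)
qed

text \<open>The dominating function for \<open>1 - exp (- z y)\<close> grows with the norm of
  \<open>z\<close>, so domination is available on bounded sets only.\<close>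

lemma continuous_on_ballsI:
  fixes f :: "'a::real_normed_vector \<Rightarrow> 'b::topological_space"
  assumes "\<And>r. continuous_on (S \<inter> ball 0 r) f"
  shows "continuous_on S f"
  unfolding continuous_on_eq_continuous_within continuous_within
proof
  fix x assume x: "x \<in> S"
  define r where "r = norm x + 1"
  have "(f \<longlongrightarrow> f x) (at x within S \<inter> ball 0 r)"
    using assms[of r] x by (auto simp: continuous_on_def r_def)
  also have "at x within S \<inter> ball 0 r = at x within S"
    by (rule at_within_nhd[of _ "ball 0 r"]) (auto simp: r_def)
  finally show "(f \<longlongrightarrow> f x) (at x within S)" .
qed

lemma holomorphic_on_ballsI:
  assumes S: "open S" and hol: "\<And>r. f holomorphic_on (S \<inter> ball 0 r)"
  shows "f holomorphic_on S"
proof -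
  have "f analytic_on (\<Union>n. S \<inter> ball 0 (real n))"
    unfolding analytic_on_UN using S hol by (simp add: analytic_on_open open_Int)
  moreover have "(\<Union>n. S \<inter> ball 0 (real n)) = S" by (auto intro: reals_Archimedean2)
  ultimately show ?thesis using S by (simp add: analytic_on_open)
qed

lemma Re_half_planes:
  "open {z. 0 < Re z}" "connected {z. 0 < Re z}" "convex {z. 0 \<le> Re z}"
  by (auto intro: open_halfspace_Re_gt convex_connected convex_halfspace_Re_gt convex_halfspace_Re_ge)

text \<open>Transforms are prescribed at real arguments, but are needed on the imaginary axis. The
  positive reals accumulate at 1 inside the open half-plane, so the identity theorem applies there,
  and continuity from the right reaches the boundary.\<close>

lemma half_plane_eqI:
  assumes hol: "f holomorphic_on {z. 0 < Re z}" "g holomorphic_on {z. 0 < Re z}"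
    and cont: "continuous_on {z. 0 \<le> Re z} f" "continuous_on {z. 0 \<le> Re z} g"
    and eq: "\<And>r::real. 0 < r \<Longrightarrow> f (of_real r) = g (of_real r)"
    and z: "0 \<le> Re z"
  shows "f z = g z"
proof -
  have pos: "f w = g w" if "0 < Re w" for w
  proof -
    have "(\<lambda>z. f z - g z) w = 0"
    proof (rule analytic_continuation[of "\<lambda>z. f z - g z" "{z. 0 < Re z}" "of_real ` {0<..}" 1])
      show "(\<lambda>z. f z - g z) holomorphic_on {z. 0 < Re z}" by (intro holomorphic_intros hol)
      have "(\<lambda>n. of_real (1 + inverse (real (Suc n)))) \<longlonglongrightarrow> (of_real (1 + 0) :: complex)"
        by (intro tendsto_intros LIMSEQ_inverse_real_of_nat)
      then show "(1::complex) islimpt of_real ` {0<..}"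
        unfolding islimpt_sequential
        by (intro exI[of _ "\<lambda>n. of_real (1 + inverse (real (Suc n)))"])
           (auto simp del: of_real_add of_nat_Suc simp: add_pos_pos intro!: imageI)
    qed (use that eq Re_half_planes in auto)
    then show ?thesis by simp
  qed
  have "f z = g z" if "0 \<le> Re z" for z
  proof (rule LIMSEQ_unique)
    define X where "X n = z + of_real (inverse (real (Suc n)))" for n
    have "X \<longlonglongrightarrow> z + of_real 0" unfolding X_def by (intro tendsto_intros LIMSEQ_inverse_real_of_nat)
    then have X: "X \<longlonglongrightarrow> z" "\<And>n. 0 < Re (X n)" using that by (auto simp: X_def intro!: add_nonneg_pos)
    show "(\<lambda>n. f (X n)) \<longlonglongrightarrow> f z"
      using cont(1) X that unfolding continuous_on_sequentially comp_def by (auto simp: less_imp_le)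
    show "(\<lambda>n. f (X n)) \<longlonglongrightarrow> g z"
      using cont(2) X that unfolding continuous_on_sequentially comp_def by (auto simp: less_imp_le pos)
  qed
  then show ?thesis using z .
qed

text \<open>Continuity up to the common boundary line already makes the pasted function holomorphic,
  so neither function has to be continued analytically across the axis before Liouville's theorem is
  used.\<close>

lemma bounded_half_planes_constant:
  assumes contU: "continuous_on {z. 0 \<le> Re z} U" and holU: "U holomorphic_on {z. 0 < Re z}"
    and contV: "continuous_on {z. Re z \<le> 0} V" and holV: "V holomorphic_on {z. Re z < 0}"
    and bdU: "\<And>z. 0 \<le> Re z \<Longrightarrow> norm (U z) \<le> C" and bdV: "\<And>z. Re z \<le> 0 \<Longrightarrow> norm (V z) \<le> C"
    and eq: "\<And>z. Re z = 0 \<Longrightarrow> U z = V z" and z: "0 \<le> Re z"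
  shows "U z = V 0"
proof -
  define W where "W z = (if 0 \<le> Re z then U z else V z)" for z
  have "continuous_on ({z. 0 \<le> Re z} \<union> {z. Re z \<le> 0}) W"
    unfolding W_def
    by (rule continuous_on_cases)
        (use contU contV eq in \<open>auto intro: closed_halfspace_Re_ge closed_halfspace_Re_le\<close>)
  moreover have "{z. 0 \<le> Re z} \<union> {z. Re z \<le> 0} = UNIV" by auto
  ultimately have "continuous_on UNIV W" by simp
  moreover have "W holomorphic_on {z. Re z < 0}"
    by (rule holomorphic_transform[OF holV]) (auto simp: W_def)
  moreover have "W holomorphic_on {z. 0 < Re z}"
    by (rule holomorphic_transform[OF holU]) (auto simp: W_def)
  ultimately have "W holomorphic_on UNIV"
    by (intro holomorphic_on_paste_across_line[of UNIV 1 W 0]) (auto simp: inner_complex_def)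
  moreover have "bounded (range W)"
    unfolding bounded_iff by (rule exI[of _ C]) (auto simp: W_def bdU bdV)
  ultimately obtain c where "\<And>z. W z = c" using Liouville_theorem[of W] unfolding constant_on_def by auto
  then have "W z = W 0" by simp
  then show ?thesis using z eq[of 0] by (simp add: W_def)
qed

section \<open>Laplace transforms of exponentially weighted tails\<close>

text \<open>The derivative telescopes: each summand cancels what the previous one leaves, and only
  the top term survives. The sum is the normalised upper incomplete gamma function, an
  antiderivative of a power times an exponential.\<close>

lemma exp_remainder_has_field_derivative:
  fixes w Y v :: complex
  shows "((\<lambda>v. \<Sum>i\<le>a. (w * (Y - v)) ^ i / fact i * exp (- w * (Y - v)))
      has_field_derivative w * ((w * (Y - v)) ^ a / fact a) * exp (- w * (Y - v))) (at v)"
proof (induction a)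
  case 0
  show ?case by (auto intro!: derivative_eq_intros)
next
  case (Suc a)
  have f: "(fact (Suc a) :: complex) = of_nat (Suc a) * fact a" by simp
  have "((\<lambda>v. (w * (Y - v)) ^ Suc a / fact (Suc a) * exp (- w * (Y - v)))
      has_field_derivative
        (of_nat (Suc a) * (w * (Y - v)) ^ a * (- w)) / fact (Suc a) * exp (- w * (Y - v)) +
        (w * (Y - v)) ^ Suc a / fact (Suc a) * (exp (- w * (Y - v)) * w)) (at v)"
    by (rule derivative_eq_intros refl | simp add: mult_ac del: of_nat_Suc power_Suc fact_Suc)+
  also have "(of_nat (Suc a) * (w * (Y - v)) ^ a * (- w)) / fact (Suc a) =
      - w * ((w * (Y - v)) ^ a / fact a)"
    unfolding f by (simp del: of_nat_Suc)
  finally have "((\<lambda>v. (w * (Y - v)) ^ Suc a / fact (Suc a) * exp (- w * (Y - v)))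
      has_field_derivative
        - w * ((w * (Y - v)) ^ a / fact a) * exp (- w * (Y - v)) +
        (w * (Y - v)) ^ Suc a / fact (Suc a) * (exp (- w * (Y - v)) * w)) (at v)" .
  from DERIV_add[OF Suc this] show ?case by (simp del: power_Suc fact_Suc add: mult_ac)
qed

lemma exp_remainder_has_vector_derivative:
  fixes w :: complex and y :: real
  shows "((\<lambda>u. \<Sum>i\<le>a. (w * of_real (y - u)) ^ i / fact i * exp (- w * of_real (y - u)))
      has_vector_derivative w * ((w * of_real (y - u)) ^ a / fact a) * exp (- w * of_real (y - u)))
          (at u within S)"
  using has_vector_derivative_real_field[OF
      exp_remainder_has_field_derivative[where a=a and w=w and Y="of_real y" and v="of_real u"]]
  by simp

text \<open>Here \<open>exp (- z u) exp (- b (y - u)) = exp (- z y) exp (- (b - z) (y - u))\<close>, so that the remainder formula above applies.\<close>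

lemma integral_exp_kernel:
  fixes b z :: complex and y :: real and a :: nat
  assumes "0 \<le> y"
  defines "F \<equiv> \<lambda>u. exp (- z * of_real u) * of_real (y - u) ^ a * exp (- b * of_real (y - u))"
  shows "set_integrable lborel {0<..<y} F"
    and "(b - z) ^ Suc a / fact a * (LINT u:{0<..<y}|lborel. F u) =
      exp (- z * of_real y) - (\<Sum>i\<le>a. ((b - z) * of_real y) ^ i / fact i * exp (- b * of_real y))"
proof -
  have cont: "continuous_on {0..y} F" unfolding F_def by (intro continuous_intros)
  show "set_integrable lborel {0<..<y} F"
    by (rule set_integrable_subset[OF borel_integrable_atLeastAtMost'[OF cont]]) auto
  define w where "w = b - z"
  have ex: "exp (- z * of_real y) * exp (- w * of_real (y - u)) =
      exp (- z * of_real u) * exp (- b * of_real (y - u))" for u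
    unfolding exp_add[symmetric] w_def by (simp add: algebra_simps)
  define \<Phi> where "\<Phi> u = exp (- z * of_real y) *
      (\<Sum>i\<le>a. (w * of_real (y - u)) ^ i / fact i * exp (- w * of_real (y - u)))" for u :: real
  have "(LINT u|lborel. indicator {0..y} u *\<^sub>R (w ^ Suc a / fact a * F u)) = \<Phi> y - \<Phi> 0"
  proof (rule integral_FTC_atLeastAtMost[OF assms(1)])
    fix u
    have "(\<Phi> has_vector_derivative exp (- z * of_real y) *
        (w * ((w * of_real (y - u)) ^ a / fact a) * exp (- w * of_real (y - u)))) (at u within {0..y})"
      unfolding \<Phi>_def by (intro has_vector_derivative_mult_right exp_remainder_has_vector_derivative)
    also have "exp (- z * of_real y) *
        (w * ((w * of_real (y - u)) ^ a / fact a) * exp (- w * of_real (y - u)))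
        = w ^ Suc a / fact a * of_real (y - u) ^ a * (exp (- z * of_real y) * exp (- w * of_real (y - u)))"
      by (simp add: power_mult_distrib mult_ac)
    also have "\<dots> = w ^ Suc a / fact a * F u" unfolding ex F_def by (simp add: mult_ac)
    finally show "(\<Phi> has_vector_derivative w ^ Suc a / fact a * F u) (at u within {0..y})" .
  qed (intro continuous_intros cont)
  also have "(LINT u|lborel. indicator {0..y} u *\<^sub>R (w ^ Suc a / fact a * F u)) =
      w ^ Suc a / fact a * (LINT u:{0..y}|lborel. F u)"
    unfolding set_lebesgue_integral_def
        by (subst integral_mult_right_zero[symmetric]) (simp add: mult_ac scaleR_conv_of_real)
  also have "(LINT u:{0..y}|lborel. F u) = (LINT u:{0<..<y}|lborel. F u)"
    unfolding set_lebesgue_integral_def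
  proof (rule integral_cong_AE)
    have "AE u in lborel. u \<noteq> 0 \<and> u \<noteq> y"
      using AE_lborel_singleton[of 0] AE_lborel_singleton[of y] by eventually_elim auto
    then show "AE u in lborel. indicat_real {0..y} u *\<^sub>R F u = indicat_real {0<..<y} u *\<^sub>R F u"
      by eventually_elim (auto simp: indicator_def)
  qed (auto simp: F_def)
  also have "\<Phi> y = exp (- z * of_real y)"
    unfolding \<Phi>_def by (subst sum.remove[of _ 0]) (auto intro!: sum.neutral)
  also have "\<Phi> 0 = (\<Sum>i\<le>a. (w * of_real y) ^ i / fact i * exp (- b * of_real y))"
    unfolding \<Phi>_def sum_distrib_left using ex[of 0] by (intro sum.cong) (auto simp: mult_ac)
  finally show "(b - z) ^ Suc a / fact a * (LINT u:{0<..<y}|lborel. F u) =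
      exp (- z * of_real y) - (\<Sum>i\<le>a. ((b - z) * of_real y) ^ i / fact i * exp (- b * of_real y))"
    by (simp add: w_def)
qed

section \<open>Integrals against a Levy measure\<close>

locale levy_measure =
  fixes \<nu> :: "real measure"
  assumes levy: "subordinator_levy_measure \<nu>"
begin

lemma sets_nu [measurable_cong, simp]: "sets \<nu> = sets borel" and space_nu [simp]: "space \<nu> = UNIV"
  using levy by (auto simp: subordinator_levy_measure_def dest: sets_eq_imp_space_eq)

lemma AE_pos: "AE y in \<nu>. 0 < y"
  using levy by (intro AE_I'[of "{..0}"]) (auto simp: subordinator_levy_measure_def null_sets_def)

lemma integrable_min: "integrable \<nu> (min 1)"
  using levy AE_pos
  by (intro integrableI_nonneg) (auto simp: subordinator_levy_measure_def elim: eventually_mono)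

lemma integrable_dominated:
  fixes f :: "real \<Rightarrow> 'b::{banach, second_countable_topology}"
  assumes "f \<in> borel_measurable borel" "\<And>y. 0 < y \<Longrightarrow> norm (f y) \<le> C * min 1 y"
  shows "integrable \<nu> f"
proof (rule Bochner_Integration.integrable_bound)
  show "integrable \<nu> (\<lambda>y. C * min 1 y)" using integrable_min by simp
  show "f \<in> borel_measurable \<nu>" using assms(1) by measurable
  show "AE y in \<nu>. norm (f y) \<le> norm (C * min 1 y)" using AE_pos by eventually_elim (use assms(2) in force)
qed

text \<open>Prepares Fubini's theorem. \<open>\<nu>\<close> may have infinite mass near 0, but the
  indicator of \<open>{1 / real (Suc n)<..}\<close> is at most \<open>Suc n\<close> times
  \<open>min 1 y\<close> on the positive half-line.\<close>

sublocale sigma_finite_measure \<nu>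
proof
  have fin: "emeasure \<nu> {1 / real (Suc n)<..} \<noteq> \<infinity>" for n
  proof -
    have "integrable \<nu> (indicator {1 / real (Suc n)<..} :: real \<Rightarrow> real)"
    proof (rule integrable_dominated[where C="real (Suc n)"])
      fix y :: real assume "0 < y"
      have "1 \<le> real (Suc n) * min 1 y" if "1 / real (Suc n) < y"
        using that by (auto simp: min_def field_simps)
      then show "norm (indicator {1 / real (Suc n)<..} y :: real) \<le> real (Suc n) * min 1 y"
        using \<open>0 < y\<close> by (auto simp: indicator_def simp del: of_nat_Suc)
    qed auto
    then show ?thesis by (simp add: integrable_indicator_iff less_top[symmetric])
  qed
  let ?A = "insert {..0} (range (\<lambda>n. {1 / real (Suc n)<..}))"
  show "\<exists>A. countable A \<and> A \<subseteq> sets \<nu> \<and> \<Union> A = space \<nu> \<and> (\<forall>a\<in>A. emeasure \<nu> a \<noteq> \<infinity>)"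
  proof (intro exI[of _ ?A] conjI)
    have "\<exists>n. 1 / real (Suc n) < y" if "0 < y" for y
      using reals_Archimedean[OF that] by (auto simp: inverse_eq_divide)
    then show "\<Union> ?A = space \<nu>" by (auto simp del: of_nat_Suc) (metis not_le)
    show "\<forall>a\<in>?A. emeasure \<nu> a \<noteq> \<infinity>"
      using fin levy by (auto simp: subordinator_levy_measure_def simp del: of_nat_Suc)
  qed auto
qed

lemma norm_1_minus_exp_le:
  assumes "0 \<le> Re z" "0 < y"
  shows "norm (1 - exp (- (z * of_real y))) \<le> (2 + norm z) * min 1 y"
proof -
  have R: "Re (- (z * of_real y)) \<le> 0" using assms by simp
  have "norm (1 - exp (- (z * of_real y))) \<le> norm z * y" "norm (1 - exp (- (z * of_real y))) \<le> 2"
    using norm_exp_minus_1_le[OF R] assms by (simp_all add: norm_minus_commute norm_mult)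
  moreover have "0 \<le> norm z" by simp
  ultimately show ?thesis using assms
    by (cases "1 \<le> y") (auto simp: min_def ring_distribs intro: order_trans)
qed

lemma integrable_exponent: "0 \<le> Re z \<Longrightarrow> integrable \<nu> (\<lambda>y. 1 - exp (- (z * of_real y)))"
  by (rule integrable_dominated[OF _ norm_1_minus_exp_le]) auto

lemma exponent_bound:
  "AE y in \<nu>. \<forall>z\<in>{z. 0 \<le> Re z} \<inter> ball 0 r. norm (1 - exp (- (z * of_real y))) \<le> (2 + r) * min 1 y"
  using AE_pos
proof eventually_elim
  case (elim y)
  show ?case
  proof
    fix z assume z: "z \<in> {z. 0 \<le> Re z} \<inter> ball 0 r"
    have "norm (1 - exp (- (z * of_real y))) \<le> (2 + norm z) * min 1 y"
      using norm_1_minus_exp_le z elim by auto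
    also have "\<dots> \<le> (2 + r) * min 1 y" using z elim by (intro mult_right_mono) auto
    finally show "norm (1 - exp (- (z * of_real y))) \<le> (2 + r) * min 1 y" .
  qed
qed

lemma exponent_continuous: "continuous_on {z. 0 \<le> Re z} (subordinator_exponent \<nu> :: complex \<Rightarrow> complex)"
proof -
  have loc: "continuous_on ({z. 0 \<le> Re z} \<inter> ball 0 r) (subordinator_exponent \<nu> :: complex \<Rightarrow> complex)" for r
    unfolding subordinator_exponent_def
  proof (rule continuous_on_parametric_integral[where g="\<lambda>y. (2 + r) * min 1 y"])
    show "AE y in \<nu>. \<forall>z\<in>{z. 0 \<le> Re z} \<inter> ball 0 r. norm (1 - exp (- (z * of_real y))) \<le> (2 + r) * min 1 y"
      by (rule exponent_bound)
  qed (use integrable_min in \<open>auto intro!: continuous_intros\<close>)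
  show ?thesis by (rule continuous_on_ballsI[OF loc])
qed

lemma exponent_holomorphic: "(subordinator_exponent \<nu> :: complex \<Rightarrow> complex) holomorphic_on {z. 0 < Re z}"
proof -
  have loc: "(subordinator_exponent \<nu> :: complex \<Rightarrow> complex) holomorphic_on ({z. 0 < Re z} \<inter> ball 0 r)" for r
    unfolding subordinator_exponent_def
  proof (rule holomorphic_on_parametric_integral[where g="\<lambda>y. (2 + r) * min 1 y"])
    show "AE y in \<nu>. \<forall>z\<in>{z. 0 < Re z} \<inter> ball 0 r. norm (1 - exp (- (z * of_real y))) \<le> (2 + r) * min 1 y"
      using exponent_bound by eventually_elim (auto simp: less_imp_le)
  qed (use integrable_min in \<open>auto intro!: holomorphic_intros Re_half_planes\<close>)
  show ?thesis by (rule holomorphic_on_ballsI[OF _ loc]) (rule Re_half_planes)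
qed


text \<open>For large \<open>y\<close>, a single term of the exponential series is at most the whole
  series. Near 0 a factor \<open>y\<close> must remain, because \<open>\<nu>\<close> may be infinite
  there; hence \<open>1 \<le> i\<close>.\<close>

lemma integrable_power_exp:
  assumes b: "0 < Re b" and i: "1 \<le> i"
  shows "integrable \<nu> (\<lambda>y. of_real y ^ i / fact i * exp (- (b * of_real y)) :: complex)"
proof (rule integrable_dominated)
  define \<rho> where "\<rho> = Re b"
  fix y :: real assume y: "0 < y"
  have n: "norm (of_real y ^ i / fact i * exp (- (b * of_real y)) :: complex) =
      y ^ i / fact i * exp (- (\<rho> * y))"
    using y by (simp add: norm_mult norm_power norm_divide \<rho>_def)
  have "(\<rho> * y) ^ i / fact i \<le> exp (\<rho> * y)"
  proof -
    have "(\<Sum>k\<in>{i}. (\<rho> * y) ^ k /\<^sub>R fact k) \<le> (\<Sum>k. (\<rho> * y) ^ k /\<^sub>R fact k)"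
      using y b by (intro sum_le_suminf summable_exp_generic) (auto simp: \<rho>_def)
    then show ?thesis by (simp add: exp_def field_simps)
  qed
  then have 1: "y ^ i / fact i * exp (- (\<rho> * y)) \<le> 1 / \<rho> ^ i"
    using b by (simp add: exp_minus field_simps power_mult_distrib \<rho>_def)
  have 2: "y ^ i / fact i * exp (- (\<rho> * y)) \<le> y" if "y < 1"
  proof -
    have "y ^ i \<le> y ^ 1" using y that i by (intro power_decreasing) auto
    moreover have "exp (- (\<rho> * y)) \<le> 1" "(1::real) \<le> fact i" using y b by (auto simp: \<rho>_def)
    ultimately have "y ^ i / fact i * exp (- (\<rho> * y)) \<le> y / 1 * 1"
      using y by (intro mult_mono frac_le) auto
    then show ?thesis by simp
  qed
  have 3: "0 \<le> 1 / \<rho> ^ i" using b by (simp add: \<rho>_def)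
  show "norm (of_real y ^ i / fact i * exp (- (b * of_real y)) :: complex) \<le> (1 + 1 / \<rho> ^ i) * min 1 y"
    unfolding n
  proof (cases "y < 1")
    case True
    have "y \<le> (1 + 1 / \<rho> ^ i) * y" using 3 y by (simp add: ring_distribs)
    then show "y ^ i / fact i * exp (- (\<rho> * y)) \<le> (1 + 1 / \<rho> ^ i) * min 1 y"
      using 2[OF True] True by (simp add: min_def)
  next
    case False
    then show "y ^ i / fact i * exp (- (\<rho> * y)) \<le> (1 + 1 / \<rho> ^ i) * min 1 y"
      using 1 by (simp add: min_def)
  qed
qed auto

text \<open>This is \<open>integral_exp_kernel\<close> at \<open>z = 0\<close> with every subtracted
  term except \<open>i = 0\<close> dropped. It supplies the absolute integrability that Fubini's
  theorem asks for in the next result.\<close>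

lemma kernel_integral_le:
  fixes \<rho> y :: real
  assumes \<rho>: "0 < \<rho>" and y: "0 < y"
  shows "(LINT u:{0<..<y}|lborel. (y - u) ^ a * exp (- (\<rho> * (y - u)))) \<le>
      fact a / \<rho> ^ Suc a * (2 + \<rho>) * min 1 y"
proof -
  let ?L = "LINT u:{0<..<y}|lborel. (y - u) ^ a * exp (- (\<rho> * (y - u)))"
  have "(LINT u:{0<..<y}|lborel. exp (- 0 * of_real u) * of_real (y - u) ^ a *
      exp (- of_real \<rho> * of_real (y - u)) :: complex)
      = of_real ?L"
    unfolding set_lebesgue_integral_def integral_complex_of_real[symmetric]
    by (intro Bochner_Integration.integral_cong refl) (simp add: exp_of_real[symmetric] scaleR_conv_of_real)
  with integral_exp_kernel(2)[of y "of_real \<rho>" 0 a] y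
  have "complex_of_real (\<rho> ^ Suc a / fact a * ?L) =
      of_real (1 - (\<Sum>i\<le>a. (\<rho> * y) ^ i / fact i * exp (- (\<rho> * y))))"
    by (simp add: exp_of_real[symmetric])
  then have "\<rho> ^ Suc a / fact a * ?L = 1 - (\<Sum>i\<le>a. (\<rho> * y) ^ i / fact i * exp (- (\<rho> * y)))"
    by (simp only: of_real_eq_iff)
  also have "\<dots> \<le> 1 - (\<Sum>i\<in>{0}. (\<rho> * y) ^ i / fact i * exp (- (\<rho> * y)))"
    using \<rho> y by (intro diff_left_mono sum_mono2) auto
  also have "\<dots> \<le> norm (1 - exp (- (of_real \<rho> * of_real y)) :: complex)"
    using complex_Re_le_cmod[of "1 - exp (- (of_real \<rho> * of_real y))"] by (simp add: Re_exp)
  also have "\<dots> \<le> (2 + \<rho>) * min 1 y"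
    using norm_1_minus_exp_le[of "of_real \<rho>" y] \<rho> y by simp
  finally show ?thesis using \<rho> by (simp add: field_simps)
qed

definition tail_kernel :: "nat \<Rightarrow> complex \<Rightarrow> real \<Rightarrow> complex" where
  "tail_kernel a b u = (LINT y:{u<..}|\<nu>. of_real (y - u) ^ a * exp (- (b * of_real (y - u))))"

text \<open>The transform is computed by exchanging the integrals in \<open>u\<close> and
  \<open>y\<close>. The factor \<open>(b - z) ^ Suc a / fact a\<close> is kept on the left so that
  the identity also holds at \<open>z = b\<close>, where the quotient form is singular.\<close>

lemma
  assumes b: "0 < Re b" and z: "0 \<le> Re z"
  shows laplace_tail_kernel_integrable:
      "set_integrable lborel {0<..} (\<lambda>u. exp (- z * of_real u) * tail_kernel a b u)"
    and laplace_tail_kernel: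
      "(b - z) ^ Suc a / fact a * (LINT u:{0<..}|lborel. exp (- z * of_real u) * tail_kernel a b u) =
       subordinator_exponent \<nu> b - subordinator_exponent \<nu> z
         - (\<Sum>i=1..a. (b - z) ^ i * (LINT y|\<nu>. of_real y ^ i / fact i * exp (- (b * of_real y))))"
proof -
  interpret pair_sigma_finite \<nu> lborel ..
  define F where "F y u = exp (- z * of_real u) * of_real (y - u) ^ a * exp (- b * of_real (y - u))"
      for y u :: real
  define f where "f y u = indicator {0<..<y} u *\<^sub>R F y u" for y u :: real
  have f_eq: "f y u = (if 0 < u \<and> u < y then F y u else 0)" for y u by (simp add: f_def)
  have f_meas: "case_prod f \<in> borel_measurable (\<nu> \<Otimes>\<^sub>M lborel)"
    unfolding f_eq F_def case_prod_beta by measurable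
  have bd: "norm (f y u) \<le> indicator {0<..<y} u * ((y - u) ^ a * exp (- (Re b * (y - u))))" for y u
  proof (cases "0 < u \<and> u < y")
    case True
    have "exp (- (Re z * u)) \<le> 1" using z True by simp
    then show ?thesis using True
      by (auto simp: f_def F_def norm_mult norm_power simp flip: of_real_diff intro!: mult_right_mono
          mult_left_le_one_le)
  qed (auto simp: f_eq)
  have int_real: "set_integrable lborel {0<..<y} (\<lambda>u. (y - u) ^ a * exp (- (Re b * (y - u))))" for y
    by (rule set_integrable_subset[OF borel_integrable_atLeastAtMost'[of 0 y]])
        (auto intro!: continuous_intros)
  have int_f: "integrable lborel (f y)" for y
    by (rule Bochner_Integration.integrable_bound[OF int_real[of y, unfolded set_integrable_def]])
       (use f_meas bd in \<open>auto intro: order_trans[OF _ abs_ge_self] simp: f_def[abs_def] F_def\<close>)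
  have int: "integrable (\<nu> \<Otimes>\<^sub>M lborel) (case_prod f)"
  proof (rule Fubini_integrable[OF f_meas])
    show "integrable \<nu> (\<lambda>y. LINT u|lborel. norm (case_prod f (y, u)))"
    proof (rule integrable_dominated)
      show "(\<lambda>y. LINT u|lborel. norm (case_prod f (y, u))) \<in> borel_measurable borel"
        unfolding f_eq F_def by simp measurable
      fix y :: real assume y: "0 < y"
      have "(LINT u|lborel. norm (f y u)) \<le>
          (LINT u:{0<..<y}|lborel. (y - u) ^ a * exp (- (Re b * (y - u))))"
        unfolding set_lebesgue_integral_def
        by (rule integral_mono) (use bd int_f int_real[of y, unfolded set_integrable_def] in auto)
      also have "\<dots> \<le> fact a / Re b ^ Suc a * (2 + Re b) * min 1 y" by (rule kernel_integral_le[OF b y])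
      finally show "norm (LINT u|lborel. norm (case_prod f (y, u))) \<le>
          fact a / Re b ^ Suc a * (2 + Re b) * min 1 y"
        by simp
    qed
  qed (use int_f in auto)
  have snd: "(LINT y|\<nu>. f y u) = indicator {0<..} u *\<^sub>R (exp (- z * of_real u) * tail_kernel a b u)" for u
  proof -
    have "(LINT y|\<nu>. f y u) = (LINT y|\<nu>. (indicator {0<..} u * exp (- z * of_real u)) *
        (indicator {u<..} y *\<^sub>R (of_real (y - u) ^ a * exp (- (b * of_real (y - u))))))"
      by (intro Bochner_Integration.integral_cong refl) (auto simp: f_eq F_def indicator_def)
    also have "\<dots> = (indicator {0<..} u * exp (- z * of_real u)) * tail_kernel a b u"
      unfolding tail_kernel_def set_lebesgue_integral_def by (rule integral_mult_right_zero)
    finally show ?thesis by (simp add: indicator_def)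
  qed
  show "set_integrable lborel {0<..} (\<lambda>u. exp (- z * of_real u) * tail_kernel a b u)"
    using integrable_snd[OF int] unfolding set_integrable_def snd .
  have "(LINT u:{0<..}|lborel. exp (- z * of_real u) * tail_kernel a b u) =
      (LINT u|lborel. LINT y|\<nu>. f y u)"
    unfolding set_lebesgue_integral_def snd ..
  also have "\<dots> = (LINT y|\<nu>. LINT u|lborel. f y u)" by (rule Fubini_integral[OF int])
  finally have "(b - z) ^ Suc a / fact a *
      (LINT u:{0<..}|lborel. exp (- z * of_real u) * tail_kernel a b u) =
      (LINT y|\<nu>. (b - z) ^ Suc a / fact a * (LINT u|lborel. f y u))" by simp
  \<comment> \<open>\<open>exp (- z y)\<close> and \<open>exp (- b y)\<close> need not be
    \<open>\<nu>\<close>-integrable, only their distances from 1 are. The term \<open>i = 0\<close>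
    of the remainder sum is therefore grouped with \<open>exp (- z y)\<close> before the integral is
    split.\<close>
  also have "\<dots> = (LINT y|\<nu>. (1 - exp (- (b * of_real y))) - (1 - exp (- (z * of_real y)))
       - (\<Sum>i=1..a. (b - z) ^ i * (of_real y ^ i / fact i * exp (- (b * of_real y)))))"
  proof (rule integral_cong_AE)
    show "AE y in \<nu>. (b - z) ^ Suc a / fact a * (LINT u|lborel. f y u) =
      (1 - exp (- (b * of_real y))) - (1 - exp (- (z * of_real y)))
       - (\<Sum>i=1..a. (b - z) ^ i * (of_real y ^ i / fact i * exp (- (b * of_real y))))"
      using AE_pos
    proof eventually_elim
      case (elim y)
      have "{..a} = insert 0 {1..a}" by auto
      then have "(\<Sum>i\<le>a. ((b - z) * of_real y) ^ i / fact i * exp (- b * of_real y)) =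
          exp (- (b * of_real y)) +
              (\<Sum>i=1..a. (b - z) ^ i * (of_real y ^ i / fact i * exp (- (b * of_real y))))"
        by (simp add: power_mult_distrib mult_ac)
      then show ?case
        using integral_exp_kernel(2)[of y b z a] elim
        by (simp add: f_def F_def set_lebesgue_integral_def)
    qed
    show "(\<lambda>y. (b - z) ^ Suc a / fact a * (LINT u|lborel. f y u)) \<in> borel_measurable \<nu>"
      unfolding f_eq F_def by measurable
  qed auto
  also have "\<dots> = subordinator_exponent \<nu> b - subordinator_exponent \<nu> z
         - (\<Sum>i=1..a. (b - z) ^ i * (LINT y|\<nu>. of_real y ^ i / fact i * exp (- (b * of_real y))))"
  proof -
    have ib: "integrable \<nu> (\<lambda>y. 1 - exp (- (b * of_real y)))"
        and iz: "integrable \<nu> (\<lambda>y. 1 - exp (- (z * of_real y)))"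
      using b z by (auto intro: integrable_exponent)
    have ip: "integrable \<nu> (\<lambda>y. (b - z) ^ i * (of_real y ^ i / fact i * exp (- (b * of_real y))))"
        if "i \<in> {1..a}" for i
      using that b by (intro integrable_mult_right integrable_power_exp) auto
    show ?thesis
      unfolding subordinator_exponent_def
      by (simp only: Bochner_Integration.integral_diff[OF Bochner_Integration.integrable_diff[OF ib iz]
          Bochner_Integration.integrable_sum[OF ip]]
          Bochner_Integration.integral_diff[OF ib iz] Bochner_Integration.integral_sum[OF ip]
              integral_mult_right_zero)
  qed
  finally show "(b - z) ^ Suc a / fact a *
      (LINT u:{0<..}|lborel. exp (- z * of_real u) * tail_kernel a b u) =
       subordinator_exponent \<nu> b - subordinator_exponent \<nu> z
         - (\<Sum>i=1..a. (b - z) ^ i * (LINT y|\<nu>. of_real y ^ i / fact i * exp (- (b * of_real y))))" .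
qed

end

section \<open>Factorisation of the killed exponent\<close>

lemma order_ge_of_bigo:
  fixes p :: "complex poly"
  assumes "p \<noteq> 0" and bigo: "poly p \<in> O[at b](\<lambda>z. (z - b) ^ k)"
  shows "k \<le> order b p"
proof (rule ccontr)
  define d where "d = order b p"
  assume "\<not> k \<le> order b p"
  then have d: "d < k" by (simp add: d_def)
  obtain r where r: "p = [:- b, 1:] ^ d * r" "\<not> [:- b, 1:] dvd r"
    using order_decomp[OF assms(1), of b] by (auto simp: d_def)
  have rb: "poly r b \<noteq> 0" using r(2) by (simp add: poly_eq_0_iff_dvd)
  obtain c where c: "\<forall>\<^sub>F z in at b. norm (poly p z) \<le> c * norm ((z - b) ^ k)"
    using landau_o.bigE[OF bigo] by blast
  have "norm (poly r b) \<le> c * norm (b - b) ^ (k - d)"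
  proof (rule tendsto_le[OF at_neq_bot])
    show "((\<lambda>z. norm (poly r z)) \<longlongrightarrow> norm (poly r b)) (at b)"
      by (intro tendsto_intros poly_isCont[unfolded isCont_def])
    show "((\<lambda>z. c * norm (z - b) ^ (k - d)) \<longlongrightarrow> c * norm (b - b) ^ (k - d)) (at b)"
      by (intro tendsto_intros)
    have "\<forall>\<^sub>F z in at b. z \<noteq> b" by (simp add: eventually_at_filter)
    with c show "\<forall>\<^sub>F z in at b. norm (poly r z) \<le> c * norm (z - b) ^ (k - d)"
    proof eventually_elim
      case (elim z)
      have "norm (z - b) ^ d * norm (poly r z) \<le> norm (z - b) ^ d * (c * norm (z - b) ^ (k - d))"
        using elim(1) d by (simp add: r(1) norm_mult norm_power mult_ac flip: power_add)
      then show ?case using elim(2) by (subst (asm) mult_le_cancel_left_pos) auto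
    qed
  qed
  then show False using rb d by (auto simp: power_0_left)
qed

text \<open>More zeros than the degree allows. Vanishing is expressed by \<open>O\<close> so that it
  can be checked on any expression that agrees with \<open>p\<close> near a root, in particular on
  one involving integrals.\<close>

lemma poly_eq_0_of_bigo:
  fixes p :: "complex poly"
  assumes inj: "inj_on \<beta> J" and J: "finite J" and deg: "degree p < (\<Sum>j\<in>J. k j)"
    and bigo: "\<And>j. j \<in> J \<Longrightarrow> poly p \<in> O[at (\<beta> j)](\<lambda>z. (z - \<beta> j) ^ k j)"
  shows "p = 0"
proof (rule ccontr)
  assume p: "p \<noteq> 0"
  have "(\<Sum>j\<in>J. k j) \<le> (\<Sum>j\<in>J. order (\<beta> j) p)"
    using order_ge_of_bigo[OF p bigo] by (intro sum_mono)
  also have "\<dots> = (\<Sum>x\<in>\<beta> ` J. order x p)" using inj by (simp add: sum.reindex)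
  also have "\<dots> \<le> (\<Sum>x\<in>\<beta> ` J \<union> {x. poly p x = 0}. order x p)"
    using p J by (intro sum_mono2) (auto intro: poly_roots_finite)
  also have "\<dots> = (\<Sum>x | poly p x = 0. order x p)"
    using p J by (intro sum.mono_neutral_right) (auto intro: poly_roots_finite, metis order_0I neq0_conv)
  also have "\<dots> \<le> degree p" by (rule sum_order_le_degree[OF p])
  finally show False using deg by simp
qed

lemma taylor_bigo:
  assumes hol: "h holomorphic_on ball b r" and r: "0 < r" and k: "1 \<le> k"
  shows "(\<lambda>z. h z - (\<Sum>i<k. (deriv ^^ i) h b / fact i * (z - b) ^ i)) \<in> O[at b](\<lambda>z. (z - b) ^ k)"
proof -
  obtain n where n: "k = Suc n" using k by (cases k) auto
  define S where "S = cball b (r / 2)"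
  have S: "S \<subseteq> ball b r" using r by (auto simp: S_def)
  have holi: "(deriv ^^ i) h holomorphic_on ball b r" for i
    by (rule holomorphic_higher_deriv[OF hol]) auto
  have "continuous_on S ((deriv ^^ k) h)"
    using holomorphic_on_imp_continuous_on[OF holi] S continuous_on_subset by blast
  then have "bounded ((deriv ^^ k) h ` S)"
    unfolding S_def by (intro compact_imp_bounded compact_continuous_image) auto
  then obtain B where B: "\<And>z. z \<in> S \<Longrightarrow> norm ((deriv ^^ k) h z) \<le> B" unfolding bounded_iff by auto
  have bound: "norm (h z - (\<Sum>i<k. (deriv ^^ i) h b / fact i * (z - b) ^ i)) \<le>
      B / fact n * norm ((z - b) ^ k)"
    if z: "z \<in> S" for z
  proof -
    have "norm ((deriv ^^ 0) h z - (\<Sum>i\<le>n. (deriv ^^ i) h b * (z - b) ^ i / fact i)) \<le>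
        B * norm (z - b) ^ Suc n / fact n"
    proof (rule complex_Taylor[where S=S])
      fix i x assume "x \<in> S"
      then have "x \<in> ball b r" using S by auto
      then have "((deriv ^^ i) h has_field_derivative deriv ((deriv ^^ i) h) x) (at x)"
        by (intro holomorphic_derivI[OF holi]) auto
      then show "((deriv ^^ i) h has_field_derivative (deriv ^^ Suc i) h x) (at x within S)"
        by (simp add: has_field_derivative_at_within)
    qed (use B z r n in \<open>auto simp: S_def\<close>)
    then show ?thesis by (simp add: n lessThan_Suc_atMost norm_mult norm_power)
  qed
  show ?thesis
  proof (rule landau_o.bigI)
    show "0 < \<bar>B / fact n\<bar> + 1" by (rule add_nonneg_pos) auto
    have "\<forall>\<^sub>F z in at b. z \<in> ball b (r / 2)" using r by (intro eventually_at_in_open') auto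
    then show "\<forall>\<^sub>F z in at b. norm (h z - (\<Sum>i<k. (deriv ^^ i) h b / fact i * (z - b) ^ i)) \<le>
        (\<bar>B / fact n\<bar> + 1) * norm ((z - b) ^ k)"
    proof eventually_elim
      case (elim z)
      then have "norm (h z - (\<Sum>i<k. (deriv ^^ i) h b / fact i * (z - b) ^ i)) \<le>
          B / fact n * norm ((z - b) ^ k)"
        by (intro bound) (auto simp: S_def)
      also have "\<dots> \<le> (\<bar>B / fact n\<bar> + 1) * norm ((z - b) ^ k)"
        by (intro mult_right_mono) (use abs_ge_self[of "B / fact n"] in linarith, simp)
      finally show ?case .
    qed
  qed
qed

lemma bigo_mult_continuous:
  fixes f g :: "complex \<Rightarrow> complex"
  assumes "g \<in> O[at b](h)" "isCont f b"
  shows "(\<lambda>z. f z * g z) \<in> O[at b](h)"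
proof -
  have "f \<in> O[at b](\<lambda>_. 1)"
    using assms(2) by (intro bigoI_tendsto[where c="f b"]) (auto simp: isCont_def)
  from landau_o.big.mult[OF this assms(1)] show ?thesis by simp
qed

section \<open>Partial fractions of \<open>P / B\<close>\<close>

locale rational_factor =
  fixes N R :: nat and \<alpha> :: "nat \<Rightarrow> real" and n k :: "nat \<Rightarrow> nat" and \<beta> :: "nat \<Rightarrow> complex"
  assumes inj: "inj_on \<beta> {1..R}" and k_pos: "\<And>j. j \<in> {1..R} \<Longrightarrow> 1 \<le> k j"
    and card: "(\<Sum>j=1..R. k j) = Suc (\<Sum>l=1..N. n l)"
begin

declare One_nat_def [simp del]

definition "pP = (\<Prod>l=1..N. [:complex_of_real (\<alpha> l), - 1:] ^ n l)"
definition "pB = (\<Prod>j=1..R. [:\<beta> j, - 1:] ^ k j)"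
definition "pBj j = (\<Prod>l\<in>{1..R} - {j}. [:\<beta> l, - 1:] ^ k l)"
text \<open>This is \<open>B\<close> divided by \<open>(\<beta> j - z) ^ Suc a\<close>, so that the
  partial fraction identity becomes one between polynomials.\<close>

definition "pBja j a = pBj j * [:\<beta> j, - 1:] ^ (k j - Suc a)"
text \<open>The coefficient of \<open>1 / (\<beta> j - z) ^ Suc a\<close> in \<open>P / B\<close>.
  \<open>E_coeff\<close> weights \<open>y ^ a\<close> times an exponential instead, whose Laplace
  transform carries the additional factor \<open>fact a\<close>.\<close>

definition "e j a = fact a * E_coeff N \<alpha> n R \<beta> k j a"

abbreviation "m \<equiv> \<Sum>l=1..N. n l"

lemma poly_pP: "poly pP z = (\<Prod>l=1..N. (of_real (\<alpha> l) - z) ^ n l)"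
  and poly_pB: "poly pB z = (\<Prod>j=1..R. (\<beta> j - z) ^ k j)"
  and poly_pBj: "poly (pBj j) z = (\<Prod>l\<in>{1..R} - {j}. (\<beta> l - z) ^ k l)"
  by (simp_all add: pP_def pB_def pBj_def poly_prod)

lemma linear_power: "degree ([:x :: complex, - 1:] ^ i) = i" "lead_coeff ([:x :: complex, - 1:] ^ i) =
    (- 1) ^ i"
    "[:x :: complex, - 1:] ^ i \<noteq> 0"
  by (simp_all add: degree_power_eq lead_coeff_power)

lemma linear_power_prod:
  fixes x :: "nat \<Rightarrow> complex"
  shows "degree (\<Prod>l\<in>A. [:x l, - 1:] ^ i l) = (\<Sum>l\<in>A. i l)"
    and "coeff (\<Prod>l\<in>A. [:x l, - 1:] ^ i l) (\<Sum>l\<in>A. i l) = (- 1) ^ (\<Sum>l\<in>A. i l)"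
proof -
  show d: "degree (\<Prod>l\<in>A. [:x l, - 1:] ^ i l) = (\<Sum>l\<in>A. i l)"
    by (subst degree_prod_sum_eq) (simp_all only: linear_power not_False_eq_True)
  show "coeff (\<Prod>l\<in>A. [:x l, - 1:] ^ i l) (\<Sum>l\<in>A. i l) = (- 1) ^ (\<Sum>l\<in>A. i l)"
    unfolding d[symmetric] lead_coeff_prod by (simp only: linear_power(2) d power_sum)
qed

lemma pP_degree: "degree pP = m" and pP_lead: "coeff pP m = (- 1) ^ m"
  unfolding pP_def by (rule linear_power_prod)+

lemma pB_degree: "degree pB = Suc m" and pB_lead: "coeff pB (Suc m) = (- 1) ^ Suc m"
  unfolding pB_def card[symmetric] by (rule linear_power_prod)+

lemma pB_split: "j \<in> {1..R} \<Longrightarrow> poly pB z = poly (pBj j) z * (\<beta> j - z) ^ k j"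
  unfolding poly_pB poly_pBj by (subst prod.remove[of _ j]) auto

lemma pBj_degree: "j \<in> {1..R} \<Longrightarrow> degree (pBj j) = Suc m - k j"
proof -
  assume j: "j \<in> {1..R}"
  have "degree (pBj j) = (\<Sum>l\<in>{1..R} - {j}. k l)" unfolding pBj_def by (rule linear_power_prod)
  moreover have "Suc m = k j + (\<Sum>l\<in>{1..R} - {j}. k l)"
    unfolding card[symmetric] using j by (subst sum.remove[of _ j]) auto
  ultimately show ?thesis by simp
qed

lemma pBja_degree:
  assumes "j \<in> {1..R}" "a < k j"
  shows "degree (pBja j a) \<le> m - a"
proof -
  have "k j \<le> Suc m" using assms unfolding card[symmetric] by (intro member_le_sum) auto
  moreover have "degree (pBja j a) \<le> (Suc m - k j) + (k j - Suc a)"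
    unfolding pBja_def using pBj_degree[OF assms(1)]
        degree_mult_le[of "pBj j" "[:\<beta> j, - 1:] ^ (k j - Suc a)"]
    by (simp add: degree_power_eq)
  ultimately show ?thesis using assms by linarith
qed

lemma pBja_mult:
  assumes "j \<in> {1..R}" "a < k j"
  shows "poly (pBja j a) z * (\<beta> j - z) ^ Suc a = poly pB z"
proof -
  have "k j = (k j - Suc a) + Suc a" using assms by simp
  then have "(\<beta> j - z) ^ k j = (\<beta> j - z) ^ (k j - Suc a) * (\<beta> j - z) ^ Suc a" by (metis power_add)
  then show ?thesis
    using assms by (simp add: pBja_def pB_split mult_ac)
qed

lemma poly_pBj_nonzero: "poly (pBj j) (\<beta> j) \<noteq> 0" if "j \<in> {1..R}"
proof -
  have "\<beta> l - \<beta> j \<noteq> 0" if "l \<in> {1..R} - {j}" for l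
    using inj_onD[OF inj, of l j] that \<open>j \<in> {1..R}\<close> by auto
  then show ?thesis unfolding poly_pBj by (subst prod_zero_iff) auto
qed

lemma root_power_bigo: "(\<lambda>z. (b - z) ^ i) \<in> O[at b](\<lambda>z. (z - b) ^ i)" for b :: complex
  by (intro bigoI[of _ 1] always_eventually) (auto simp: norm_power norm_minus_commute)

lemma pB_bigo: "j \<in> {1..R} \<Longrightarrow> poly pB \<in> O[at (\<beta> j)](\<lambda>z. (z - \<beta> j) ^ k j)"
proof -
  assume j: "j \<in> {1..R}"
  then have "poly pB = (\<lambda>z. poly (pBj j) z * (\<beta> j - z) ^ k j)"
    by (auto simp: pB_split)
  then show ?thesis by (auto intro!: bigo_mult_continuous root_power_bigo)
qed

text \<open>Up to a sign this is a Taylor coefficient of \<open>P / pBj j\<close> at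
  \<open>\<beta> j\<close>: the binomial coefficient and \<open>fact a\<close> turn
  \<open>1 / fact (k j - 1)\<close> into \<open>1 / fact (k j - Suc a)\<close>. The sign appears
  because the expansion is in powers of \<open>\<beta> j - z\<close>.\<close>

lemma e_eq:
  assumes "a < k j"
  shows "e j a = (- 1) ^ (k j - Suc a) / fact (k j - Suc a) *
    (deriv ^^ (k j - Suc a)) (\<lambda>s. poly pP s / poly (pBj j) s) (\<beta> j)"
proof -
  define t where "t = k j - Suc a"
  have t: "k j - 1 = a + t" "a + t - a = t" "1 - int (k j) + int a = - int t" using assms
      by (auto simp: t_def)
  have "fact a * of_nat ((a + t) choose a) / fact (a + t) = (1 / fact t :: complex)"
    by (simp add: binomial_fact field_simps)
  then show ?thesis
    unfolding e_def E_coeff_def t_def[symmetric] t poly_pP poly_pBj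
    by (simp add: power_int_minus field_simps t(1)[simplified])
qed

text \<open>The difference of the two sides has degree at most \<open>m\<close> but vanishes to
  order \<open>k j\<close> at each \<open>\<beta> j\<close>, in total \<open>m + 1\<close> times.
  Near \<open>\<beta> j\<close> the summands of other roots contain
  \<open>(\<beta> j - z) ^ k j\<close>, while those of \<open>j\<close> form \<open>pBj j\<close>
  times the Taylor polynomial of \<open>P / pBj j\<close>.\<close>

theorem partial_fractions: "pP = (\<Sum>j=1..R. \<Sum>a<k j. smult (e j a) (pBja j a))"
proof -
  define p where "p = pP - (\<Sum>j=1..R. \<Sum>a<k j. smult (e j a) (pBja j a))"
  have "p = 0"
  proof (rule poly_eq_0_of_bigo[OF inj, where k=k])
    have "degree (\<Sum>j=1..R. \<Sum>a<k j. smult (e j a) (pBja j a)) \<le> m"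
      by (intro degree_sum_le order_trans[OF degree_smult_le])
         (auto intro: order_trans[OF pBja_degree])
    then have "degree p \<le> m" unfolding p_def using pP_degree by (intro degree_diff_le) auto
    then show "degree p < sum k {1..R}" by (simp add: card)
  next
    fix j assume j: "j \<in> {1..R}"
    define h where "h s = poly pP s / poly (pBj j) s" for s
    obtain r where r: "0 < r" "\<And>z. z \<in> ball (\<beta> j) r \<Longrightarrow> poly (pBj j) z \<noteq> 0"
    proof -
      have "\<forall>\<^sub>F z in nhds (\<beta> j). poly (pBj j) z \<noteq> 0"
        by (intro tendsto_imp_eventually_ne[OF _ poly_pBj_nonzero[OF j]])
           (use poly_isCont[where p="pBj j"] in \<open>simp add: isCont_def tendsto_nhds_iff\<close>)
      then show ?thesis using that by (auto simp: eventually_nhds_metric dist_commute)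
    qed
    have "h holomorphic_on ball (\<beta> j) r"
      unfolding h_def using r by (auto intro!: holomorphic_intros)
    from taylor_bigo[OF this r(1) k_pos[OF j]]
    have T: "(\<lambda>z. h z - (\<Sum>i<k j. (deriv ^^ i) h (\<beta> j) / fact i * (z - \<beta> j) ^ i)) \<in>
        O[at (\<beta> j)](\<lambda>z. (z - \<beta> j) ^ k j)" .
    have taylor_eq: "(\<Sum>i<k j. (deriv ^^ i) h (\<beta> j) / fact i * (z - \<beta> j) ^ i) =
        (\<Sum>a<k j. e j a * (\<beta> j - z) ^ (k j - Suc a))" for z
    proof -
      have "(\<Sum>a<k j. e j a * (\<beta> j - z) ^ (k j - Suc a)) =
          (\<Sum>a<k j. (deriv ^^ (k j - Suc a)) h (\<beta> j) / fact (k j - Suc a) * (z - \<beta> j) ^ (k j - Suc a))"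
      proof (intro sum.cong refl)
        fix a assume "a \<in> {..<k j}"
        have "(\<beta> j - z) ^ i = (- 1) ^ i * (z - \<beta> j) ^ i" for i by (subst power_mult_distrib[symmetric]) simp
        then show "e j a * (\<beta> j - z) ^ (k j - Suc a) =
            (deriv ^^ (k j - Suc a)) h (\<beta> j) / fact (k j - Suc a) * (z - \<beta> j) ^ (k j - Suc a)"
          using \<open>a \<in> _\<close> by (simp add: e_eq h_def[abs_def] flip: power_mult_distrib)
      qed
      also have "\<dots> = (\<Sum>i<k j. (deriv ^^ i) h (\<beta> j) / fact i * (z - \<beta> j) ^ i)"
        by (rule sum.nat_diff_reindex)
      finally show ?thesis ..
    qed
    have main: "(\<lambda>z. poly pP z - (\<Sum>a<k j. e j a * poly (pBja j a) z)) \<in> O[at (\<beta> j)](\<lambda>z. (z - \<beta> j) ^ k j)"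
    proof -
      have *: "(\<lambda>z. poly (pBj j) z * (h z - (\<Sum>i<k j. (deriv ^^ i) h (\<beta> j) / fact i * (z - \<beta> j) ^ i))) \<in>
          O[at (\<beta> j)](\<lambda>z. (z - \<beta> j) ^ k j)"
        by (rule bigo_mult_continuous[OF T]) simp
      have "\<forall>\<^sub>F z in at (\<beta> j). z \<in> ball (\<beta> j) r" using r by (intro eventually_at_in_open') auto
      then have "\<forall>\<^sub>F z in at (\<beta> j). poly pP z - (\<Sum>a<k j. e j a * poly (pBja j a) z) =
          poly (pBj j) z * (h z - (\<Sum>i<k j. (deriv ^^ i) h (\<beta> j) / fact i * (z - \<beta> j) ^ i))"
      proof eventually_elim
        case (elim z)
        then show ?case using r(2) unfolding taylor_eq
          by (simp add: h_def pBja_def right_diff_distrib sum_distrib_left mult_ac)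
      qed
      from landau_o.big.in_cong[OF this] * show ?thesis by simp
    qed
    have other: "poly (pBja l a) \<in> O[at (\<beta> j)](\<lambda>z. (z - \<beta> j) ^ k j)" if "l \<in> {1..R} - {j}" for l a
    proof -
      have "poly (pBja l a) z =
          (poly ([:\<beta> l, - 1:] ^ (k l - Suc a)) z * (\<Prod>i\<in>{1..R} - {l} - {j}. (\<beta> i - z) ^ k i)) *
              (\<beta> j - z) ^ k j" for z
        using that j by (simp add: pBja_def poly_pBj prod.remove[of "{1..R} - {l}" j] mult_ac)
      then have eq: "poly (pBja l a) =
          (\<lambda>z. (poly ([:\<beta> l, - 1:] ^ (k l - Suc a)) z * (\<Prod>i\<in>{1..R} - {l} - {j}. (\<beta> i - z) ^ k i)) *
              (\<beta> j - z) ^ k j)"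
        by auto
      show ?thesis unfolding eq by (intro bigo_mult_continuous root_power_bigo continuous_intros)
    qed
    have "poly p = (\<lambda>z. (poly pP z - (\<Sum>a<k j. e j a * poly (pBja j a) z)) -
        (\<Sum>l\<in>{1..R} - {j}. \<Sum>a<k l. e l a * poly (pBja l a) z))"
      using j by (auto simp: p_def poly_sum sum.remove[of "{1..R}" j])
    then show "poly p \<in> O[at (\<beta> j)](\<lambda>z. (z - \<beta> j) ^ k j)"
      using other by (auto intro!: sum_in_bigo(2) main big_sum_in_bigo landau_o.big.mult_in_1
          bigo_mult_continuous)
  qed auto
  then show ?thesis by (simp add: p_def)
qed

end

section \<open>Matching the zeros of \<open>q - \<Psi>\<close> with those of
  \<open>B\<close>\<close>

lemma cnj_poly_of_real: "cnj (poly (map_poly of_real Q) z) = poly (map_poly of_real Q) (cnj z)"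
  for Q :: "real poly"
  by (subst poly_cnj_real) (auto simp: coeff_map_poly)

locale levy_roots = levy_measure \<nu> for \<nu> :: "real measure" +
  fixes c \<mu> q :: real and Q :: "real poly" and N R :: nat and \<alpha> :: "nat \<Rightarrow> real"
    and n k :: "nat \<Rightarrow> nat" and \<beta> :: "nat \<Rightarrow> complex"
  assumes \<alpha>_pos: "\<And>l. l \<in> {1..N} \<Longrightarrow> 0 < \<alpha> l"
    and degQ: "degree Q < (\<Sum>l=1..N. n l)"
    and inj': "inj_on \<beta> {1..R}"
    and roots: "\<beta> ` {1..R} = {z. 0 < Re z \<and> z \<notin> (\<lambda>i. of_real (\<alpha> i)) ` {1..N} \<and> Psi c \<mu> Q N \<alpha> n \<nu> z -
        of_real q = 0}"
    and mult: "\<And>j. j \<in> {1..R} \<Longrightarrow> int (k j) = zorder (\<lambda>z. Psi c \<mu> Q N \<alpha> n \<nu> z - of_real q) (\<beta> j)"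
    and card': "(\<Sum>j=1..R. k j) = Suc (\<Sum>l=1..N. n l)"
begin

declare One_nat_def [simp del]

abbreviation \<Psi> where "\<Psi> \<equiv> Psi c \<mu> Q N \<alpha> n \<nu>"
abbreviation G :: "complex \<Rightarrow> complex" where "G \<equiv> subordinator_exponent \<nu>"
abbreviation Qc :: "complex poly" where "Qc \<equiv> map_poly of_real Q"

definition S where "S = {z. 0 < Re z} - (\<lambda>i. of_real (\<alpha> i)) ` {1..N}"

lemma open_S: "open S" and connected_S: "connected S" and infinite_S: "infinite S"
proof -
  have f: "finite ((\<lambda>i. complex_of_real (\<alpha> i)) ` {1..N})" by auto
  show "open S" unfolding S_def by (intro open_Diff Re_half_planes finite_imp_closed f)
  show "connected S" unfolding S_def
    by (intro connected_open_delete_finite Re_half_planes f) auto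
  have "infinite {z. 0 < Re z}"
  proof
    assume "finite {z. 0 < Re z}"
    moreover have "complex_of_real ` {0<..} \<subseteq> {z. 0 < Re z}" by auto
    ultimately have "finite (complex_of_real ` {0<..})" using finite_subset by blast
    then have "finite {0::real<..}" by (rule finite_imageD) (auto intro: inj_onI)
    then show False using infinite_Ioi by blast
  qed
  then show "infinite S" unfolding S_def using f by (simp add: Diff_infinite_finite)
qed

lemma S_nonzero: "z \<in> S \<Longrightarrow> l \<in> {1..N} \<Longrightarrow> of_real (\<alpha> l) - z \<noteq> 0"
  by (auto simp: S_def)

lemma Psi_holomorphic: "(\<lambda>z. \<Psi> z - of_real q) holomorphic_on S"
proof -
  have "G holomorphic_on S" by (rule holomorphic_on_subset[OF exponent_holomorphic]) (auto simp: S_def)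
  then show ?thesis
    unfolding Psi_def using S_nonzero by (auto intro!: holomorphic_intros)
qed

lemma beta_S: "j \<in> {1..R} \<Longrightarrow> \<beta> j \<in> S" and beta_root: "j \<in> {1..R} \<Longrightarrow> \<Psi> (\<beta> j) - of_real q = 0"
proof -
  assume "j \<in> {1..R}"
  then have "\<beta> j \<in> \<beta> ` {1..R}" by (rule imageI)
  then show "\<beta> j \<in> S" "\<Psi> (\<beta> j) - of_real q = 0" unfolding roots by (auto simp: S_def)
qed

text \<open>\<open>zorder\<close> describes a zero only if the function is not identically zero near
  it. The roots are finite in number and \<open>S\<close> is infinite, so \<open>\<Psi> - q\<close>
  is nonzero somewhere in \<open>S\<close>, and connectedness of \<open>S\<close> excludes local
  vanishing.\<close>

lemma local_factor:
  assumes j: "j \<in> {1..R}"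
  shows "1 \<le> k j" and "\<exists>r g. 0 < r \<and> cball (\<beta> j) r \<subseteq> S \<and> g holomorphic_on cball (\<beta> j) r \<and>
    (\<forall>w\<in>cball (\<beta> j) r. \<Psi> w - of_real q = g w * (w - \<beta> j) ^ k j \<and> g w \<noteq> 0)"
proof -
  have "\<exists>w\<in>S. \<Psi> w - of_real q \<noteq> 0"
  proof (rule ccontr)
    assume "\<not> ?thesis"
    then have "S \<subseteq> \<beta> ` {1..R}" unfolding roots by (auto simp: S_def)
    then show False using infinite_S finite_subset by blast
  qed
  from zorder_exist_zero[OF Psi_holomorphic open_S connected_S beta_S[OF j] this]
  have z: "0 < zorder (\<lambda>z. \<Psi> z - of_real q) (\<beta> j)"
    and ex: "\<exists>r>0. cball (\<beta> j) r \<subseteq> S \<and> zor_poly (\<lambda>z. \<Psi> z - of_real q) (\<beta> j) holomorphic_on cball (\<beta> j) r \<and>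
      (\<forall>w\<in>cball (\<beta> j) r. \<Psi> w - of_real q =
          zor_poly (\<lambda>z. \<Psi> z - of_real q) (\<beta> j) w * (w - \<beta> j) ^ nat (zorder (\<lambda>z. \<Psi> z - of_real q) (\<beta> j)) \<and>
          zor_poly (\<lambda>z. \<Psi> z - of_real q) (\<beta> j) w \<noteq> 0)"
    using beta_root[OF j] by auto
  show "1 \<le> k j" using z mult[OF j] by simp
  have "nat (zorder (\<lambda>z. \<Psi> z - of_real q) (\<beta> j)) = k j" using mult[OF j] by simp
  with ex show "\<exists>r g. 0 < r \<and> cball (\<beta> j) r \<subseteq> S \<and> g holomorphic_on cball (\<beta> j) r \<and>
    (\<forall>w\<in>cball (\<beta> j) r. \<Psi> w - of_real q = g w * (w - \<beta> j) ^ k j \<and> g w \<noteq> 0)" by auto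
qed

sublocale rational_factor N R \<alpha> n k \<beta>
  by unfold_locales (use inj' local_factor(1) card' in auto)

text \<open>This is \<open>(q - \<Psi>) P\<close> with the poles cleared by hand. At the points
  \<open>\<alpha> i\<close> it has the value of the continued function, which the product with
  \<open>\<Psi>\<close> would spoil by a division by zero.\<close>

definition "Lam z = (of_real (q + \<mu>) - of_real c * z) * poly pP z - of_real \<mu> * poly Qc (- z) + G z *
    poly pP z"

lemma Lam_eq: "z \<notin> (\<lambda>i. of_real (\<alpha> i)) ` {1..N} \<Longrightarrow> Lam z = (of_real q - \<Psi> z) * poly pP z"
proof -
  assume z: "z \<notin> (\<lambda>i. of_real (\<alpha> i)) ` {1..N}"
  then have "poly pP z \<noteq> 0" unfolding poly_pP by (subst prod_zero_iff) auto
  then show ?thesis unfolding Lam_def Psi_def poly_pP[symmetric] by (simp add: field_simps)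
qed

lemma Lam_bigo: "j \<in> {1..R} \<Longrightarrow> Lam \<in> O[at (\<beta> j)](\<lambda>z. (z - \<beta> j) ^ k j)"
proof -
  assume j: "j \<in> {1..R}"
  obtain r g where r: "0 < r" "cball (\<beta> j) r \<subseteq> S" "g holomorphic_on cball (\<beta> j) r"
    "\<And>w. w \<in> cball (\<beta> j) r \<Longrightarrow> \<Psi> w - of_real q = g w * (w - \<beta> j) ^ k j"
    using local_factor(2)[OF j] by blast
  have "\<forall>\<^sub>F z in at (\<beta> j). z \<in> ball (\<beta> j) r" using r by (intro eventually_at_in_open') auto
  then have ev: "\<forall>\<^sub>F z in at (\<beta> j). Lam z = (- g z * poly pP z) * (z - \<beta> j) ^ k j"
  proof eventually_elim
    case (elim z)
    then have "z \<in> cball (\<beta> j) r" by auto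
    then have "z \<notin> (\<lambda>i. of_real (\<alpha> i)) ` {1..N}" using r(2) by (auto simp: S_def)
    moreover have "of_real q - \<Psi> z = - (g z * (z - \<beta> j) ^ k j)"
      using r(4)[OF \<open>z \<in> cball _ _\<close>] by (simp add: algebra_simps)
    ultimately show ?case by (simp add: Lam_eq)
  qed
  have "isCont g (\<beta> j)"
    using r by (intro continuous_on_interior[OF holomorphic_on_imp_continuous_on[OF r(3)]]) auto
  then have "(\<lambda>z. (- g z * poly pP z) * (z - \<beta> j) ^ k j) \<in> O[at (\<beta> j)](\<lambda>z. (z - \<beta> j) ^ k j)"
    by (intro bigo_mult_continuous continuous_intros) auto
  with landau_o.big.in_cong[OF ev] show ?thesis by simp
qed

text \<open>The sum under \<open>Re\<close> in \<open>chi\<close>. All algebra is done with it, and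
  the real part is taken by a symmetry argument in \<open>Lam_factor\<close>.\<close>

definition "chiC u = (\<Sum>j=1..R. \<Sum>a<k j. E_coeff N \<alpha> n R \<beta> k j a * tail_kernel a (\<beta> j) u)"

lemma chi_eq: "chi N \<alpha> n R \<beta> k \<nu> u = Re (chiC u)"
proof -
  have "{0..k j - 1} = {..<k j}" if "j \<in> {1..R}" for j using k_pos[OF that] by auto
  then show ?thesis unfolding chi_def chiC_def tail_kernel_def by (intro arg_cong[where f=Re] sum.cong) auto
qed

definition "hatC z = (LINT u:{0<..}|lborel. exp (- z * of_real u) * chiC u)"

lemma Re_beta: "j \<in> {1..R} \<Longrightarrow> 0 < Re (\<beta> j)" using beta_S by (auto simp: S_def)

lemma hatC_integrable: "0 \<le> Re z \<Longrightarrow> set_integrable lborel {0<..} (\<lambda>u. exp (- z * of_real u) * chiC u)"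
  and hatC_sum: "0 \<le> Re z \<Longrightarrow> hatC z = (\<Sum>j=1..R. \<Sum>a<k j. E_coeff N \<alpha> n R \<beta> k j a *
      (LINT u:{0<..}|lborel. exp (- z * of_real u) * tail_kernel a (\<beta> j) u))"
proof -
  assume z: "0 \<le> Re z"
  have eq: "indicator {0<..} u *\<^sub>R (exp (- z * of_real u) * chiC u) =
      (\<Sum>j=1..R. \<Sum>a<k j. E_coeff N \<alpha> n R \<beta> k j a *
          (indicator {0<..} u *\<^sub>R (exp (- z * of_real u) * tail_kernel a (\<beta> j) u)))" for u
    by (auto simp: chiC_def sum_distrib_left indicator_def mult_ac intro!: sum.cong)
  have int: "integrable lborel (\<lambda>u. E_coeff N \<alpha> n R \<beta> k j a *
      (indicator {0<..} u *\<^sub>R (exp (- z * of_real u) * tail_kernel a (\<beta> j) u)))"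
    if "j \<in> {1..R}" for j a
    using laplace_tail_kernel_integrable[OF Re_beta[OF that] z, of a] unfolding set_integrable_def
    by (rule integrable_mult_right)
  show "set_integrable lborel {0<..} (\<lambda>u. exp (- z * of_real u) * chiC u)"
    unfolding set_integrable_def eq by (intro Bochner_Integration.integrable_sum int)
  have "hatC z = (\<Sum>j=1..R. (LINT u|lborel.
      (\<Sum>a<k j. E_coeff N \<alpha> n R \<beta> k j a *
          (indicator {0<..} u *\<^sub>R (exp (- z * of_real u) * tail_kernel a (\<beta> j) u)))))"
    unfolding hatC_def set_lebesgue_integral_def eq
    by (rule Bochner_Integration.integral_sum) (intro Bochner_Integration.integrable_sum int)
  also have "\<dots> = (\<Sum>j=1..R. \<Sum>a<k j. E_coeff N \<alpha> n R \<beta> k j a *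
      (LINT u:{0<..}|lborel. exp (- z * of_real u) * tail_kernel a (\<beta> j) u))"
    unfolding set_lebesgue_integral_def
  proof (intro sum.cong refl)
    fix j assume j: "j \<in> {1..R}"
    show "(LINT u|lborel. (\<Sum>a<k j. E_coeff N \<alpha> n R \<beta> k j a *
        (indicator {0<..} u *\<^sub>R (exp (- z * of_real u) * tail_kernel a (\<beta> j) u)))) =
        (\<Sum>a<k j. E_coeff N \<alpha> n R \<beta> k j a *
            (LINT u|lborel. indicator {0<..} u *\<^sub>R (exp (- z * of_real u) * tail_kernel a (\<beta> j) u)))"
      unfolding Bochner_Integration.integral_sum[OF int[OF j]]
          by (intro sum.cong refl integral_mult_right_zero)
  qed
  finally show "hatC z = (\<Sum>j=1..R. \<Sum>a<k j. E_coeff N \<alpha> n R \<beta> k j a *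
      (LINT u:{0<..}|lborel. exp (- z * of_real u) * tail_kernel a (\<beta> j) u))" .
qed

lemma chiC_integrable: "set_integrable lborel {0<..} chiC"
  using hatC_integrable[of 0] by simp

lemma hatC_continuous: "continuous_on {z. 0 \<le> Re z} hatC"
  unfolding hatC_def set_lebesgue_integral_def
proof (rule continuous_on_parametric_integral)
  show "integrable lborel (\<lambda>u. norm (indicator {0<..} u *\<^sub>R chiC u))"
    using chiC_integrable unfolding set_integrable_def by (rule integrable_norm)
  show "AE u in lborel. \<forall>z\<in>{z. 0 \<le> Re z}.
      norm (indicat_real {0<..} u *\<^sub>R (exp (- z * of_real u) * chiC u)) \<le>
          norm (indicator {0<..} u *\<^sub>R chiC u)"
    by (intro AE_I2) (auto simp: indicator_def norm_mult intro!: mult_left_le_one_le)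
  show "(\<lambda>u. indicat_real {0<..} u *\<^sub>R (exp (- z * of_real u) * chiC u)) \<in> borel_measurable lborel"
      if "z \<in> {z. 0 \<le> Re z}" for z
    using hatC_integrable[of z] that by (simp add: set_integrable_def)
qed (auto intro!: continuous_intros)

text \<open>The Taylor polynomial of degree \<open>a\<close> of \<open>G\<close> at
  \<open>\<beta> j\<close>; the integrals are, up to signs and factorials, the derivatives of
  \<open>G\<close> there.\<close>

definition "pR j a = [:G (\<beta> j):] -
    (\<Sum>i=1..a. smult (LINT y|\<nu>. of_real y ^ i / fact i * exp (- (\<beta> j * of_real y))) ([:\<beta> j, - 1:] ^ i))"
definition "pT = (\<Sum>j=1..R. \<Sum>a<k j. smult (e j a) (pBja j a * pR j a))"

lemma pR_degree: "degree (pR j a) \<le> a"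
  unfolding pR_def
  by (intro degree_diff_le degree_sum_le order_trans[OF degree_smult_le]) (auto simp: linear_power)

lemma pT_degree: "degree pT \<le> m"
proof -
  have "degree (pBja j a * pR j a) \<le> m" if "j \<in> {1..R}" "a < k j" for j a
  proof -
    have "k j \<le> Suc m" using that unfolding card[symmetric] by (intro member_le_sum) auto
    then show ?thesis
      using degree_mult_le[of "pBja j a" "pR j a"] pBja_degree[OF that] pR_degree[of j a] that by linarith
  qed
  then show ?thesis unfolding pT_def by (intro degree_sum_le order_trans[OF degree_smult_le]) auto
qed

text \<open>By \<open>laplace_tail_kernel\<close> the transform of one tail kernel is
  \<open>pR j a - G\<close> times \<open>fact a / (\<beta> j - z) ^ Suc a\<close>. After
  multiplication by \<open>B\<close> the partial fraction identity collects all terms with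
  \<open>G\<close> into \<open>G P\<close>; what remains is a polynomial.\<close>

lemma pB_hatC: "0 \<le> Re z \<Longrightarrow> poly pB z * hatC z = poly pT z - G z * poly pP z"
proof -
  assume z: "0 \<le> Re z"
  let ?H = "\<lambda>j a. LINT u:{0<..}|lborel. exp (- z * of_real u) * tail_kernel a (\<beta> j) u"
  have "poly pB z * (E_coeff N \<alpha> n R \<beta> k j a * ?H j a) =
      e j a * (poly (pBja j a) z * (poly (pR j a) z - G z))"
    if j: "j \<in> {1..R}" "a \<in> {..<k j}" for j a
  proof -
    have "poly pB z * (E_coeff N \<alpha> n R \<beta> k j a * ?H j a) =
        e j a * (poly (pBja j a) z * ((\<beta> j - z) ^ Suc a / fact a * ?H j a))"
      using pBja_mult[of j a z] j by (simp add: e_def flip: pBja_mult)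
    also have "(\<beta> j - z) ^ Suc a / fact a * ?H j a = poly (pR j a) z - G z"
      unfolding laplace_tail_kernel[OF Re_beta[OF j(1)] z] by (simp add: pR_def poly_sum mult_ac)
    finally show ?thesis .
  qed
  then have "poly pB z * hatC z = (\<Sum>j=1..R. \<Sum>a<k j. e j a * (poly (pBja j a) z * (poly (pR j a) z - G z)))"
    unfolding hatC_sum[OF z] sum_distrib_left by (intro sum.cong) auto
  also have "\<dots> = poly pT z - G z * (\<Sum>j=1..R. \<Sum>a<k j. e j a * poly (pBja j a) z)"
    by (simp add: pT_def poly_sum right_diff_distrib sum_subtractf sum_distrib_left mult_ac)
  also have "(\<Sum>j=1..R. \<Sum>a<k j. e j a * poly (pBja j a) z) = poly pP z"
    by (subst partial_fractions) (simp add: poly_sum)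
  finally show ?thesis .
qed

text \<open>This is \<open>Lam - (c - hatC) B\<close>: the terms \<open>G P\<close> on both sides
  cancel, which is why a polynomial can represent it.\<close>

definition "pD = ([:of_real (q + \<mu>), - of_real c:] * pP - smult (of_real c) pB) -
    smult (of_real \<mu>) (pcompose Qc [:0, - 1:]) + pT"

lemma pD_eq: "0 \<le> Re z \<Longrightarrow> poly pD z = Lam z - (of_real c - hatC z) * poly pB z"
  using pB_hatC[of z] by (simp add: pD_def Lam_def poly_pcompose algebra_simps)

text \<open>The coefficients of degree \<open>m + 1\<close> in \<open>- c z P\<close> and in
  \<open>c B\<close> are both \<open>c (- 1) ^ (m + 1)\<close> and cancel. This single degree is
  what brings the polynomial below its \<open>m + 1\<close> zeros.\<close>

lemma pD_degree: "degree pD \<le> m"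
proof -
  have "degree ([:of_real (q + \<mu>), - of_real c:] * pP - smult (of_real c) pB) \<le> m"
  proof (rule degree_le, intro allI impI)
    fix i assume "m < i"
    then obtain i' where i': "i = Suc i'" "m \<le> i'" by (cases i) auto
    show "coeff ([:of_real (q + \<mu>), - of_real c:] * pP - smult (of_real c) pB) i = 0"
    proof (cases "i' = m")
      case True
      have "coeff pP (Suc m) = 0" by (rule coeff_eq_0) (simp add: pP_degree)
      then show ?thesis using True by (simp add: i' pP_lead pB_lead)
    next
      case False
      then have "coeff pP (Suc i') = 0" "coeff pP i' = 0" "coeff pB (Suc i') = 0"
        using i' by (auto intro!: coeff_eq_0 simp: pP_degree pB_degree)
      then show ?thesis by (simp add: i')
    qed
  qed
  moreover have "degree (pcompose Qc [:0, - 1:]) \<le> m"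
    using degQ map_poly_degree_leq[of "of_real :: real \<Rightarrow> complex" Q] by (simp add: degree_pcompose)
  ultimately show ?thesis unfolding pD_def
    by (rule degree_add_le[OF degree_diff_le[OF _ order_trans[OF degree_smult_le]] pT_degree])
qed

lemma pD_zero: "pD = 0"
proof (rule poly_eq_0_of_bigo[OF inj, where k=k])
  show "degree pD < sum k {1..R}" using pD_degree by (simp add: card)
  fix j assume j: "j \<in> {1..R}"
  have b: "\<beta> j \<in> {z. 0 < Re z}" using Re_beta[OF j] by simp
  have "\<forall>\<^sub>F z in at (\<beta> j). z \<in> {z. 0 < Re z}" by (intro eventually_at_in_open' Re_half_planes b)
  then have ev: "\<forall>\<^sub>F z in at (\<beta> j). poly pD z = Lam z - (of_real c - hatC z) * poly pB z"
    by eventually_elim (simp add: pD_eq)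
  have "continuous_on {z. 0 < Re z} hatC" by (rule continuous_on_subset[OF hatC_continuous]) auto
  then have "isCont hatC (\<beta> j)" using b Re_half_planes(1) continuous_on_eq_continuous_at by blast
  then have "(\<lambda>z. Lam z - (of_real c - hatC z) * poly pB z) \<in> O[at (\<beta> j)](\<lambda>z. (z - \<beta> j) ^ k j)"
    by (intro sum_in_bigo Lam_bigo[OF j] bigo_mult_continuous pB_bigo[OF j] continuous_intros)
  then show "poly pD \<in> O[at (\<beta> j)](\<lambda>z. (z - \<beta> j) ^ k j)" using landau_o.big.in_cong[OF ev] by simp
qed auto

lemma Lam_factor_C: "0 \<le> Re z \<Longrightarrow> Lam z = (of_real c - hatC z) * poly pB z"
  using pD_eq[of z] by (simp add: pD_zero)

lemma G_cnj: "G (cnj z) = cnj (G z)"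
  unfolding subordinator_exponent_def
  by (simp add: exp_cnj flip: Bochner_Integration.integral_cnj)

lemma pP_cnj: "poly pP (cnj z) = cnj (poly pP z)"
  by (simp add: poly_pP)

lemma Lam_cnj: "Lam (cnj z) = cnj (Lam z)"
  unfolding Lam_def by (simp add: G_cnj pP_cnj cnj_poly_of_real)

lemma Psi_cnj: "\<Psi> (cnj z) = cnj (\<Psi> z)"
  unfolding Psi_def by (simp add: G_cnj cnj_poly_of_real)

text \<open>\<open>\<Psi>\<close> commutes with conjugation, so reflecting a local factorisation at
  \<open>\<beta> j\<close> gives one at the conjugate point with the same exponent.\<close>

lemma root_cnj:
  assumes j: "j \<in> {1..R}"
  shows "\<exists>j'\<in>{1..R}. \<beta> j' = cnj (\<beta> j) \<and> k j' = k j"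
proof -
  have S_cnj: "cnj z \<in> S" if "z \<in> S" for z
  proof -
    have "z = of_real r" if "cnj z = of_real r" for r
      using that by (metis complex_cnj_cnj complex_cnj_complex_of_real)
    then show ?thesis using that by (auto simp: S_def)
  qed
  have "cnj (\<beta> j) \<in> \<beta> ` {1..R}"
    using S_cnj[OF beta_S[OF j]] beta_root[OF j] unfolding roots
    by (auto simp: S_def Psi_cnj complex_cnj_cancel_iff simp flip: complex_cnj_diff)
  then obtain j' where j': "j' \<in> {1..R}" "\<beta> j' = cnj (\<beta> j)" by auto
  obtain r g where r: "0 < r" "g holomorphic_on cball (\<beta> j) r"
    "\<And>w. w \<in> cball (\<beta> j) r \<Longrightarrow> \<Psi> w - of_real q = g w * (w - \<beta> j) ^ k j" "\<And>w. w \<in> cball (\<beta> j) r \<Longrightarrow> g w \<noteq> 0"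
    using local_factor(2)[OF j] by blast
  have ball: "cnj w \<in> ball (\<beta> j) r" if "w \<in> ball (cnj (\<beta> j)) r" for w
    using that by (simp add: dist_norm) (metis complex_cnj_cnj complex_cnj_diff complex_mod_cnj)
  have "zorder (\<lambda>z. \<Psi> z - of_real q) (cnj (\<beta> j)) = int (k j)"
  proof (rule zorder_eqI[where S="ball (cnj (\<beta> j)) r" and g="cnj \<circ> g \<circ> cnj"])
    show "cnj \<circ> g \<circ> cnj holomorphic_on ball (cnj (\<beta> j)) r"
      using ball by (intro holomorphic_on_compose_cnj_cnj holomorphic_on_subset[OF r(2)] image_subsetI)
        (auto dest!: ball intro: subsetD[OF ball_subset_cball] simp del: mem_ball mem_cball)
    show "(cnj \<circ> g \<circ> cnj) (cnj (\<beta> j)) \<noteq> 0" using r(4)[of "\<beta> j"] r(1) by simp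
    fix w assume "w \<in> ball (cnj (\<beta> j)) r"
    then have "cnj w \<in> cball (\<beta> j) r" using ball[of w] by simp
    from arg_cong[OF r(3)[OF this], of cnj]
    show "\<Psi> w - of_real q = (cnj \<circ> g \<circ> cnj) w * (w - cnj (\<beta> j)) powi int (k j)"
      by (simp flip: Psi_cnj)
  qed (use r in auto)
  then have "k j' = k j" using mult[OF j'(1)] by (simp add: j'(2))
  then show ?thesis using j' by auto
qed

lemma pB_cnj: "poly pB (cnj z) = cnj (poly pB z)"
proof -
  define \<sigma> where "\<sigma> j = (SOME j'. j' \<in> {1..R} \<and> \<beta> j' = cnj (\<beta> j) \<and> k j' = k j)" for j
  have \<sigma>: "\<sigma> j \<in> {1..R}" "\<beta> (\<sigma> j) = cnj (\<beta> j)" "k (\<sigma> j) = k j" if "j \<in> {1..R}" for j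
    using someI_ex[of "\<lambda>j'. j' \<in> {1..R} \<and> \<beta> j' = cnj (\<beta> j) \<and> k j' = k j"] root_cnj[OF that]
        unfolding \<sigma>_def by blast+
  have "inj_on \<sigma> {1..R}"
  proof (rule inj_onI)
    fix i j assume "i \<in> {1..R}" "j \<in> {1..R}" "\<sigma> i = \<sigma> j"
    then show "i = j" using \<sigma>(2)[of i] \<sigma>(2)[of j] inj_onD[OF inj, of i j] by simp
  qed
  moreover have "\<sigma> ` {1..R} \<subseteq> {1..R}" using \<sigma> by auto
  ultimately have bij: "bij_betw \<sigma> {1..R} {1..R}"
    unfolding bij_betw_def using endo_inj_surj[of "{1..R}" \<sigma>] by auto
  have "poly pB (cnj z) = (\<Prod>j=1..R. (\<beta> (\<sigma> j) - cnj z) ^ k (\<sigma> j))"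
    unfolding poly_pB by (rule prod.reindex_bij_betw[OF bij, symmetric])
  also have "\<dots> = (\<Prod>j=1..R. cnj ((\<beta> j - z) ^ k j))"
    by (intro prod.cong refl) (simp add: \<sigma>)
  finally show ?thesis by (simp add: poly_pB)
qed

abbreviation chi_q :: "real \<Rightarrow> real" where "chi_q \<equiv> chi N \<alpha> n R \<beta> k \<nu>"

definition "hat z = (LINT u:{0<..}|lborel. exp (- z * of_real u) * complex_of_real (chi_q u))"

lemma chi_integrable: "set_integrable lborel {0<..} chi_q"
  using integrable_Re[OF chiC_integrable[unfolded set_integrable_def]]
  unfolding set_integrable_def chi_eq by simp

lemma hat_eq: "0 \<le> Re z \<Longrightarrow> hat z = (hatC z + cnj (hatC (cnj z))) / 2"
proof -
  assume z: "0 \<le> Re z"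
  have i1: "integrable lborel (\<lambda>u. indicator {0<..} u *\<^sub>R (exp (- z * of_real u) * chiC u))"
    using hatC_integrable[OF z] by (simp add: set_integrable_def)
  have i2: "integrable lborel (\<lambda>u. cnj (indicator {0<..} u *\<^sub>R (exp (- cnj z * of_real u) * chiC u)))"
    using hatC_integrable[of "cnj z"] z by (intro integrable_cnj) (simp add: set_integrable_def)
  have "(hatC z + cnj (hatC (cnj z))) / 2 =
      (LINT u|lborel. (indicator {0<..} u *\<^sub>R (exp (- z * of_real u) * chiC u)
      + cnj (indicator {0<..} u *\<^sub>R (exp (- cnj z * of_real u) * chiC u))) / 2)"
    unfolding hatC_def set_lebesgue_integral_def using i1 i2
        by (simp flip: Bochner_Integration.integral_cnj)
  also have "\<dots> = hat z"
    unfolding hat_def set_lebesgue_integral_def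
  proof (intro Bochner_Integration.integral_cong refl)
    fix u
    have 1: "cnj (exp (- cnj z * of_real u)) = exp (- z * of_real u)" by (simp add: exp_cnj)
    have 2: "chiC u + cnj (chiC u) = 2 * complex_of_real (chi_q u)"
      by (simp add: chi_eq complex_add_cnj)
    have "(indicator {0<..} u *\<^sub>R (exp (- z * of_real u) * chiC u)
      + cnj (indicator {0<..} u *\<^sub>R (exp (- cnj z * of_real u) * chiC u))) / 2 =
      (indicator {0<..} u *\<^sub>R (exp (- z * of_real u) * (chiC u + cnj (chiC u)))) / 2"
      by (simp only: complex_cnj_scaleR complex_cnj_mult 1 distrib_left scaleR_add_right)
    then show "(indicator {0<..} u *\<^sub>R (exp (- z * of_real u) * chiC u)
      + cnj (indicator {0<..} u *\<^sub>R (exp (- cnj z * of_real u) * chiC u))) / 2 =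
       indicat_real {0<..} u *\<^sub>R (exp (- z * of_real u) * complex_of_real (chi_q u))"
      unfolding 2 by (simp add: scaleR_conv_of_real)
  qed
  finally show ?thesis ..
qed

text \<open>\<open>Lam\<close> and \<open>B\<close> commute with conjugation, so averaging
  \<open>Lam_factor_C\<close> with its reflection replaces \<open>chiC\<close> by its real part. In
  this way the factorisation holds for \<open>chi\<close> without any discussion of conjugate pairs
  among the coefficients \<open>E_coeff\<close>.\<close>

theorem Lam_factor: "0 \<le> Re z \<Longrightarrow> Lam z = (of_real c - hat z) * poly pB z"
proof -
  assume z: "0 \<le> Re z"
  have "Lam z = cnj (Lam (cnj z))" by (simp add: Lam_cnj)
  also have "\<dots> = (of_real c - cnj (hatC (cnj z))) * poly pB z"
    using z by (simp add: Lam_factor_C pB_cnj)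
  finally have 1: "(of_real c - cnj (hatC (cnj z))) * poly pB z = Lam z" ..
  have "(of_real c - hat z) * poly pB z =
      ((of_real c - hatC z) * poly pB z + (of_real c - cnj (hatC (cnj z))) * poly pB z) / 2"
    unfolding hat_eq[OF z] by (simp add: field_simps)
  then show ?thesis unfolding 1 Lam_factor_C[OF z, symmetric] by simp
qed

end

section \<open>Increments and discrete minima\<close>

lemma indep_rvs_distr:
  assumes "prob_space M" "indep_rvs M A f B g"
  shows "distr M (A \<Otimes>\<^sub>M B) (\<lambda>\<omega>. (f \<omega>, g \<omega>)) = distr M A f \<Otimes>\<^sub>M distr M B g"
proof -
  interpret prob_space M by fact
  have [measurable]: "f \<in> measurable M A" "g \<in> measurable M B"
    and ind: "indep_set {f -` a \<inter> space M | a. a \<in> sets A} {g -` b \<inter> space M | b. b \<in> sets B}"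
    using assms(2) by (auto simp: indep_rvs_def)
  interpret F: prob_space "distr M A f" by (rule prob_space_distr) simp
  interpret G: prob_space "distr M B g" by (rule prob_space_distr) simp
  show ?thesis
  proof (rule pair_measure_eqI[symmetric])
    fix a b assume a: "a \<in> sets (distr M A f)" and b: "b \<in> sets (distr M B g)"
    have "emeasure (distr M (A \<Otimes>\<^sub>M B) (\<lambda>\<omega>. (f \<omega>, g \<omega>))) (a \<times> b) =
        emeasure M ((f -` a \<inter> space M) \<inter> (g -` b \<inter> space M))"
      using a b by (subst emeasure_distr) (auto intro!: arg_cong[where f="emeasure M"])
    also have "\<dots> = emeasure M (f -` a \<inter> space M) * emeasure M (g -` b \<inter> space M)"
      unfolding emeasure_eq_measure using a b
      by (subst indep_setD[OF ind]) (auto simp: ennreal_mult)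
    finally show "emeasure (distr M A f) a * emeasure (distr M B g) b =
        emeasure (distr M (A \<Otimes>\<^sub>M B) (\<lambda>\<omega>. (f \<omega>, g \<omega>))) (a \<times> b)"
      using a b by (simp add: emeasure_distr)
  qed (auto intro: F.sigma_finite_measure_axioms G.sigma_finite_measure_axioms)
qed

lemma preimages_compose_subset:
  assumes u: "u \<in> measurable M C" and h: "h \<in> measurable C D"
  shows "{(\<lambda>\<omega>. h (u \<omega>)) -` a \<inter> space M | a. a \<in> sets D} \<subseteq> {u -` a \<inter> space M | a. a \<in> sets C}"
proof safe
  fix a assume a: "a \<in> sets D"
  show "\<exists>b. (\<lambda>\<omega>. h (u \<omega>)) -` a \<inter> space M = u -` b \<inter> space M \<and> b \<in> sets C"
  proof (intro exI conjI)
    show "(\<lambda>\<omega>. h (u \<omega>)) -` a \<inter> space M = u -` (h -` a \<inter> space C) \<inter> space M"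
      using measurable_space[OF u] by auto
  qed (rule measurable_sets[OF h a])
qed

lemma indep_rvs_compose:
  assumes "prob_space M" "indep_rvs M A f B g" and [measurable]: "\<phi> \<in> measurable A A'" "\<psi> \<in> measurable B B'"
  shows "indep_rvs M A' (\<lambda>\<omega>. \<phi> (f \<omega>)) B' (\<lambda>\<omega>. \<psi> (g \<omega>))"
proof -
  interpret prob_space M by fact
  have [measurable]: "f \<in> measurable M A" "g \<in> measurable M B"
    and ind: "indep_set {f -` a \<inter> space M | a. a \<in> sets A} {g -` b \<inter> space M | b. b \<in> sets B}"
    using assms(2) by (auto simp: indep_rvs_def)
  have sub1: "{(\<lambda>\<omega>. \<phi> (f \<omega>)) -` a \<inter> space M | a. a \<in> sets A'} \<subseteq> {f -` a \<inter> space M | a. a \<in> sets A}"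
    and sub2: "{(\<lambda>\<omega>. \<psi> (g \<omega>)) -` a \<inter> space M | a. a \<in> sets B'} \<subseteq> {g -` a \<inter> space M | a. a \<in> sets B}"
    by (rule preimages_compose_subset; simp)+
  have "indep_set {(\<lambda>\<omega>. \<phi> (f \<omega>)) -` a \<inter> space M | a. a \<in> sets A'} {(\<lambda>\<omega>. \<psi> (g \<omega>)) -` b \<inter> space M | b. b \<in>
      sets B'}"
    using ind unfolding indep_set_def
    by (rule indep_sets_mono_sets) (use sub1 sub2 in \<open>auto split: bool.split\<close>)
  then show ?thesis unfolding indep_rvs_def by auto
qed

section \<open>Increments along a grid\<close>

abbreviation increments :: "real \<Rightarrow> (real \<Rightarrow> 'a \<Rightarrow> real) \<Rightarrow> 'a \<Rightarrow> nat \<Rightarrow> real" where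
  "increments h Y \<omega> \<equiv> \<lambda>i. Y (real (Suc i) * h) \<omega> - Y (real i * h) \<omega>"

abbreviation path_increments :: "real \<Rightarrow> (real \<Rightarrow> real) \<Rightarrow> nat \<Rightarrow> real" where
  "path_increments h x \<equiv> \<lambda>i. x (real (Suc i) * h) - x (real i * h)"

lemma measurable_path_increments:
  assumes "0 < h"
  shows "path_increments h \<in> measurable path_space (PiM UNIV (\<lambda>_. borel))"
proof (rule measurable_PiM_single')
  fix i
  have "0 \<le> real (Suc i) * h" "0 \<le> real i * h" using assms by auto
  then show "(\<lambda>x. x (real (Suc i) * h) - x (real i * h)) \<in> borel_measurable path_space"
    by (intro borel_measurable_diff measurable_component_singleton) auto
qed auto

lemma path_increments_path_of:
  "0 < h \<Longrightarrow> path_increments h (path_of Y \<omega>) = increments h Y \<omega>"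
  by (auto simp: less_imp_le)

text \<open>The definition speaks of finite stretches of increments. Independence of an infinite
  family only concerns its finite subfamilies, each of which lies in an initial stretch.\<close>

lemma levy_increments:
  assumes Y: "levy_process M Y" and h: "0 < h"
  shows levy_increments_indep: "prob_space.indep_vars M (\<lambda>_. borel) (\<lambda>i \<omega>. increments h Y \<omega> i) UNIV"
    and levy_increments_distr: "distr M borel (\<lambda>\<omega>. increments h Y \<omega> i) = distr M borel (Y h)"
proof -
  interpret prob_space M using Y by (simp add: levy_process_def)
  define \<tau> where "\<tau> i = real i * h" for i
  have \<tau>: "0 \<le> \<tau> 0" "strict_mono \<tau>" using h by (auto simp: \<tau>_def strict_mono_def)
  have fin: "indep_vars (\<lambda>_. borel) (\<lambda>i \<omega>. increments h Y \<omega> i) {..<n}" for n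
  proof -
    have "indep_vars (\<lambda>_. borel) (\<lambda>i \<omega>. Y (\<tau> (Suc i)) \<omega> - Y (\<tau> i) \<omega>) {..<n}"
      using Y \<tau> unfolding levy_process_def by blast
    then show ?thesis by (simp only: \<tau>_def)
  qed
  have rv: "random_variable borel (\<lambda>\<omega>. increments h Y \<omega> i)" for i
  proof -
    have "0 \<le> real (Suc i) * h" "0 \<le> real i * h" using h by auto
    then show ?thesis using Y by (intro borel_measurable_diff) (auto simp: levy_process_def)
  qed
  show "indep_vars (\<lambda>_. borel) (\<lambda>i \<omega>. increments h Y \<omega> i) UNIV"
    unfolding indep_vars_def2
  proof (rule conjI, rule ballI, rule rv)
    show "indep_sets (\<lambda>i. {(\<lambda>\<omega>. increments h Y \<omega> i) -` A \<inter> space M |A. A \<in> sets borel}) UNIV"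
    proof (rule indep_sets_finite_index_sets[THEN iffD2], intro allI impI)
      fix J :: "nat set" assume "finite J"
      then obtain n where "J \<subseteq> {..<n}" using finite_nat_bounded by blast
      moreover have "indep_sets (\<lambda>i. {(\<lambda>\<omega>. increments h Y \<omega> i) -` A \<inter> space M |A. A \<in> sets borel}) {..<n}"
        using fin[of n] unfolding indep_vars_def2 by (rule conjunct2)
      ultimately show "indep_sets (\<lambda>i. {(\<lambda>\<omega>. increments h Y \<omega> i) -` A \<inter> space M |A. A \<in> sets borel}) J"
        by (rule indep_sets_mono_index)
    qed
  qed
  have "distr M borel (\<lambda>\<omega>. Y (real i * h + h) \<omega> - Y (real i * h) \<omega>) = distr M borel (Y h)"
    using Y h unfolding levy_process_def by (auto simp: less_imp_le)
  then show "distr M borel (\<lambda>\<omega>. increments h Y \<omega> i) = distr M borel (Y h)"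
    by (simp add: algebra_simps)
qed

lemma levy_increments_law:
  assumes Y: "levy_process M Y" and h: "0 < h"
  shows "distr M (PiM UNIV (\<lambda>_. borel)) (increments h Y) = PiM UNIV (\<lambda>_. distr M borel (Y h))"
proof -
  interpret prob_space M using Y by (simp add: levy_process_def)
  have rv: "random_variable borel (\<lambda>\<omega>. increments h Y \<omega> i)" for i
    using levy_increments_indep[OF Y h] unfolding indep_vars_def2 by blast
  have "distr M (PiM UNIV (\<lambda>_. borel)) (\<lambda>\<omega>. \<lambda>i\<in>UNIV. increments h Y \<omega> i)
      = PiM UNIV (\<lambda>i. distr M borel (\<lambda>\<omega>. increments h Y \<omega> i))"
    using levy_increments_indep[OF Y h] by (subst (asm) indep_vars_iff_distr_eq_PiM[OF _ rv]) simp_all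
  then show ?thesis unfolding levy_increments_distr[OF Y h] by (simp only: restrict_UNIV)
qed

text \<open>The minimum of the partial sums with 0 to \<open>n\<close> terms. The recursion removes
  the first increment instead of the last, which makes it a Lindley step applied to the shifted
  sequence.\<close>

fun running_min :: "nat \<Rightarrow> (nat \<Rightarrow> real) \<Rightarrow> real" where
  "running_min 0 x = 0"
| "running_min (Suc n) x = min 0 (x 0 + running_min n (\<lambda>i. x (Suc i)))"

lemma running_min_le: "k \<le> n \<Longrightarrow> running_min n x \<le> (\<Sum>i<k. x i)"
proof (induction n arbitrary: k x)
  case (Suc n)
  show ?case
  proof (cases k)
    case (Suc k')
    then have "running_min n (\<lambda>i. x (Suc i)) \<le> (\<Sum>i<k'. x (Suc i))" using Suc.prems by (intro Suc.IH) simp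
    then show ?thesis unfolding Suc by (simp add: sum.lessThan_Suc_shift del: sum.lessThan_Suc)
  qed simp
qed simp

lemma running_min_attained: "\<exists>k\<le>n. running_min n x = (\<Sum>i<k. x i)"
proof (induction n arbitrary: x)
  case (Suc n)
  obtain k where k: "k \<le> n" "running_min n (\<lambda>i. x (Suc i)) = (\<Sum>i<k. x (Suc i))" using Suc.IH by blast
  show ?case
  proof (cases "0 \<le> x 0 + running_min n (\<lambda>i. x (Suc i))")
    case True
    then show ?thesis by (intro exI[of _ 0]) simp
  next
    case False
    then show ?thesis using k
      by (intro exI[of _ "Suc k"]) (simp add: sum.lessThan_Suc_shift del: sum.lessThan_Suc)
  qed
qed simp

lemma running_min_nonpos: "running_min n x \<le> 0"
  using running_min_le[of 0 n x] by simp

lemma measurable_running_min: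
  "(\<And>i. (\<lambda>\<omega>. x \<omega> i) \<in> borel_measurable N) \<Longrightarrow> (\<lambda>\<omega>. running_min n (x \<omega>)) \<in> borel_measurable N"
proof (induction n arbitrary: x)
  case (Suc n)
  have "(\<lambda>\<omega>. running_min n (\<lambda>i. x \<omega> (Suc i))) \<in> borel_measurable N" by (rule Suc.IH) (rule Suc.prems)
  then show ?case using Suc.prems[of 0] by simp
qed simp

text \<open>The additional step \<open>+ 1\<close> guarantees a grid point to the right of every
  \<open>s \<le> T\<close>, where right continuity makes \<open>Y\<close> close to
  \<open>Y s\<close>. At most one grid point then lies beyond \<open>T\<close>, by no more than the
  mesh, and right continuity at \<open>T\<close> controls it. The increments do not see the starting
  value, hence \<open>Y 0\<close> in the limit.\<close>

lemma running_min_increments_tendsto: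
  fixes Y :: "real \<Rightarrow> real"
  assumes rc: "\<And>t. 0 \<le> t \<Longrightarrow> continuous (at_right t) Y"
    and T: "0 \<le> T" and bdd: "bdd_below (Y ` {0..T})"
    and h: "\<And>n. 0 < h n" "h \<longlonglongrightarrow> 0"
  shows "(\<lambda>n. running_min (nat \<lfloor>T / h n\<rfloor> + 1) (path_increments (h n) Y)) \<longlonglongrightarrow> (INF s\<in>{0..T}. Y s) - Y 0"
proof -
  define I where "I = (INF s\<in>{0..T}. Y s)"
  define V where "V n = running_min (nat \<lfloor>T / h n\<rfloor> + 1) (path_increments (h n) Y) + Y 0" for n
  have tel: "(\<Sum>i<k. path_increments \<eta> Y i) + Y 0 = Y (real k * \<eta>)" for k \<eta>
    using sum_lessThan_telescope[of "\<lambda>i. Y (real i * \<eta>)" k] by simp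
  have fl: "real (nat \<lfloor>T / h n\<rfloor>) \<le> T / h n" "T / h n < real (nat \<lfloor>T / h n\<rfloor>) + 1" for n
    using T h(1)[of n] by (simp_all add: divide_nonneg_pos of_nat_nat)
  have right: "\<exists>\<delta>>0. \<forall>t. s \<le> t \<and> t < s + \<delta> \<longrightarrow> \<bar>Y t - Y s\<bar> < \<epsilon>" if "0 \<le> s" "0 < \<epsilon>" for s \<epsilon>
  proof -
    have "\<forall>\<^sub>F t in at_right s. dist (Y t) (Y s) < \<epsilon>"
      using rc[OF that(1)] that(2) by (auto simp: continuous_within dest: tendstoD)
    then obtain b where b: "s < b" "\<And>t. s < t \<Longrightarrow> t < b \<Longrightarrow> dist (Y t) (Y s) < \<epsilon>"
      by (auto simp: eventually_at_right_field)
    then show ?thesis using that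
      by (intro exI[of _ "b - s"]) (auto simp: dist_real_def order_le_less)
  qed
  have "V \<longlonglongrightarrow> I"
  proof (rule LIMSEQ_I)
    fix \<epsilon> :: real assume \<epsilon>: "0 < \<epsilon>"
    obtain s where s: "s \<in> {0..T}" "Y s < I + \<epsilon> / 2"
    proof -
      have "\<exists>y\<in>Y ` {0..T}. y < I + \<epsilon> / 2"
        unfolding I_def using cInf_less_iff[of "Y ` {0..T}" "I + \<epsilon> / 2"] T bdd \<epsilon> by (auto simp: I_def)
      then show ?thesis using that by auto
    qed
    obtain \<delta>1 where d1: "0 < \<delta>1" "\<And>t. s \<le> t \<Longrightarrow> t < s + \<delta>1 \<Longrightarrow> \<bar>Y t - Y s\<bar> < \<epsilon> / 2"
      using right[of s "\<epsilon> / 2"] s \<epsilon> by auto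
    obtain \<delta>2 where d2: "0 < \<delta>2" "\<And>t. T \<le> t \<Longrightarrow> t < T + \<delta>2 \<Longrightarrow> \<bar>Y t - Y T\<bar> < \<epsilon>"
      using right[of T \<epsilon>] T \<epsilon> by auto
    have "\<forall>\<^sub>F n in sequentially. h n < min \<delta>1 \<delta>2"
      by (rule order_tendstoD(2)[OF h(2)]) (use d1 d2 in auto)
    then obtain n0 where n0: "\<And>n. n0 \<le> n \<Longrightarrow> h n < \<delta>1 \<and> h n < \<delta>2"
      unfolding eventually_sequentially by auto
    have "norm (V n - I) < \<epsilon>" if n: "n0 \<le> n" for n
    proof -
      have hn: "0 < h n" "h n < \<delta>1" "h n < \<delta>2" using h(1) n0[OF n] by auto
      have "I - \<epsilon> < V n"
      proof -
        obtain k where k: "k \<le> nat \<lfloor>T / h n\<rfloor> + 1"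
          "running_min (nat \<lfloor>T / h n\<rfloor> + 1) (path_increments (h n) Y) = (\<Sum>i<k. path_increments (h n) Y i)"
          using running_min_attained by blast
        then have V: "V n = Y (real k * h n)" using tel[where k=k and \<eta>="h n"] by (simp add: V_def)
        have "real k \<le> T / h n + 1" using k(1) fl(1)[of n] by linarith
        then have kT: "real k * h n \<le> T + h n" using hn(1) by (simp add: field_simps)
        show ?thesis
        proof (cases "real k * h n \<le> T")
          case True
          then have "I \<le> Y (real k * h n)" unfolding I_def by (intro cINF_lower bdd) (use hn in auto)
          then show ?thesis using V \<epsilon> by simp
        next
          case False
          then have "\<bar>Y (real k * h n) - Y T\<bar> < \<epsilon>" using kT hn by (intro d2) auto
          moreover have "I \<le> Y T" unfolding I_def by (intro cINF_lower bdd) (use T in auto)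
          ultimately show ?thesis using V by linarith
        qed
      qed
      moreover have "V n < I + \<epsilon>"
      proof -
        \<comment> \<open>The grid point that follows \<open>s\<close> most closely; its distance to
          \<open>s\<close> is below the mesh and hence below \<open>\<delta>1\<close>.\<close>
        define k where "k = nat \<lceil>s / h n\<rceil>"
        have "0 \<le> s / h n" using s hn by simp
        then have k: "s / h n \<le> real k" "real k < s / h n + 1"
          unfolding k_def by (auto simp: real_nat_ceiling_ge) linarith
        have "s / h n \<le> T / h n" using s hn by (simp add: divide_right_mono)
        then have "real k < real (nat \<lfloor>T / h n\<rfloor>) + 1 + 1" using k fl(2)[of n] by linarith
        then have "k \<le> nat \<lfloor>T / h n\<rfloor> + 1" by linarith
        then have "V n \<le> Y (real k * h n)"
          using running_min_le[of k _ "path_increments (h n) Y"] tel[where k=k and \<eta>="h n"]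
              unfolding V_def by fastforce
        moreover have "s \<le> real k * h n" "real k * h n < s + \<delta>1"
          using k hn by (auto simp: field_simps)
        ultimately show ?thesis using d1(2)[of "real k * h n"] s(2) by linarith
      qed
      ultimately show ?thesis by (simp add: abs_less_iff)
    qed
    then show "\<exists>no. \<forall>n\<ge>no. norm (V n - I) < \<epsilon>" by blast
  qed
  then have "(\<lambda>n. V n - Y 0) \<longlonglongrightarrow> I - Y 0" by (intro tendsto_intros)
  then show ?thesis by (simp add: V_def I_def)
qed

text \<open>Bisection: at each time the value and right limit bound the path on one side and the
  left limit bounds it on the other. The intersection with \<open>{0..}\<close> cuts off negative
  times, where the path is arbitrary.\<close>

lemma cadlag_bounded:
  assumes "cadlag x" shows "bounded (x ` {0..T})"
proof (cases "0 \<le> T")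
  case True
  then have "bounded (x ` ({0..T} \<inter> {0..}))"
  proof (rule Bolzano[where P="\<lambda>a b. bounded (x ` ({a..b} \<inter> {0..}))"])
    fix a b c assume bd: "bounded (x ` ({a..b} \<inter> {0..}))" "bounded (x ` ({b..c} \<inter> {0..}))"
        and "a \<le> b" "b \<le> c"
    then have "x ` ({a..c} \<inter> {0..}) = x ` ({a..b} \<inter> {0..}) \<union> x ` ({b..c} \<inter> {0..})"
      unfolding image_Un[symmetric] by (intro arg_cong[where f="image x"]) auto
    then show "bounded (x ` ({a..c} \<inter> {0..}))" using bd by (simp only: bounded_Un simp_thms)
  next
    fix t assume local: "0 \<le> t" "t \<le> T"
    have "\<exists>d>0. bounded (x ` {t..<t + d})"
    proof -
      have "(x \<longlongrightarrow> x t) (at_right t)" using assms local by (simp add: cadlag_def continuous_within)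
      then have "\<forall>\<^sub>F s in at_right t. norm (x s - x t) < 1"
          by (auto dest!: tendstoD[of _ _ _ 1] simp: dist_norm)
      then obtain b where b: "t < b" "\<And>s. t < s \<Longrightarrow> s < b \<Longrightarrow> norm (x s - x t) < 1"
          by (auto simp: eventually_at_right_field)
      have "bounded (x ` {t..<t + (b - t)})" unfolding bounded_iff
      proof (intro exI[of _ "\<bar>x t\<bar> + 1"] ballI)
        fix y assume "y \<in> x ` {t..<t + (b - t)}"
        then obtain s where s: "y = x s" "t \<le> s" "s < b" by auto
        then show "norm y \<le> \<bar>x t\<bar> + 1" using b(2)[of s] by (cases "s = t") auto
      qed
      then show ?thesis using b(1) by (intro exI[of _ "b - t"]) auto
    qed
    then obtain d1 where d1: "0 < d1" "bounded (x ` {t..<t + d1})" by blast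
    have "\<exists>d>0. bounded (x ` ({t - d<..<t} \<inter> {0..}))"
    proof (cases "0 < t")
      case True
      then obtain l where "(x \<longlongrightarrow> l) (at_left t)" using assms by (auto simp: cadlag_def)
      then have "\<forall>\<^sub>F s in at_left t. norm (x s - l) < 1"
          by (auto dest!: tendstoD[of _ _ _ 1] simp: dist_norm)
      then obtain b where b: "b < t" "\<And>s. b < s \<Longrightarrow> s < t \<Longrightarrow> norm (x s - l) < 1"
          by (auto simp: eventually_at_left_field)
      have "bounded (x ` ({t - (t - b)<..<t} \<inter> {0..}))" unfolding bounded_iff
      proof (intro exI[of _ "\<bar>l\<bar> + 1"] ballI)
        fix y assume "y \<in> x ` ({t - (t - b)<..<t} \<inter> {0..})"
        then obtain s where s: "y = x s" "b < s" "s < t" by auto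
        then show "norm y \<le> \<bar>l\<bar> + 1" using b(2)[of s] by auto
      qed
      then show ?thesis using b(1) by (intro exI[of _ "t - b"]) auto
    next
      case False
      then have "{t - 1<..<t} \<inter> {0..} = {}" by auto
      then show ?thesis by (intro exI[of _ 1]) (simp only: image_empty bounded_empty, simp)
    qed
    then obtain d2 where d2: "0 < d2" "bounded (x ` ({t - d2<..<t} \<inter> {0..}))" by blast
    show "\<exists>d>0. \<forall>a b. a \<le> t \<and> t \<le> b \<and> b - a < d \<longrightarrow> bounded (x ` ({a..b} \<inter> {0..}))"
    proof (intro exI[of _ "min d1 d2"] conjI allI impI)
      show "0 < min d1 d2" using d1 d2 by simp
      fix a b assume ab: "a \<le> t \<and> t \<le> b \<and> b - a < min d1 d2"
      have "bounded (x ` ({t - d2<..<t} \<inter> {0..}) \<union> x ` {t..<t + d1})" using d1 d2 by simp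
      moreover have "x ` ({a..b} \<inter> {0..}) \<subseteq> x ` ({t - d2<..<t} \<inter> {0..}) \<union> x ` {t..<t + d1}"
        unfolding image_Un[symmetric] using ab by (intro image_mono) auto
      ultimately show "bounded (x ` ({a..b} \<inter> {0..}))" using bounded_subset by blast
    qed
  qed
  moreover have "{0..T} \<inter> {0..} = {0..T}" by auto
  ultimately show ?thesis by simp
qed simp

section \<open>Compound Poisson increments as block sums\<close>

context sequence_space
begin

lemma nn_integral_PiM_iter:
  assumes [measurable]: "F \<in> borel_measurable S"
  shows "(\<integral>\<^sup>+ x. F x \<partial>S) = (\<integral>\<^sup>+ s. \<integral>\<^sup>+ \<omega>. F (case_nat s \<omega>) \<partial>S \<partial>M)"
  by (subst PiM_iter[symmetric], subst nn_integral_distr, simp, simp)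
     (subst P.nn_integral_fst[symmetric], simp_all)

lemma nn_integral_PiM_comb_seq:
  assumes [measurable]: "F \<in> borel_measurable S"
  shows "(\<integral>\<^sup>+ x. F x \<partial>S) = (\<integral>\<^sup>+ \<omega>. \<integral>\<^sup>+ \<omega>'. F (comb_seq i \<omega> \<omega>') \<partial>S \<partial>S)"
  by (subst PiM_comb_seq[symmetric, of i], subst nn_integral_distr, simp, simp)
     (subst P.nn_integral_fst[symmetric], simp_all)

end

text \<open>The sequence \<open>j\<close> is cut into consecutive blocks of lengths
  \<open>k 0\<close>, \<open>k 1\<close> and so on. With jump counts per grid step for
  \<open>k\<close> and jump sizes for \<open>j\<close>, these are the increments of a compound
  Poisson process.\<close>

definition block_sum :: "nat \<Rightarrow> (nat \<Rightarrow> nat) \<Rightarrow> (nat \<Rightarrow> real) \<Rightarrow> real" where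
  "block_sum i k j = (\<Sum>l<k i. j ((\<Sum>i'<i. k i') + l))"

lemma block_sum_0: "block_sum 0 (case_nat k0 k) (comb_seq k0 \<omega> \<omega>') = (\<Sum>l<k0. \<omega> l)"
  by (simp add: block_sum_def comb_seq_def)

lemma block_sum_Suc: "block_sum (Suc i) (case_nat k0 k) (comb_seq k0 \<omega> \<omega>') = block_sum i k \<omega>'"
  by (simp add: block_sum_def sum.lessThan_Suc_shift comb_seq_def del: sum.lessThan_Suc)

locale compound_law =
  fixes \<kappa> :: "nat measure" and \<mu>J :: "real measure"
  assumes \<kappa>: "prob_space \<kappa>" "sets \<kappa> = sets (count_space UNIV)"
    and \<mu>J: "prob_space \<mu>J" "sets \<mu>J = sets borel"
begin

sublocale K: prob_space \<kappa> by (rule \<kappa>)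
sublocale J: prob_space \<mu>J by (rule \<mu>J)
sublocale KS: sequence_space \<kappa> ..
sublocale JS: sequence_space \<mu>J ..

declare \<kappa>(2) [measurable_cong] \<mu>J(2) [measurable_cong]

abbreviation "PK \<equiv> KS.S"
abbreviation "PJ \<equiv> JS.S"

sublocale KJ: pair_prob_space PK PJ ..
sublocale kJ: pair_prob_space \<kappa> PJ ..

lemma measurable_component_nat [measurable]: "(\<lambda>x. x i) \<in> measurable PK (count_space UNIV)"
  using measurable_component_singleton[of i UNIV "\<lambda>_. \<kappa>"] by (simp add: measurable_cong_sets[OF refl \<kappa>(2)])

lemma measurable_component_real [measurable]: "(\<lambda>x. x i) \<in> borel_measurable PJ"
  using measurable_component_singleton[of i UNIV "\<lambda>_. \<mu>J"]
      by (simp add: measurable_cong_sets[OF refl \<mu>J(2)])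

lemma measurable_partial_count [measurable]: "(\<lambda>k. \<Sum>i'<i. k i') \<in> measurable PK (count_space UNIV)"
proof (induction i)
  case (Suc i)
  have "(\<lambda>k. (\<lambda>a k. a + k i) (\<Sum>i'<i. k i') k) \<in> measurable PK (count_space UNIV)"
    by (rule measurable_compose_countable[OF _ Suc])
       (rule measurable_compose[OF measurable_component_nat], simp)
  then show ?case by simp
qed simp

lemma measurable_block_sum [measurable]: "(\<lambda>(k, j). block_sum i k j) \<in> borel_measurable (PK \<Otimes>\<^sub>M PJ)"
proof -
  have sums: "(\<lambda>p. \<Sum>l<a. snd p (b + l)) \<in> borel_measurable (PK \<Otimes>\<^sub>M PJ)" for a b :: nat
    by (intro borel_measurable_sum measurable_compose[OF measurable_snd measurable_component_real])
  have start: "(\<lambda>p. \<Sum>i'<i. fst p i') \<in> measurable (PK \<Otimes>\<^sub>M PJ) (count_space UNIV)"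
    by (rule measurable_compose[OF measurable_fst measurable_partial_count])
  have len: "(\<lambda>p. fst p i) \<in> measurable (PK \<Otimes>\<^sub>M PJ) (count_space UNIV)"
    by (rule measurable_compose[OF measurable_fst measurable_component_nat])
  have "(\<lambda>p. \<Sum>l<a. snd p ((\<Sum>i'<i. fst p i') + l)) \<in> borel_measurable (PK \<Otimes>\<^sub>M PJ)" for a :: nat
    using measurable_compose_countable[where f="\<lambda>b p. \<Sum>l<a. snd p (b + l)", OF sums start] .
  from measurable_compose_countable[where f="\<lambda>a p. \<Sum>l<a. snd p ((\<Sum>i'<i. fst p i') + l)", OF this len]
  have "(\<lambda>p. \<Sum>l<fst p i. snd p ((\<Sum>i'<i. fst p i') + l)) \<in> borel_measurable (PK \<Otimes>\<^sub>M PJ)" .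
  then show ?thesis by (simp add: block_sum_def case_prod_beta)
qed

lemma measurable_initial_sum [measurable]: "(\<lambda>(k, j). \<Sum>l<k. j l) \<in> borel_measurable (\<kappa> \<Otimes>\<^sub>M PJ)"
proof -
  have sums: "(\<lambda>p. \<Sum>l<a. snd p l) \<in> borel_measurable (\<kappa> \<Otimes>\<^sub>M PJ)" for a :: nat
    by (intro borel_measurable_sum measurable_compose[OF measurable_snd measurable_component_real])
  have "fst \<in> measurable (\<kappa> \<Otimes>\<^sub>M PJ) (count_space UNIV)"
    using measurable_fst[of \<kappa> PJ] by (simp only: measurable_cong_sets[OF refl \<kappa>(2)])
  from measurable_compose_countable[where f="\<lambda>a p. \<Sum>l<a. snd p l", OF sums this]
  have "(\<lambda>p. \<Sum>l<fst p. snd p l) \<in> borel_measurable (\<kappa> \<Otimes>\<^sub>M PJ)" .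
  then show ?thesis by (simp add: case_prod_beta)
qed

definition \<rho> :: "real measure" where
  "\<rho> = distr (\<kappa> \<Otimes>\<^sub>M PJ) borel (\<lambda>(k, j). \<Sum>l<k. j l)"

lemma sets_\<rho> [measurable_cong, simp]: "sets \<rho> = sets borel"
  and space_\<rho> [simp]: "space \<rho> = UNIV" by (simp_all add: \<rho>_def)

sublocale R: prob_space \<rho> unfolding \<rho>_def by (rule kJ.prob_space_distr) measurable
sublocale RS: sequence_space \<rho> ..

lemma emeasure_\<rho>:
  "A \<in> sets borel \<Longrightarrow> emeasure \<rho> A = (\<integral>\<^sup>+ k. \<integral>\<^sup>+ j. indicator A (\<Sum>l<k. j l) \<partial>PJ \<partial>\<kappa>)"
proof -
  assume [measurable]: "A \<in> sets borel"
  have "emeasure \<rho> A = (\<integral>\<^sup>+ x. indicator A x \<partial>\<rho>)" by simp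
  also have "\<dots> = (\<integral>\<^sup>+ p. indicator A ((\<lambda>(k, j). \<Sum>l<k. j l) p) \<partial>(\<kappa> \<Otimes>\<^sub>M PJ))"
    unfolding \<rho>_def by (rule nn_integral_distr[OF measurable_initial_sum]) simp
  also have "\<dots> = (\<integral>\<^sup>+ k. \<integral>\<^sup>+ j. indicator A (\<Sum>l<k. j l) \<partial>PJ \<partial>\<kappa>)"
    by (subst JS.P.nn_integral_fst[symmetric], rule measurable_compose[OF measurable_initial_sum]) simp_all
  finally show ?thesis .
qed

lemma measurable_block_sums:
  assumes "\<And>i. A i \<in> sets borel"
  shows "(\<lambda>p. \<Prod>i<n. indicator (A i) (block_sum i (fst p) (snd p)) :: ennreal) \<in>
      borel_measurable (PK \<Otimes>\<^sub>M PJ)"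
  using measurable_block_sum assms
  by (intro borel_measurable_prod_ennreal) (simp add: case_prod_beta)

text \<open>Given the count \<open>k0\<close>, block 0 uses the leading \<open>k0\<close> jumps and
  all other blocks use the sequence after them, which is an independent copy of the whole. The
  integrand therefore factors, and since the second factor does not depend on \<open>k0\<close> the
  induction hypothesis applies to it.\<close>

lemma nn_integral_block_sums:
  assumes "\<And>i. A i \<in> sets borel"
  shows "(\<integral>\<^sup>+ k. \<integral>\<^sup>+ j. (\<Prod>i<n. indicator (A i) (block_sum i k j)) \<partial>PJ \<partial>PK) = (\<Prod>i<n. emeasure \<rho> (A i))"
  using assms
proof (induction n arbitrary: A)
  case 0
  show ?case using KS.P.emeasure_space_1 JS.P.emeasure_space_1 by simp
next
  case (Suc n)
  note [measurable] = Suc.prems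
  let ?F = "\<lambda>k j. \<Prod>i<Suc n. indicator (A i) (block_sum i k j) :: ennreal"
  let ?G = "\<lambda>k j. \<Prod>i<n. indicator (A (Suc i)) (block_sum i k j) :: ennreal"
  have F_meas: "(\<lambda>p. ?F (fst p) (snd p)) \<in> borel_measurable (PK \<Otimes>\<^sub>M PJ)"
    by (rule measurable_block_sums) (rule Suc.prems)
  have G_meas: "(\<lambda>p. ?G (fst p) (snd p)) \<in> borel_measurable (PK \<Otimes>\<^sub>M PJ)"
    by (rule measurable_block_sums) (rule Suc.prems)
  have F_k: "?F k \<in> borel_measurable PJ" if "k \<in> space PK" for k
    using measurable_compose[OF measurable_Pair1'[OF that] F_meas] by simp
  have G_k: "?G k \<in> borel_measurable PJ" if "k \<in> space PK" for k
    using measurable_compose[OF measurable_Pair1'[OF that] G_meas] by simp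
  have sum_meas [measurable]: "(\<lambda>j. \<Sum>l<k0. j l) \<in> borel_measurable PJ" for k0 :: nat
    by (intro borel_measurable_sum measurable_component_real)
  have case_space: "case_nat k0 k \<in> space PK" if "k \<in> space PK" for k0 k
    using that sets_eq_imp_space_eq[OF \<kappa>(2)] by (auto simp: space_PiM)
  have "(\<integral>\<^sup>+ k. \<integral>\<^sup>+ j. ?F k j \<partial>PJ \<partial>PK) = (\<integral>\<^sup>+ k0. \<integral>\<^sup>+ k. \<integral>\<^sup>+ j. ?F (case_nat k0 k) j \<partial>PJ \<partial>PK \<partial>\<kappa>)"
    using F_meas by (intro KS.nn_integral_PiM_iter) (simp add: JS.P.borel_measurable_nn_integral_fst)
  also have "\<dots> = (\<integral>\<^sup>+ k0. \<integral>\<^sup>+ k. (\<integral>\<^sup>+ \<omega>. indicator (A 0) (\<Sum>l<k0. \<omega> l) \<partial>PJ) * (\<integral>\<^sup>+ j. ?G k j \<partial>PJ) \<partial>PK \<partial>\<kappa>)"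
  proof (intro nn_integral_cong)
    fix k0 k assume k: "k \<in> space PK"
    have "(\<integral>\<^sup>+ j. ?F (case_nat k0 k) j \<partial>PJ) =
        (\<integral>\<^sup>+ \<omega>. \<integral>\<^sup>+ \<omega>'. ?F (case_nat k0 k) (comb_seq k0 \<omega> \<omega>') \<partial>PJ \<partial>PJ)"
      by (rule JS.nn_integral_PiM_comb_seq) (rule F_k[OF case_space[OF k]])
    also have "\<dots> = (\<integral>\<^sup>+ \<omega>. \<integral>\<^sup>+ \<omega>'. indicator (A 0) (\<Sum>l<k0. \<omega> l) * ?G k \<omega>' \<partial>PJ \<partial>PJ)"
      by (simp only: prod.lessThan_Suc_shift block_sum_0 block_sum_Suc)
    also have "\<dots> = (\<integral>\<^sup>+ \<omega>. indicator (A 0) (\<Sum>l<k0. \<omega> l) * (\<integral>\<^sup>+ \<omega>'. ?G k \<omega>' \<partial>PJ) \<partial>PJ)"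
      by (intro nn_integral_cong nn_integral_cmult G_k[OF k])
    also have "\<dots> = (\<integral>\<^sup>+ \<omega>. indicator (A 0) (\<Sum>l<k0. \<omega> l) \<partial>PJ) * (\<integral>\<^sup>+ \<omega>'. ?G k \<omega>' \<partial>PJ)"
      by (intro nn_integral_multc) measurable
    finally show "(\<integral>\<^sup>+ j. ?F (case_nat k0 k) j \<partial>PJ) =
      (\<integral>\<^sup>+ \<omega>. indicator (A 0) (\<Sum>l<k0. \<omega> l) \<partial>PJ) * (\<integral>\<^sup>+ j. ?G k j \<partial>PJ)" .
  qed
  also have "\<dots> = (\<integral>\<^sup>+ k0. (\<integral>\<^sup>+ \<omega>. indicator (A 0) (\<Sum>l<k0. \<omega> l) \<partial>PJ) * (\<integral>\<^sup>+ k. \<integral>\<^sup>+ j. ?G k j \<partial>PJ \<partial>PK) \<partial>\<kappa>)"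
    using G_meas by (intro nn_integral_cong nn_integral_cmult)
        (simp add: JS.P.borel_measurable_nn_integral_fst)
  also have "\<dots> = emeasure \<rho> (A 0) * (\<integral>\<^sup>+ k. \<integral>\<^sup>+ j. ?G k j \<partial>PJ \<partial>PK)"
    unfolding emeasure_\<rho>[OF Suc.prems]
    by (rule nn_integral_multc) (simp add: measurable_cong_sets[OF \<kappa>(2) refl])
  also have "(\<integral>\<^sup>+ k. \<integral>\<^sup>+ j. ?G k j \<partial>PJ \<partial>PK) = (\<Prod>i<n. emeasure \<rho> (A (Suc i)))"
    by (rule Suc.IH) (rule Suc.prems)
  finally show ?case by (simp only: prod.lessThan_Suc_shift)
qed

theorem distr_block_sums:
  "distr (PK \<Otimes>\<^sub>M PJ) (PiM UNIV (\<lambda>_. borel)) (\<lambda>(k, j) i. block_sum i k j) = PiM UNIV (\<lambda>_. \<rho>)"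
proof (rule RS.PiM_eq)
  have bs: "(\<lambda>(k, j) i. block_sum i k j) \<in> measurable (PK \<Otimes>\<^sub>M PJ) (PiM UNIV (\<lambda>_. borel))"
    using measurable_block_sum by (intro measurable_PiM_single') (auto simp: case_prod_beta)
  show "sets (distr (PK \<Otimes>\<^sub>M PJ) (PiM UNIV (\<lambda>_. borel)) (\<lambda>(k, j) i. block_sum i k j)) = sets RS.S"
    by (simp cong: sets_PiM_cong)
  fix T :: "nat set" and F assume T: "finite T" "T \<subseteq> UNIV" "\<And>i. i \<in> T \<Longrightarrow> F i \<in> sets \<rho>"
  \<comment> \<open>Coordinates outside \<open>T\<close> receive no constraint, so that an arbitrary
    cylinder set becomes a product over an initial segment of indices.\<close>
  define A where "A i = (if i \<in> T then F i else UNIV)" for i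
  have A: "A i \<in> sets borel" for i using T by (auto simp: A_def)
  obtain n where n: "T \<subseteq> {..<n}" using T(1) finite_nat_bounded by blast
  have box: "prod_emb UNIV (\<lambda>_. \<rho>) T (Pi\<^sub>E T F) \<in> sets (PiM UNIV (\<lambda>_. borel :: real measure))"
  proof -
    have "prod_emb UNIV (\<lambda>_. \<rho>) T (Pi\<^sub>E T F) \<in> sets RS.S" using T by (intro sets_PiM_I) auto
    also have "sets RS.S = sets (PiM UNIV (\<lambda>_. borel))" by (simp cong: sets_PiM_cong)
    finally show ?thesis .
  qed
  have ind: "indicator (prod_emb UNIV (\<lambda>_. \<rho>) T (Pi\<^sub>E T F)) (\<lambda>i. x i) =
      (\<Prod>i<n. indicator (A i) (x i) :: ennreal)" for x :: "nat \<Rightarrow> real"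
  proof -
    have "(\<Prod>i<n. indicator (A i) (x i) :: ennreal) = (\<Prod>i\<in>T. indicator (F i) (x i))"
      using n by (intro prod.mono_neutral_cong_right) (auto simp: A_def)
    also have "\<dots> = indicator (prod_emb UNIV (\<lambda>_. \<rho>) T (Pi\<^sub>E T F)) x"
      using T(1) by (auto simp: prod_emb_def indicator_def PiE_iff prod_eq_1_iff prod_zero_iff split:
          if_splits)
    finally show ?thesis by simp
  qed
  have "emeasure (distr (PK \<Otimes>\<^sub>M PJ) (PiM UNIV (\<lambda>_. borel)) (\<lambda>(k, j) i. block_sum i k j))
      (prod_emb UNIV (\<lambda>_. \<rho>) T (Pi\<^sub>E T F))
      = (\<integral>\<^sup>+ x. indicator (prod_emb UNIV (\<lambda>_. \<rho>) T (Pi\<^sub>E T F)) x \<partial>distr (PK \<Otimes>\<^sub>M PJ) (PiM UNIV (\<lambda>_. borel))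
          (\<lambda>(k, j) i. block_sum i k j))"
    using box by simp
  also have "\<dots> = (\<integral>\<^sup>+ p. indicator (prod_emb UNIV (\<lambda>_. \<rho>) T (Pi\<^sub>E T F)) ((\<lambda>(k, j) i. block_sum i k j) p)
      \<partial>(PK \<Otimes>\<^sub>M PJ))"
    using bs box by (intro nn_integral_distr) auto
  also have "\<dots> = (\<integral>\<^sup>+ p. (\<Prod>i<n. indicator (A i) (block_sum i (fst p) (snd p))) \<partial>(PK \<Otimes>\<^sub>M PJ))"
    by (simp only: case_prod_beta ind)
  also have "\<dots> = (\<integral>\<^sup>+ k. \<integral>\<^sup>+ j. (\<Prod>i<n. indicator (A i) (block_sum i k j)) \<partial>PJ \<partial>PK)"
    using measurable_block_sums[where A=A, OF A] by (subst JS.P.nn_integral_fst[symmetric]) simp_all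
  also have "\<dots> = (\<Prod>i<n. emeasure \<rho> (A i))" by (rule nn_integral_block_sums) (rule A)
  also have "\<dots> = (\<Prod>i\<in>T. emeasure \<rho> (F i))"
    using n R.emeasure_space_1 by (intro prod.mono_neutral_cong_right) (auto simp: A_def)
  finally show "emeasure (distr (PK \<Otimes>\<^sub>M PJ) (PiM UNIV (\<lambda>_. borel)) (\<lambda>(k, j) i. block_sum i k j))
      (prod_emb UNIV (\<lambda>_. \<rho>) T (Pi\<^sub>E T F)) = (\<Prod>i\<in>T. emeasure \<rho> (F i))" .
qed

end

text \<open>\<open>Z\<close> is given through \<open>K\<close> and \<open>J\<close>, which does not
  directly say that its increments are independent. Along the grid they are block sums whose block
  lengths, the increments of \<open>K\<close>, are independent Poisson variables and independent of
  the jumps.\<close>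

lemma compound_poisson_increments_law:
  assumes cpp: "compound_poisson_process M \<mu> f Z" and h: "0 < h"
    and Z: "path_of Z \<in> measurable M path_space"
  shows "distr M (PiM UNIV (\<lambda>_. borel)) (increments h Z) =
    PiM UNIV (\<lambda>_. compound_law.\<rho> (measure_pmf (poisson_pmf (\<mu> * h))) (density lborel (\<lambda>x. ennreal (f x))))"
    and "compound_law (measure_pmf (poisson_pmf (\<mu> * h))) (density lborel (\<lambda>x. ennreal (f x)))"
proof -
  obtain K J where K: "poisson_process M \<mu> K"
    and J: "\<And>i. distributed M lborel (J i) (\<lambda>x. ennreal (f x))"
    and J_ind: "prob_space.indep_vars M (\<lambda>_. borel) J UNIV"
    and KJ: "indep_rvs M path_space (path_of (\<lambda>t \<omega>. real (K t \<omega>))) (PiM UNIV (\<lambda>_. borel)) (\<lambda>\<omega> i. J i \<omega>)"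
    and Z_eq: "\<And>t \<omega>. 0 \<le> t \<Longrightarrow> \<omega> \<in> space M \<Longrightarrow> Z t \<omega> = (\<Sum>i<K t \<omega>. J i \<omega>)"
    using cpp unfolding compound_poisson_process_def by blast
  \<comment> \<open>Increment laws are available for real processes; \<open>cnt\<close> below
    recovers the integer counts from real increments.\<close>
  define Y where "Y t \<omega> = real (K t \<omega>)" for t \<omega>
  have Y: "levy_process M Y" using K by (simp add: poisson_process_def Y_def[abs_def])
  interpret prob_space M using Y by (simp add: levy_process_def)
  define \<kappa> where "\<kappa> = measure_pmf (poisson_pmf (\<mu> * h))"
  define \<mu>J where "\<mu>J = density lborel (\<lambda>x. ennreal (f x))"
  have J_rv: "random_variable borel (J i)" for i using J[of i] by (auto simp: distributed_def)
  have J_distr: "distr M borel (J i) = \<mu>J" for i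
  proof -
    have "distr M borel (J i) = distr M lborel (J i)" by (rule distr_cong) auto
    then show ?thesis using J[of i] by (simp add: distributed_def \<mu>J_def)
  qed
  have pJ: "prob_space \<mu>J" unfolding J_distr[of 0, symmetric] by (rule prob_space_distr) (rule J_rv)
  interpret C: compound_law \<kappa> \<mu>J
  proof (rule compound_law.intro)
    show "prob_space \<kappa>" unfolding \<kappa>_def by (rule measure_pmf.prob_space_axioms)
    show "sets \<kappa> = sets (count_space UNIV)" by (simp add: \<kappa>_def)
    show "prob_space \<mu>J" by (rule pJ)
    show "sets \<mu>J = sets borel" by (simp add: \<mu>J_def)
  qed
  show "compound_law (measure_pmf (poisson_pmf (\<mu> * h))) (density lborel (\<lambda>x. ennreal (f x)))"
    using C.compound_law_axioms by (simp add: \<kappa>_def \<mu>J_def)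
  have J_law: "distr M (PiM UNIV (\<lambda>_. borel)) (\<lambda>\<omega> i. J i \<omega>) = C.PJ"
    using J_ind unfolding indep_vars_iff_distr_eq_PiM[OF UNIV_not_empty J_rv] J_distr
        by (simp only: restrict_UNIV)
  define cnt :: "real \<Rightarrow> nat" where "cnt x = nat \<lfloor>x\<rfloor>" for x
  have cnt [measurable]: "cnt \<in> measurable borel (count_space UNIV)" 
    unfolding cnt_def by (rule measurable_compose[OF measurable_real_floor]) simp
  define k where "k \<omega> i = cnt (increments h Y \<omega> i)" for \<omega> i
  have k_ind: "indep_vars (\<lambda>_. count_space UNIV) (\<lambda>i \<omega>. k \<omega> i) UNIV"
    unfolding k_def by (rule indep_vars_compose2[OF levy_increments_indep[OF Y h]]) simp
  have k_rv: "random_variable (count_space UNIV) (\<lambda>\<omega>. k \<omega> i)" for i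
    using k_ind unfolding indep_vars_def2 by blast
  have inc_rv: "random_variable borel (\<lambda>\<omega>. increments h Y \<omega> i)" for i
    using levy_increments_indep[OF Y h] unfolding indep_vars_def2 by blast
  have Yh: "random_variable borel (Y h)" using Y h by (simp add: levy_process_def)
  have Kh: "random_variable (count_space UNIV) (K h)"
    using measurable_compose[OF Yh cnt] by (simp add: Y_def cnt_def)
  have k_distr: "distr M (count_space UNIV) (\<lambda>\<omega>. k \<omega> i) = \<kappa>" for i
  proof -
    have "distr M (count_space UNIV) (\<lambda>\<omega>. k \<omega> i) =
        distr (distr M borel (\<lambda>\<omega>. increments h Y \<omega> i)) (count_space UNIV) cnt"
      unfolding k_def by (subst distr_distr[OF cnt inc_rv]) (simp add: comp_def)
    also have "\<dots> = distr (distr M borel (Y h)) (count_space UNIV) cnt"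
      by (simp only: levy_increments_distr[OF Y h])
    also have "\<dots> = distr M (count_space UNIV) (K h)"
      by (subst distr_distr[OF cnt Yh]) (simp add: comp_def Y_def cnt_def)
    also have "\<dots> = \<kappa>" using K h by (simp add: poisson_process_def \<kappa>_def)
    finally show ?thesis .
  qed
  have k_law: "distr M (PiM UNIV (\<lambda>_. count_space UNIV)) k = C.PK"
    using k_ind unfolding indep_vars_iff_distr_eq_PiM[OF UNIV_not_empty k_rv] k_distr
        by (simp only: restrict_UNIV)
  have cnt_path: "(\<lambda>x i. cnt (path_increments h x i)) \<in>
      measurable path_space (PiM UNIV (\<lambda>_. count_space UNIV))"
  proof (rule measurable_PiM_single')
    fix i
    show "(\<lambda>x. cnt (path_increments h x i)) \<in> measurable path_space (count_space UNIV)"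
      by (rule measurable_compose[OF
          measurable_compose[OF measurable_path_increments[OF h] measurable_component_singleton] cnt]) simp
  qed auto
  have "indep_rvs M (PiM UNIV (\<lambda>_. count_space UNIV)) (\<lambda>\<omega> i. cnt (path_increments h (path_of Y \<omega>) i))
     (PiM UNIV (\<lambda>_. borel)) (\<lambda>\<omega> i. J i \<omega>)"
    using KJ unfolding Y_def[symmetric]
    by (rule indep_rvs_compose[OF prob_space_axioms _ cnt_path, where \<psi>="\<lambda>x. x"]) simp
  moreover have "(\<lambda>\<omega> i. cnt (path_increments h (path_of Y \<omega>) i)) = k"
    unfolding k_def by (intro ext arg_cong[where f=cnt]) (use h in \<open>simp add: less_imp_le\<close>)
  ultimately have ind: "indep_rvs M (PiM UNIV (\<lambda>_. count_space UNIV)) k (PiM UNIV (\<lambda>_. borel))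
      (\<lambda>\<omega> i. J i \<omega>)"
    by simp
  have pair_law: "distr M (PiM UNIV (\<lambda>_. count_space UNIV) \<Otimes>\<^sub>M PiM UNIV (\<lambda>_. borel))
      (\<lambda>\<omega>. (k \<omega>, \<lambda>i. J i \<omega>)) = C.PK \<Otimes>\<^sub>M C.PJ"
    unfolding indep_rvs_distr[OF prob_space_axioms ind] k_law J_law ..
  have pair_rv: "(\<lambda>\<omega>. (k \<omega>, \<lambda>i. J i \<omega>)) \<in>
      measurable M (PiM UNIV (\<lambda>_. count_space UNIV) \<Otimes>\<^sub>M PiM UNIV (\<lambda>_. borel))"
    using ind unfolding indep_rvs_def by (intro measurable_Pair) auto
  have sets_pair: "sets (PiM UNIV (\<lambda>_. count_space UNIV) \<Otimes>\<^sub>M PiM UNIV (\<lambda>_. borel)) = sets (C.PK \<Otimes>\<^sub>M C.PJ)"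
    using C.\<kappa>(2) C.\<mu>J(2) by (intro sets_pair_measure_cong sets_PiM_cong) auto
  have blocks: "(\<lambda>(k, j) i. block_sum i k j) \<in>
      measurable (PiM UNIV (\<lambda>_. count_space UNIV) \<Otimes>\<^sub>M PiM UNIV (\<lambda>_. borel)) (PiM UNIV (\<lambda>_. borel))"
    unfolding measurable_cong_sets[OF sets_pair refl]
    using C.measurable_block_sum by (intro measurable_PiM_single') (auto simp: case_prod_beta)
  have block_law: "distr M (PiM UNIV (\<lambda>_. borel)) (\<lambda>\<omega> i. block_sum i (k \<omega>) (\<lambda>i. J i \<omega>)) =
      PiM UNIV (\<lambda>_. C.\<rho>)"
    unfolding C.distr_block_sums[symmetric] pair_law[symmetric]
    by (subst distr_distr[OF blocks pair_rv]) (simp add: comp_def)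
  \<comment> \<open>That \<open>K\<close> grows along the grid is extracted from its law: every
    increment is distributed as \<open>K h\<close>, which is nonnegative.\<close>
  have AE_nonneg: "AE \<omega> in M. \<forall>i. 0 \<le> increments h Y \<omega> i"
    unfolding AE_all_countable
  proof
    fix i
    have "AE x in distr M borel (Y h). 0 \<le> x"
      by (subst AE_distr_iff[OF Yh]) (auto simp: Y_def)
    then have "AE x in distr M borel (\<lambda>\<omega>. increments h Y \<omega> i). 0 \<le> x"
      by (simp only: levy_increments_distr[OF Y h])
    then show "AE \<omega> in M. 0 \<le> increments h Y \<omega> i"
      by (subst (asm) AE_distr_iff[OF inc_rv]) auto
  qed
  have AE_0: "AE \<omega> in M. Y 0 \<omega> = 0" using Y by (simp add: levy_process_def)
  have eq: "AE \<omega> in M. increments h Z \<omega> = (\<lambda>i. block_sum i (k \<omega>) (\<lambda>i. J i \<omega>))"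
    using AE_nonneg AE_0 AE_space
  proof eventually_elim
    case (elim \<omega>)
    have mono: "K (real i * h) \<omega> \<le> K (real (Suc i) * h) \<omega>" for i
      using elim(1)[rule_format, of i] by (simp add: Y_def)
    have k_eq: "k \<omega> i = K (real (Suc i) * h) \<omega> - K (real i * h) \<omega>" for i
    proof -
      have "increments h Y \<omega> i = real (K (real (Suc i) * h) \<omega> - K (real i * h) \<omega>)"
        using mono[of i] by (simp add: Y_def of_nat_diff del: of_nat_Suc)
      then show ?thesis unfolding k_def by (simp only: cnt_def floor_of_nat nat_int)
    qed
    have C_eq: "(\<Sum>i'<i. k \<omega> i') = K (real i * h) \<omega>" for i
    proof (induction i)
      case 0
      then show ?case using elim(2) by (simp add: Y_def)
    next
      case (Suc i)
      then show ?case using mono[of i] by (simp add: k_eq del: of_nat_Suc)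
    qed
    show ?case
    proof
      fix i
      have t: "0 \<le> real i * h" "0 \<le> real (Suc i) * h" using h by auto
      have "(\<Sum>l<a + d. g l) = (\<Sum>l<a. g l) + (\<Sum>l<d. g (a + l))" for a d and g :: "nat \<Rightarrow> real"
        by (induction d) auto
      from this[where a1="K (real i * h) \<omega>" and d1="k \<omega> i" and g1="\<lambda>l. J l \<omega>"]
      show "increments h Z \<omega> i = block_sum i (k \<omega>) (\<lambda>i. J i \<omega>)"
        using mono[of i] unfolding Z_eq[OF t(1) elim(3)] Z_eq[OF t(2) elim(3)] block_sum_def C_eq
        by (simp add: k_eq del: of_nat_Suc)
    qed
  qed
  have Zinc: "increments h Z \<in> measurable M (PiM UNIV (\<lambda>_. borel))"
    using measurable_compose[OF Z measurable_path_increments[OF h]]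
    by (simp only: path_increments_path_of[OF h])
  have "distr M (PiM UNIV (\<lambda>_. borel)) (increments h Z) =
      distr M (PiM UNIV (\<lambda>_. borel)) (\<lambda>\<omega> i. block_sum i (k \<omega>) (\<lambda>i. J i \<omega>))"
    by (rule distr_cong_AE[OF refl refl eq Zinc])
       (use measurable_compose[OF pair_rv blocks] in simp)
  then show "distr M (PiM UNIV (\<lambda>_. borel)) (increments h Z) =
    PiM UNIV (\<lambda>_. compound_law.\<rho> (measure_pmf (poisson_pmf (\<mu> * h))) (density lborel (\<lambda>x. ennreal (f x))))"
    using block_law by (simp only: \<kappa>_def \<mu>J_def)
qed

section \<open>The Lindley step under exponential killing\<close>

text \<open>The leading terms of both sequences form an increment \<open>x\<close> that is
  independent of the minimum over the shifted sequences. That minimum has the law of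
  \<open>W n\<close> without being equal to it, so the recursion is one of laws.\<close>

lemma lindley_recursion:
  fixes \<rho>1 \<rho>2 :: "real measure" and a :: real
  assumes "prob_space \<rho>1" "prob_space \<rho>2" and sets [measurable_cong]: "sets \<rho>1 = sets borel" "sets \<rho>2 =
      sets borel"
  defines "P \<equiv> PiM UNIV (\<lambda>_::nat. \<rho>1) \<Otimes>\<^sub>M PiM UNIV (\<lambda>_::nat. \<rho>2)"
  defines "W \<equiv> \<lambda>n (z, s). running_min n (\<lambda>i. a + z i - s i)"
  shows "distr P borel (W (Suc n)) =
    distr (distr (\<rho>1 \<Otimes>\<^sub>M \<rho>2) borel (\<lambda>(z, s). a + z - s) \<Otimes>\<^sub>M distr P borel (W n)) borel
        (\<lambda>(x, w). min 0 (x + w))"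
proof -
  interpret A: prob_space \<rho>1 by fact
  interpret B: prob_space \<rho>2 by fact
  interpret SA: sequence_space \<rho>1 ..
  interpret SB: sequence_space \<rho>2 ..
  interpret AB: pair_prob_space \<rho>1 \<rho>2 ..
  interpret PP: pair_prob_space SA.S SB.S ..
  interpret AS: pair_prob_space SA.S \<rho>2 ..
  let ?\<rho> = "distr (\<rho>1 \<Otimes>\<^sub>M \<rho>2) borel (\<lambda>(z, s). a + z - s)"
  have comp: "(\<lambda>x. x i) \<in> borel_measurable SA.S" "(\<lambda>x. x i) \<in> borel_measurable SB.S" for i
    using measurable_component_singleton[of i UNIV "\<lambda>_. \<rho>1"]
        measurable_component_singleton[of i UNIV "\<lambda>_. \<rho>2"]
    by (simp_all add: measurable_cong_sets[OF refl sets(1)] measurable_cong_sets[OF refl sets(2)])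
  have W [measurable]: "W n \<in> borel_measurable (SA.S \<Otimes>\<^sub>M SB.S)" for n
    unfolding W_def case_prod_beta
    by (intro measurable_running_min borel_measurable_diff borel_measurable_add borel_measurable_const
        measurable_compose[OF measurable_fst comp(1)] measurable_compose[OF measurable_snd comp(2)])
  have W_sec: "(\<lambda>s. W n (z, s)) \<in> borel_measurable SB.S" for n z
    unfolding W_def case_prod_conv
    by (intro measurable_running_min borel_measurable_diff borel_measurable_const comp(2))
  have WP: "W n \<in> borel_measurable P" for n unfolding P_def by (rule W)
  have W_Suc: "W (Suc n) (case_nat z0 z, case_nat s0 s) = min 0 ((a + z0 - s0) + W n (z, s))"
      for n z0 z s0 s
    by (simp add: W_def)
  interpret WP: prob_space "distr P borel (W n)"
    unfolding P_def by (rule PP.prob_space_distr) (rule W)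
  have meas_\<rho>: "(\<lambda>(z, s). a + z - s) \<in> borel_measurable (\<rho>1 \<Otimes>\<^sub>M \<rho>2)" by measurable
  interpret rho: prob_space ?\<rho> by (rule AB.prob_space_distr) (rule meas_\<rho>)
  interpret RW: pair_prob_space ?\<rho> "distr P borel (W n)" ..
  show ?thesis
  proof (rule measure_eqI)
    fix E assume "E \<in> sets (distr P borel (W (Suc n)))"
    then have E [measurable]: "E \<in> sets borel" by simp
    define I where "I x = (indicator E x :: ennreal)" for x :: real
    have I [measurable]: "I \<in> borel_measurable borel" unfolding I_def by measurable
    have H: "(\<lambda>x. \<integral>\<^sup>+ w. I (min 0 (x + w)) \<partial>distr P borel (W n)) \<in> borel_measurable borel" by measurable
    have em: "emeasure N E = (\<integral>\<^sup>+ x. I x \<partial>N)" if "sets N = sets borel" for N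
      unfolding I_def using that by (simp add: nn_integral_indicator)
    have "emeasure (distr P borel (W (Suc n))) E = (\<integral>\<^sup>+ p. I (W (Suc n) p) \<partial>P)"
      by (subst em) (auto simp: nn_integral_distr[OF WP])
    also have "\<dots> = (\<integral>\<^sup>+ z. \<integral>\<^sup>+ s. I (W (Suc n) (z, s)) \<partial>SB.S \<partial>SA.S)"
      unfolding P_def by (subst SB.P.nn_integral_fst[symmetric]) simp_all
    also have "\<dots> = (\<integral>\<^sup>+ z0. \<integral>\<^sup>+ z. \<integral>\<^sup>+ s. I (W (Suc n) (case_nat z0 z, s)) \<partial>SB.S \<partial>SA.S \<partial>\<rho>1)"
      by (rule SA.nn_integral_PiM_iter) measurable
    also have "\<dots> = (\<integral>\<^sup>+ z0. \<integral>\<^sup>+ z. \<integral>\<^sup>+ s0. \<integral>\<^sup>+ s.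
        I (W (Suc n) (case_nat z0 z, case_nat s0 s)) \<partial>SB.S \<partial>\<rho>2 \<partial>SA.S \<partial>\<rho>1)"
      by (intro nn_integral_cong SB.nn_integral_PiM_iter measurable_compose[OF W_sec I])
    also have "\<dots> = (\<integral>\<^sup>+ z0. \<integral>\<^sup>+ z. \<integral>\<^sup>+ s0. \<integral>\<^sup>+ s.
        I (min 0 ((a + z0 - s0) + W n (z, s))) \<partial>SB.S \<partial>\<rho>2 \<partial>SA.S \<partial>\<rho>1)"
      by (simp only: W_Suc)
    \<comment> \<open>The leading subordinator increment is moved past the remaining jump sequence,
      so that both leading increments become the outer variables.\<close>
    also have "\<dots> = (\<integral>\<^sup>+ z0. \<integral>\<^sup>+ s0. \<integral>\<^sup>+ z. \<integral>\<^sup>+ s.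
        I (min 0 ((a + z0 - s0) + W n (z, s))) \<partial>SB.S \<partial>SA.S \<partial>\<rho>2 \<partial>\<rho>1)"
      by (intro nn_integral_cong AS.Fubini'[symmetric]) measurable
    also have "\<dots> = (\<integral>\<^sup>+ z0. \<integral>\<^sup>+ s0. \<integral>\<^sup>+ p. I (min 0 ((a + z0 - s0) + W n p)) \<partial>P \<partial>\<rho>2 \<partial>\<rho>1)"
      unfolding P_def by (intro nn_integral_cong) (subst SB.P.nn_integral_fst[symmetric], simp_all)
    also have "\<dots> = (\<integral>\<^sup>+ z0. \<integral>\<^sup>+ s0. \<integral>\<^sup>+ w. I (min 0 ((a + z0 - s0) + w)) \<partial>distr P borel (W n) \<partial>\<rho>2 \<partial>\<rho>1)"
      by (intro nn_integral_cong nn_integral_distr[OF WP, symmetric]) measurable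
    also have "\<dots> = (\<integral>\<^sup>+ q. \<integral>\<^sup>+ w. I (min 0 ((\<lambda>(z, s). a + z - s) q + w)) \<partial>distr P borel (W n) \<partial>(\<rho>1 \<Otimes>\<^sub>M \<rho>2))"
      by (subst B.nn_integral_fst[symmetric], rule measurable_compose[OF meas_\<rho> H]) simp
    also have "\<dots> = (\<integral>\<^sup>+ x. \<integral>\<^sup>+ w. I (min 0 (x + w)) \<partial>distr P borel (W n) \<partial>?\<rho>)"
      by (rule nn_integral_distr[OF meas_\<rho>, symmetric]) (simp add: H)
    also have "\<dots> = (\<integral>\<^sup>+ p. I ((\<lambda>(x, w). min 0 (x + w)) p) \<partial>(?\<rho> \<Otimes>\<^sub>M distr P borel (W n)))"
      by (subst WP.nn_integral_fst[symmetric]) simp_all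
    also have "\<dots> = emeasure (distr (?\<rho> \<Otimes>\<^sub>M distr P borel (W n)) borel (\<lambda>(x, w). min 0 (x + w))) E"
      by (subst em) (auto intro!: nn_integral_distr[symmetric])
    finally show "emeasure (distr P borel (W (Suc n))) E = \<dots>" .
  qed simp
qed

lemma measurable_floor_div: "(\<lambda>t :: real. nat \<lfloor>t / h\<rfloor>) \<in> measurable borel (count_space UNIV)"
proof -
  have "(\<lambda>t :: real. t / h) \<in> borel_measurable borel" by simp
  from measurable_compose[OF this measurable_real_floor]
  show ?thesis by (rule measurable_compose) simp
qed

text \<open>Split at time \<open>h\<close>. Before it the index is 0; after it, translation by
  \<open>h\<close> multiplies the density by \<open>exp (- (q * h))\<close> and leaves the index one
  higher. The number of completed grid steps is thus geometric.\<close>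

lemma exponential_memoryless:
  fixes a :: "nat \<Rightarrow> complex" and q h :: real
  assumes "prob_space M" and e: "distributed M lborel e (\<lambda>x. ennreal (exponential_density q x))"
    and q: "0 < q" and h: "0 < h" and bd: "\<And>n. norm (a n) \<le> C"
  shows "(LINT \<omega>|M. a (nat \<lfloor>e \<omega> / h\<rfloor>)) =
    complex_of_real (1 - exp (- (q * h))) * a 0 + complex_of_real (exp (- (q * h))) *
        (LINT \<omega>|M. a (Suc (nat \<lfloor>e \<omega> / h\<rfloor>)))"
proof -
  interpret prob_space M by fact
  define d where "d t = (if t < 0 then 0 else q * exp (- t * q))" for t :: real
  have d_eq: "exponential_density q = d" by (auto simp: exponential_density_def d_def)
  have d [measurable]: "d \<in> borel_measurable borel" unfolding d_def by measurable
  have d0: "0 \<le> d t" for t using q by (simp add: d_def)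
  have meas: "(\<lambda>t. b (nat \<lfloor>t / h\<rfloor>)) \<in> borel_measurable borel" for b :: "nat \<Rightarrow> complex"
    by (rule measurable_compose[OF measurable_floor_div]) simp
  have int_d: "integrable lborel d"
    using distributed_integrable[OF e, of "\<lambda>_. 1"] by (simp add: d_eq d0)
  have ex: "(LINT \<omega>|M. b (nat \<lfloor>e \<omega> / h\<rfloor>)) = (LINT t|lborel. d t *\<^sub>R b (nat \<lfloor>t / h\<rfloor>))"
      for b :: "nat \<Rightarrow> complex"
  proof -
    have e_meas: "e \<in> measurable M lborel" using e by (auto simp: distributed_def)
    have "(LINT \<omega>|M. b (nat \<lfloor>e \<omega> / h\<rfloor>)) = (LINT t|distr M lborel e. b (nat \<lfloor>t / h\<rfloor>))"
      by (rule integral_distr[OF e_meas, symmetric]) (simp add: meas)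
    also have "\<dots> = (LINT t|lborel. d t *\<^sub>R b (nat \<lfloor>t / h\<rfloor>))"
      unfolding distributed_distr_eq_density[OF e] d_eq
      by (rule integral_density) (auto simp: meas d0)
    finally show ?thesis .
  qed
  have int: "integrable lborel (\<lambda>t. d t *\<^sub>R b (nat \<lfloor>t / h\<rfloor>))" if "\<And>n. norm (b n) \<le> C"
      for b :: "nat \<Rightarrow> complex"
  proof (rule Bochner_Integration.integrable_bound[OF integrable_mult_right[OF int_d, of C]])
    have "0 \<le> C" using that[of 0] norm_ge_zero order_trans by blast
    then show "AE t in lborel. norm (d t *\<^sub>R b (nat \<lfloor>t / h\<rfloor>)) \<le> norm (C * d t)"
      using that d0 by (intro AE_I2) (simp add: abs_mult mult.commute[of C] mult_left_mono)
  qed (use meas[of b] in measurable)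
  define p where "p = exp (- (q * h))"
  have prob_lt: "(LINT t|lborel. indicator {..<h} t * d t) = 1 - p"
  proof -
    have "(LINT t|lborel. indicator {..<h} t * d t) = (LINT \<omega>|M. indicator {..<h} (e \<omega>))"
      using distributed_integral[OF e, of "indicator {..<h} :: real \<Rightarrow> real"]
          by (simp add: d_eq d0 mult.commute)
    also have "\<dots> = prob {\<omega> \<in> space M. e \<omega> < h}"
    proof -
      have "e \<in> borel_measurable M" using e by (auto simp: distributed_def)
      then have "{\<omega> \<in> space M. e \<omega> < h} \<in> events" by measurable
      moreover have "(LINT \<omega>|M. indicator {..<h} (e \<omega>)) =
          (LINT \<omega>|M. indicator {\<omega> \<in> space M. e \<omega> < h} \<omega> :: real)"
        by (intro Bochner_Integration.integral_cong refl) (auto simp: indicator_def)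
      ultimately show ?thesis by simp
    qed
    also have "\<dots> = prob (space M) - prob {\<omega> \<in> space M. h \<le> e \<omega>}"
    proof -
      have "e \<in> borel_measurable M" using e by (auto simp: distributed_def)
      then have ev: "{\<omega> \<in> space M. h \<le> e \<omega>} \<in> events" by measurable
      have "{\<omega> \<in> space M. e \<omega> < h} = space M - {\<omega> \<in> space M. h \<le> e \<omega>}" by auto
      then show ?thesis using prob_compl[OF ev] prob_space by simp
    qed
    also have "prob {\<omega> \<in> space M. h \<le> e \<omega>} = p"
    proof -
      have e_meas: "e \<in> borel_measurable M" using e by (auto simp: distributed_def)
      have "prob {\<omega> \<in> space M. h \<le> e \<omega>} = prob {\<omega> \<in> space M. h < e \<omega>}"
      proof (rule measure_eq_AE)
        have "AE t in distr M lborel e. t \<noteq> h"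
          unfolding distributed_distr_eq_density[OF e]
          using AE_lborel_singleton[of h] by (subst AE_density) (auto simp: d_eq)
        then have "AE \<omega> in M. e \<omega> \<noteq> h" using e_meas by (subst (asm) AE_distr_iff) auto
        then show "AE \<omega> in M. (\<omega> \<in> {\<omega> \<in> space M. h \<le> e \<omega>}) = (\<omega> \<in> {\<omega> \<in> space M. h < e \<omega>})"
          by eventually_elim auto
      qed (use e_meas in measurable)
      also have "\<dots> = p"
        using exponential_distributedD_gt[OF e, of h] h q by (simp add: p_def mult.commute)
      finally show ?thesis .
    qed
    finally show ?thesis using prob_space by simp
  qed
  have i1: "integrable lborel (\<lambda>t. indicator {..<h} t *\<^sub>R (d t *\<^sub>R a (nat \<lfloor>t / h\<rfloor>)))"
    and i2: "integrable lborel (\<lambda>t. indicator {h..} t *\<^sub>R (d t *\<^sub>R a (nat \<lfloor>t / h\<rfloor>)))"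
    by (intro integrable_mult_indicator int bd; simp)+
  have "(LINT \<omega>|M. a (nat \<lfloor>e \<omega> / h\<rfloor>)) = (LINT t|lborel. indicator {..<h} t *\<^sub>R (d t *\<^sub>R a (nat \<lfloor>t / h\<rfloor>))
      + indicator {h..} t *\<^sub>R (d t *\<^sub>R a (nat \<lfloor>t / h\<rfloor>)))"
    unfolding ex by (intro Bochner_Integration.integral_cong refl) (auto simp: indicator_def)
  also have "\<dots> = (LINT t|lborel. indicator {..<h} t *\<^sub>R (d t *\<^sub>R a (nat \<lfloor>t / h\<rfloor>)))
      + (LINT t|lborel. indicator {h..} t *\<^sub>R (d t *\<^sub>R a (nat \<lfloor>t / h\<rfloor>)))"
    by (rule Bochner_Integration.integral_add[OF i1 i2])
  also have "(LINT t|lborel. indicator {..<h} t *\<^sub>R (d t *\<^sub>R a (nat \<lfloor>t / h\<rfloor>))) =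
      (LINT t|lborel. (indicator {..<h} t * d t) *\<^sub>R a 0)"
  proof (intro Bochner_Integration.integral_cong refl)
    fix t
    show "indicator {..<h} t *\<^sub>R (d t *\<^sub>R a (nat \<lfloor>t / h\<rfloor>)) = (indicator {..<h} t * d t) *\<^sub>R a 0"
    proof (cases "0 \<le> t \<and> t < h")
      case True
      then have "t / h < 1" "0 \<le> t / h" using h by auto
      then have "\<lfloor>t / h\<rfloor> = 0" by (simp add: floor_eq_iff)
      then show ?thesis by simp
    next
      case False
      then show ?thesis by (auto simp: d_def indicator_def)
    qed
  qed
  also have "\<dots> = complex_of_real (1 - p) * a 0"
    using integrable_mult_indicator[OF _ int_d, of "{..<h}"]
    by (subst integral_scaleR_left) (simp_all add: prob_lt scaleR_conv_of_real)
  also have "(LINT t|lborel. indicator {h..} t *\<^sub>R (d t *\<^sub>R a (nat \<lfloor>t / h\<rfloor>))) =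
      \<bar>1\<bar> *\<^sub>R (LINT t|lborel. indicator {h..} (h + 1 * t) *\<^sub>R
          (d (h + 1 * t) *\<^sub>R a (nat \<lfloor>(h + 1 * t) / h\<rfloor>)))"
    by (rule lborel_integral_real_affine) simp
  also have "\<dots> = (LINT t|lborel. of_real p * (d t *\<^sub>R a (Suc (nat \<lfloor>t / h\<rfloor>))))"
  proof -
    have "indicator {h..} (h + 1 * t) *\<^sub>R (d (h + 1 * t) *\<^sub>R a (nat \<lfloor>(h + 1 * t) / h\<rfloor>)) =
        of_real p * (d t *\<^sub>R a (Suc (nat \<lfloor>t / h\<rfloor>)))" for t
    proof (cases "0 \<le> t")
      case True
      have "(h + 1 * t) / h = t / h + 1" using h by (simp add: field_simps)
      then have "\<lfloor>(h + 1 * t) / h\<rfloor> = \<lfloor>t / h\<rfloor> + 1" by simp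
      moreover have "0 \<le> \<lfloor>t / h\<rfloor>" using True h by simp
      ultimately have "nat \<lfloor>(h + 1 * t) / h\<rfloor> = Suc (nat \<lfloor>t / h\<rfloor>)"
          by (simp add: Suc_nat_eq_nat_zadd1 add.commute)
      moreover have "d (h + t) = p * d t"
        using True h by (simp add: d_def p_def exp_add[symmetric] algebra_simps)
      ultimately show ?thesis using True by (simp add: scaleR_conv_of_real)
    qed (simp add: d_def)
    then show ?thesis by simp
  qed
  also have "\<dots> = of_real p * (LINT \<omega>|M. a (Suc (nat \<lfloor>e \<omega> / h\<rfloor>)))"
    unfolding ex[of "\<lambda>n. a (Suc n)"] by (rule integral_mult_right_zero)
  finally show ?thesis by (simp add: p_def)
qed

section \<open>The killed walk at a fixed mesh\<close>

locale jump_model = prob_space M for M :: "'a measure" +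
  fixes X Z S :: "real \<Rightarrow> 'a \<Rightarrow> real" and e :: "'a \<Rightarrow> real" and c \<mu> q :: real
    and f :: "real \<Rightarrow> real" and \<nu> :: "real measure"
  assumes f_meas: "f \<in> borel_measurable borel" and f_nonneg: "\<And>x. 0 \<le> f x" and f_neg: "\<And>x. x \<le> 0 \<Longrightarrow> f x = 0"
    and f_int: "(\<integral>\<^sup>+ x. ennreal (f x) \<partial>lborel) = 1"
    and c_pos: "0 < c" and mu_pos: "0 < \<mu>"
    and cpp: "compound_poisson_process M \<mu> f Z"
    and sub: "driftless_subordinator M \<nu> S"
    and ZS: "indep_rvs M path_space (path_of Z) path_space (path_of S)"
    and X_eq: "\<And>t \<omega>. 0 \<le> t \<Longrightarrow> \<omega> \<in> space M \<Longrightarrow> X t \<omega> = c * t + Z t \<omega> - S t \<omega>"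
    and q_pos: "0 < q"
    and e_dist: "distributed M lborel e (\<lambda>x. ennreal (exponential_density q x))"
    and eX: "indep_rvs M borel e path_space (path_of X)"
begin

definition "\<mu>J = density lborel (\<lambda>x. ennreal (f x))"
definition "\<rho>Z h = compound_law.\<rho> (measure_pmf (poisson_pmf (\<mu> * h))) \<mu>J"
definition "\<rho>S h = distr M borel (S h)"
definition "\<rho>X h = distr (\<rho>Z h \<Otimes>\<^sub>M \<rho>S h) borel (\<lambda>(z, s). c * h + z - s)"

lemma compound_law: "0 < h \<Longrightarrow> compound_law (measure_pmf (poisson_pmf (\<mu> * h))) \<mu>J"
  unfolding \<mu>J_def using compound_poisson_increments_law(2)[OF cpp] ZS by (auto simp: indep_rvs_def)

lemma Z_law: "0 < h \<Longrightarrow> distr M (PiM UNIV (\<lambda>_. borel)) (increments h Z) = PiM UNIV (\<lambda>_. \<rho>Z h)"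
  unfolding \<mu>J_def \<rho>Z_def using compound_poisson_increments_law(1)[OF cpp] ZS by (auto simp: indep_rvs_def)

lemma S_levy: "levy_process M S" using sub by (simp add: driftless_subordinator_def)

lemma S_law: "0 < h \<Longrightarrow> distr M (PiM UNIV (\<lambda>_. borel)) (increments h S) = PiM UNIV (\<lambda>_. \<rho>S h)"
  unfolding \<rho>S_def by (rule levy_increments_law[OF S_levy])

lemma S_rv: "0 \<le> t \<Longrightarrow> S t \<in> borel_measurable M"
  using S_levy by (simp add: levy_process_def)

lemma rho_prob: "0 < h \<Longrightarrow> prob_space (\<rho>Z h)" "0 < h \<Longrightarrow> prob_space (\<rho>S h)"
  and rho_sets [simp]: "0 < h \<Longrightarrow> sets (\<rho>Z h) = sets borel" "sets (\<rho>S h) = sets borel" "sets (\<rho>X h) =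
      sets borel"
proof -
  assume h: "0 < h"
  interpret C: compound_law "measure_pmf (poisson_pmf (\<mu> * h))" \<mu>J by (rule compound_law[OF h])
  show "prob_space (\<rho>Z h)" unfolding \<rho>Z_def by (rule C.R.prob_space_axioms)
  show "sets (\<rho>Z h) = sets borel" unfolding \<rho>Z_def by simp
  show "prob_space (\<rho>S h)" unfolding \<rho>S_def by (rule prob_space_distr) (use S_rv h in auto)
qed (simp_all add: \<rho>S_def \<rho>X_def)

lemma rhoX_prob: assumes h: "0 < h" shows "prob_space (\<rho>X h)"
proof -
  interpret A: prob_space "\<rho>Z h" by (rule rho_prob[OF h])
  interpret B: prob_space "\<rho>S h" by (rule rho_prob[OF h])
  interpret pair_prob_space "\<rho>Z h" "\<rho>S h" ..
  note [measurable_cong] = rho_sets(1)[OF h] rho_sets(2)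
  show ?thesis unfolding \<rho>X_def by (rule prob_space_distr) measurable
qed

lemma ZS_law:
  assumes h: "0 < h"
  shows "distr M (PiM UNIV (\<lambda>_. borel) \<Otimes>\<^sub>M PiM UNIV (\<lambda>_. borel))
      (\<lambda>\<omega>. (increments h Z \<omega>, increments h S \<omega>)) =
    PiM UNIV (\<lambda>_. \<rho>Z h) \<Otimes>\<^sub>M PiM UNIV (\<lambda>_. \<rho>S h)"
    and ZS_rv: "(\<lambda>\<omega>. (increments h Z \<omega>, increments h S \<omega>)) \<in>
        measurable M (PiM UNIV (\<lambda>_. borel) \<Otimes>\<^sub>M PiM UNIV (\<lambda>_. borel))"
proof -
  have ind: "indep_rvs M (PiM UNIV (\<lambda>_. borel)) (increments h Z) (PiM UNIV (\<lambda>_. borel)) (increments h S)"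
    using indep_rvs_compose[OF prob_space_axioms ZS measurable_path_increments[OF h]
        measurable_path_increments[OF h]]
    by (simp only: path_increments_path_of[OF h])
  show "distr M (PiM UNIV (\<lambda>_. borel) \<Otimes>\<^sub>M PiM UNIV (\<lambda>_. borel)) (\<lambda>\<omega>. (increments h Z \<omega>, increments h S \<omega>)) =
    PiM UNIV (\<lambda>_. \<rho>Z h) \<Otimes>\<^sub>M PiM UNIV (\<lambda>_. \<rho>S h)"
    unfolding indep_rvs_distr[OF prob_space_axioms ind] Z_law[OF h] S_law[OF h] ..
  show "(\<lambda>\<omega>. (increments h Z \<omega>, increments h S \<omega>)) \<in>
      measurable M (PiM UNIV (\<lambda>_. borel) \<Otimes>\<^sub>M PiM UNIV (\<lambda>_. borel))"
    using ind unfolding indep_rvs_def by (intro measurable_Pair) auto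
qed

definition "W h n \<omega> = running_min n (increments h X \<omega>)"

lemma measurable_path_running_min:
  "0 < h \<Longrightarrow> (\<lambda>x. running_min n (path_increments h x)) \<in> borel_measurable path_space"
  by (rule measurable_running_min,
      rule measurable_compose[OF measurable_path_increments measurable_component_singleton]) auto

lemma W_path: "0 < h \<Longrightarrow> W h n \<omega> = running_min n (path_increments h (path_of X \<omega>))"
  unfolding W_def by (simp only: path_increments_path_of)

lemma W_rv:
  assumes h: "0 < h" shows "W h n \<in> borel_measurable M"
proof -
  have "path_of X \<in> measurable M path_space" using eX by (simp add: indep_rvs_def)
  from measurable_compose[OF this measurable_path_running_min[OF h]]
  show ?thesis unfolding W_path[OF h, symmetric] .
qed

text \<open>The increments of \<open>Z\<close> and \<open>S\<close> are kept as a pair of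
  independent sequences instead of being added, which is the form in which
  \<open>lindley_recursion\<close> consumes independence.\<close>

lemma W_law:
  assumes h: "0 < h"
  shows "distr M borel (W h n) = distr (PiM UNIV (\<lambda>_. \<rho>Z h) \<Otimes>\<^sub>M PiM UNIV (\<lambda>_. \<rho>S h)) borel
    (\<lambda>(z, s). running_min n (\<lambda>i. c * h + z i - s i))"
proof -
  have meas: "(\<lambda>(z, s). running_min n (\<lambda>i. c * h + z i - s i)) \<in>
      borel_measurable (PiM UNIV (\<lambda>_. borel) \<Otimes>\<^sub>M PiM UNIV (\<lambda>_. borel :: real measure))"
    unfolding case_prod_beta by (rule measurable_running_min) measurable
  have "distr M borel (W h n) =
      distr M borel (\<lambda>\<omega>. (\<lambda>(z, s). running_min n (\<lambda>i. c * h + z i - s i))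
          (increments h Z \<omega>, increments h S \<omega>))"
  proof (rule distr_cong[OF refl refl])
    fix \<omega> assume \<omega>: "\<omega> \<in> space M"
    have "increments h X \<omega> i = c * h + increments h Z \<omega> i - increments h S \<omega> i" for i
      using X_eq[OF _ \<omega>, of "real (Suc i) * h"] X_eq[OF _ \<omega>, of "real i * h"] h by (simp add: algebra_simps)
    then show "W h n \<omega> = (\<lambda>(z, s). running_min n (\<lambda>i. c * h + z i - s i))
        (increments h Z \<omega>, increments h S \<omega>)"
      unfolding W_def case_prod_conv by (intro arg_cong[where f="running_min n"] ext)
  qed
  also have "\<dots> = distr (PiM UNIV (\<lambda>_. \<rho>Z h) \<Otimes>\<^sub>M PiM UNIV (\<lambda>_. \<rho>S h)) borel
    (\<lambda>(z, s). running_min n (\<lambda>i. c * h + z i - s i))"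
    unfolding ZS_law(1)[OF h, symmetric] by (subst distr_distr[OF meas ZS_rv[OF h]]) (simp add: comp_def)
  finally show ?thesis .
qed

text \<open>The transition operator of the walk reflected at 0, acting on test functions.\<close>

definition "step h g w = (LINT x|\<rho>X h. g (min 0 (x + w)))" for g :: "real \<Rightarrow> complex"

lemma step_props:
  fixes g :: "real \<Rightarrow> complex"
  assumes h: "0 < h" and g [measurable]: "g \<in> borel_measurable borel" and bd: "\<And>x. norm (g x) \<le> C"
  shows "step h g \<in> borel_measurable borel" "norm (step h g w) \<le> C"
    "(LINT \<omega>|M. g (W h (Suc n) \<omega>)) = (LINT \<omega>|M. step h g (W h n \<omega>))"
proof -
  interpret R: prob_space "\<rho>X h" by (rule rhoX_prob[OF h])
  note [measurable_cong] = rho_sets(3)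
  show m: "step h g \<in> borel_measurable borel" unfolding step_def[abs_def] by measurable
  have int: "integrable (\<rho>X h) (\<lambda>x. g (min 0 (x + w)))" for w
    by (rule R.integrable_const_bound[where B=C]) (use bd in auto)
  have "norm (step h g w) \<le> (LINT x|\<rho>X h. C)" unfolding step_def
    by (rule order_trans[OF integral_norm_bound], rule integral_mono) (use int bd in auto)
  then show "norm (step h g w) \<le> C" using R.prob_space by simp
  interpret V: prob_space "distr M borel (W h n)" by (rule prob_space_distr) (rule W_rv[OF h])
  interpret RV: pair_prob_space "\<rho>X h" "distr M borel (W h n)" ..
  have intp: "integrable (\<rho>X h \<Otimes>\<^sub>M distr M borel (W h n)) (\<lambda>(x, w). g (min 0 (x + w)))"
    by (rule RV.integrable_const_bound[where B=C]) (use bd in auto)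
  have "(LINT \<omega>|M. g (W h (Suc n) \<omega>)) = (LINT w|distr M borel (W h (Suc n)). g w)"
    by (subst integral_distr[OF W_rv[OF h]]) auto
  also have "distr M borel (W h (Suc n)) =
      distr (\<rho>X h \<Otimes>\<^sub>M distr M borel (W h n)) borel (\<lambda>(x, w). min 0 (x + w))"
    unfolding \<rho>X_def W_law[OF h] by (rule lindley_recursion) (use h rho_prob in auto)
  also have "(LINT w|distr (\<rho>X h \<Otimes>\<^sub>M distr M borel (W h n)) borel (\<lambda>(x, w). min 0 (x + w)). g w) =
      (LINT p|(\<rho>X h \<Otimes>\<^sub>M distr M borel (W h n)). g ((\<lambda>(x, w). min 0 (x + w)) p))"
    by (rule integral_distr) measurable
  also have "\<dots> = (LINT p|(\<rho>X h \<Otimes>\<^sub>M distr M borel (W h n)). (\<lambda>(x, w). g (min 0 (x + w))) p)"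
    by (simp add: case_prod_beta)
  also have "\<dots> = (LINT w|distr M borel (W h n). step h g w)"
    unfolding step_def using RV.integral_snd[of "\<lambda>x w. g (min 0 (x + w))"] intp by simp
  also have "\<dots> = (LINT \<omega>|M. step h g (W h n \<omega>))"
    by (subst integral_distr[OF W_rv[OF h]]) (auto intro: m)
  finally show "(LINT \<omega>|M. g (W h (Suc n) \<omega>)) = (LINT \<omega>|M. step h g (W h n \<omega>))" .
qed

text \<open>The number of steps is geometric and at least 1. The additional step is the one that
  \<open>running_min_increments_tendsto\<close> requires in order to reach beyond the time
  \<open>e\<close>.\<close>

definition "V h \<omega> = W h (Suc (nat \<lfloor>e \<omega> / h\<rfloor>)) \<omega>"

lemma e_rv: "e \<in> borel_measurable M" using e_dist by (auto simp: distributed_def)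

lemma V_rv:
  assumes h: "0 < h" shows "V h \<in> borel_measurable M"
proof -
  have "(\<lambda>\<omega>. nat \<lfloor>e \<omega> / h\<rfloor>) \<in> measurable M (count_space UNIV)"
    by (rule measurable_compose[OF e_rv measurable_floor_div])
  from measurable_compose_countable[where f="\<lambda>n \<omega>. W h (Suc n) \<omega>", OF W_rv[OF h] this]
  show ?thesis unfolding V_def[abs_def] .
qed

text \<open>\<open>e\<close> is independent of the whole path, so the random number of steps can be
  frozen under the inner expectation.\<close>

lemma V_expectation:
  fixes g :: "real \<Rightarrow> complex"
  assumes h: "0 < h" and g: "g \<in> borel_measurable borel" and bd: "\<And>x. norm (g x) \<le> C"
  shows "(LINT \<omega>|M. g (V h \<omega>)) = (LINT \<omega>|M. (\<lambda>n. LINT \<omega>'|M. g (W h (Suc n) \<omega>')) (nat \<lfloor>e \<omega> / h\<rfloor>))"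
proof -
  define PX where "PX = distr M path_space (path_of X)"
  have pX: "path_of X \<in> measurable M path_space" using eX by (simp add: indep_rvs_def)
  have sPX [measurable_cong]: "sets PX = sets path_space" by (simp add: PX_def)
  interpret D: prob_space "distr M borel e" by (rule prob_space_distr) (rule e_rv)
  interpret PX: prob_space PX unfolding PX_def by (rule prob_space_distr) (rule pX)
  interpret DP: pair_prob_space "distr M borel e" PX ..
  define F where "F t x = running_min (Suc (nat \<lfloor>t / h\<rfloor>)) (path_increments h x)" for t x
  have F: "(\<lambda>p. F (fst p) (snd p)) \<in> borel_measurable (borel \<Otimes>\<^sub>M path_space)"
  proof -
    have 1: "(\<lambda>p. running_min (Suc n) (path_increments h (snd p))) \<in>
        borel_measurable (borel \<Otimes>\<^sub>M path_space)" for n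
      by (rule measurable_compose[OF measurable_snd measurable_path_running_min[OF h]])
    have 2: "(\<lambda>p. nat \<lfloor>fst p / h\<rfloor>) \<in> measurable (borel \<Otimes>\<^sub>M path_space) (count_space UNIV)"
      by (rule measurable_compose[OF measurable_fst measurable_floor_div])
    show ?thesis unfolding F_def
      by (rule measurable_compose_countable[where
          f="\<lambda>n p. running_min (Suc n) (path_increments h (snd p))", OF 1 2])
  qed
  have law: "distr M (borel \<Otimes>\<^sub>M path_space) (\<lambda>\<omega>. (e \<omega>, path_of X \<omega>)) = distr M borel e \<Otimes>\<^sub>M PX"
    unfolding PX_def by (rule indep_rvs_distr[OF prob_space_axioms eX])
  have gF: "(\<lambda>p. g (F (fst p) (snd p))) \<in> borel_measurable (borel \<Otimes>\<^sub>M path_space)"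
    by (rule measurable_compose[OF F g])
  have "(LINT \<omega>|M. g (V h \<omega>)) = (LINT \<omega>|M. (\<lambda>p. g (F (fst p) (snd p))) (e \<omega>, path_of X \<omega>))"
    unfolding V_def W_path[OF h] F_def by simp
  also have "\<dots> = (LINT p|(distr M borel e \<Otimes>\<^sub>M PX). g (F (fst p) (snd p)))"
    unfolding law[symmetric]
    by (rule integral_distr[symmetric]) (use e_rv pX gF in \<open>auto intro: measurable_Pair\<close>)
  also have "\<dots> = (LINT t|distr M borel e. LINT x|PX. g (F t x))"
  proof -
    have "integrable (distr M borel e \<Otimes>\<^sub>M PX) (\<lambda>p. g (F (fst p) (snd p)))"
    proof (rule DP.integrable_const_bound[where B=C])
      have "sets (distr M borel e \<Otimes>\<^sub>M PX) = sets (borel \<Otimes>\<^sub>M path_space)"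
        by (intro sets_pair_measure_cong) (auto simp: PX_def)
      then show "(\<lambda>p. g (F (fst p) (snd p))) \<in> borel_measurable (distr M borel e \<Otimes>\<^sub>M PX)"
        using gF by (rule measurable_cong_sets[OF _ refl, THEN equalityD2, THEN subsetD])
    qed (use bd in auto)
    from DP.integral_fst'[OF this] show ?thesis by simp
  qed
  also have "\<dots> = (LINT t|distr M borel e. (\<lambda>n. LINT \<omega>'|M. g (W h (Suc n) \<omega>')) (nat \<lfloor>t / h\<rfloor>))"
  proof (intro Bochner_Integration.integral_cong refl)
    fix t
    show "(LINT x|PX. g (F t x)) = (\<lambda>n. LINT \<omega>'|M. g (W h (Suc n) \<omega>')) (nat \<lfloor>t / h\<rfloor>)"
      unfolding PX_def F_def
      by (subst integral_distr[OF pX measurable_compose[OF measurable_path_running_min[OF h] g]])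
         (simp only: W_path[OF h])
  qed
  also have "\<dots> = (LINT \<omega>|M. (\<lambda>n. LINT \<omega>'|M. g (W h (Suc n) \<omega>')) (nat \<lfloor>e \<omega> / h\<rfloor>))"
    by (rule integral_distr[OF e_rv], rule measurable_compose[OF measurable_floor_div]) simp
  finally show ?thesis .
qed

text \<open>Geometric killing makes the law of the discrete minimum a fixed point of one Lindley step.\<close>

theorem V_fixed_point:
  fixes g :: "real \<Rightarrow> complex"
  assumes h: "0 < h" and g: "g \<in> borel_measurable borel" and bd: "\<And>x. norm (g x) \<le> C"
  shows "(LINT \<omega>|M. g (V h \<omega>)) =
    complex_of_real (1 - exp (- (q * h))) * (LINT \<omega>|M. g (W h 1 \<omega>)) + complex_of_real (exp (- (q * h))) *
        (LINT \<omega>|M. step h g (V h \<omega>))"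
proof -
  define a where "a n = (LINT \<omega>|M. g (W h (Suc n) \<omega>))" for n
  have a_bd: "norm (a n) \<le> C" for n
  proof -
    have "integrable M (\<lambda>\<omega>. g (W h (Suc n) \<omega>))"
      by (rule integrable_const_bound[where B=C]) (use bd measurable_compose[OF W_rv[OF h] g] in auto)
    then have "norm (a n) \<le> (LINT \<omega>|M. C)" unfolding a_def
      by (intro order_trans[OF integral_norm_bound] integral_mono) (use bd in auto)
    then show ?thesis using prob_space by simp
  qed
  have a_Suc: "a (Suc n) = (LINT \<omega>|M. step h g (W h (Suc n) \<omega>))" for n
    unfolding a_def by (rule step_props(3)[OF h g bd])
  have "(LINT \<omega>|M. g (V h \<omega>)) = (LINT \<omega>|M. a (nat \<lfloor>e \<omega> / h\<rfloor>))"
    unfolding V_expectation[OF h g bd] a_def ..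
  also have "\<dots> = complex_of_real (1 - exp (- (q * h))) * a 0 + complex_of_real (exp (- (q * h))) *
      (LINT \<omega>|M. a (Suc (nat \<lfloor>e \<omega> / h\<rfloor>)))"
    by (rule exponential_memoryless[OF prob_space_axioms e_dist q_pos h a_bd])
  also have "(LINT \<omega>|M. a (Suc (nat \<lfloor>e \<omega> / h\<rfloor>))) = (LINT \<omega>|M. step h g (V h \<omega>))"
    unfolding a_Suc V_expectation[OF h step_props(1,2)[OF h g bd]] ..
  finally show ?thesis by (simp add: a_def)
qed

end

section \<open>The minimum at an exponential time\<close>

lemma exp_minus_1_quotient_tendsto:
  fixes w :: complex and h :: "nat \<Rightarrow> real"
  assumes "\<And>n. 0 < h n" "h \<longlonglongrightarrow> 0"
  shows "(\<lambda>n. (exp (w * of_real (h n)) - 1) / of_real (h n)) \<longlonglongrightarrow> w"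
proof -
  have "((\<lambda>z. exp (w * z)) has_field_derivative w) (at 0)" by (auto intro!: derivative_eq_intros)
  then have *: "(\<lambda>z. (exp (w * z) - 1) / z) \<midarrow>0\<rightarrow> w" by (simp add: DERIV_def)
  have "(\<lambda>n. complex_of_real (h n)) \<longlonglongrightarrow> 0" using tendsto_of_real[OF assms(2), where 'a=complex] by simp
  then have "filterlim (\<lambda>n. complex_of_real (h n)) (at 0) sequentially"
    using assms(1) by (auto simp: filterlim_at less_imp_neq[symmetric])
  from filterlim_compose[OF * this] show ?thesis .
qed

text \<open>A product rule at 1. Drift, jumps and subordinator enter the transform of a step as
  three factors, and this makes their rates add.\<close>

lemma quotient_mult_tendsto:
  fixes A B :: "nat \<Rightarrow> complex"
  assumes A: "(\<lambda>n. (A n - 1) / of_real (h n)) \<longlonglongrightarrow> a" and B: "(\<lambda>n. (B n - 1) / of_real (h n)) \<longlonglongrightarrow> b"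
    and h: "\<And>n. 0 < h n" "h \<longlonglongrightarrow> 0"
  shows "(\<lambda>n. (A n * B n - 1) / of_real (h n)) \<longlonglongrightarrow> a + b"
proof -
  have h0: "(\<lambda>n. complex_of_real (h n)) \<longlonglongrightarrow> 0" using tendsto_of_real[OF h(2), where 'a=complex] by simp
  have "(\<lambda>n. of_real (h n) * ((B n - 1) / of_real (h n)) + 1) \<longlonglongrightarrow> 0 * b + 1" by (intro tendsto_intros h0 B)
  then have "B \<longlonglongrightarrow> 1" using h(1) by (simp add: less_imp_neq[symmetric])
  then have "(\<lambda>n. ((A n - 1) / of_real (h n)) * B n + (B n - 1) / of_real (h n)) \<longlonglongrightarrow> a * 1 + b"
    by (intro tendsto_intros A B)
  moreover have "((A n - 1) / of_real (h n)) * B n + (B n - 1) / of_real (h n) =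
      (A n * B n - 1) / of_real (h n)" for n
    by (simp add: left_diff_distrib flip: add_divide_distrib)
  ultimately show ?thesis by simp
qed

text \<open>The error is governed by the probability \<open>1 - exp (- x) (1 + x)\<close> of two or
  more points, which \<open>exp (- x) \<ge> 1 - x\<close> bounds by
  \<open>x\<^sup>2\<close>.\<close>

lemma poisson_expansion:
  fixes b :: "nat \<Rightarrow> complex"
  assumes x: "0 < x" and bd: "\<And>n. norm (b n) \<le> C"
  shows "norm ((LINT n|measure_pmf (poisson_pmf x). b n) - of_real (exp (- x)) * (b 0 + of_real x * b 1))
      \<le> C * x\<^sup>2"
proof -
  let ?P = "measure_pmf (poisson_pmf x)"
  have C: "0 \<le> C" using bd[of 0] norm_ge_zero order_trans by blast
  have int: "integrable ?P (\<lambda>n. indicator A n *\<^sub>R b n)" for A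
    by (rule measure_pmf.integrable_const_bound[where B=C]) (use bd C in \<open>auto simp: indicator_def\<close>)
  have single: "(LINT n|?P. indicator {i} n *\<^sub>R b n) = of_real (pmf (poisson_pmf x) i) * b i" for i
  proof -
    have "(LINT n|?P. indicator {i} n *\<^sub>R b n) = (LINT n|?P. indicat_real {i} n *\<^sub>R b i)"
      by (intro Bochner_Integration.integral_cong refl) (auto simp: indicator_def)
    then show ?thesis by (simp add: measure_pmf_single scaleR_conv_of_real)
  qed
  have "(LINT n|?P. b n) = (LINT n|?P. (indicator {0} n *\<^sub>R b n + indicator {1} n *\<^sub>R b n) +
      indicator {2..} n *\<^sub>R b n)"
    by (intro Bochner_Integration.integral_cong refl) (auto simp: indicator_def)
  also have "\<dots> = of_real (exp (- x)) * (b 0 + of_real x * b 1) + (LINT n|?P. indicator {2..} n *\<^sub>R b n)"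
    using x by (simp add: int single ring_distribs)
  finally have "norm ((LINT n|?P. b n) - of_real (exp (- x)) * (b 0 + of_real x * b 1)) =
      norm (LINT n|?P. indicator {2..} n *\<^sub>R b n)" by simp
  also have "\<dots> \<le> (LINT n|?P. norm (indicator {2..} n *\<^sub>R b n))" by (rule integral_norm_bound)
  also have "\<dots> \<le> (LINT n|?P. indicator {2..} n * C)"
  proof (rule integral_mono[OF integrable_norm[OF int]])
    show "integrable ?P (\<lambda>n. indicator {2..} n * C)"
      by (rule measure_pmf.integrable_const_bound[where B=C]) (use C in \<open>auto simp: indicator_def\<close>)
  qed (use bd C in \<open>auto simp: indicator_def\<close>)
  also have "\<dots> = measure ?P {2..} * C" by simp
  also have "measure ?P {2..} = 1 - exp (- x) * (1 + x)"
  proof -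
    have "measure ?P {2..} = 1 - measure ?P {0, 1}"
      by (subst measure_pmf.prob_compl[symmetric]) (auto intro!: arg_cong[where f="measure ?P"])
    also have "measure ?P {0, 1} = exp (- x) * (1 + x)"
      using x by (subst measure_measure_pmf_finite) (auto simp: ring_distribs)
    finally show ?thesis .
  qed
  also have "1 - exp (- x) * (1 + x) \<le> 1 - (1 - x) * (1 + x)"
    using exp_ge_add_one_self[of "- x"] x by (intro diff_left_mono mult_right_mono) auto
  also have "\<dots> = x\<^sup>2" by (simp add: power2_eq_square algebra_simps)
  finally show ?thesis using C by (simp add: mult_right_mono mult.commute)
qed

section \<open>Limits along the mesh: paths, infimum and transforms\<close>

context jump_model
begin

lemma levy: "subordinator_levy_measure \<nu>" using sub by (simp add: driftless_subordinator_def)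

sublocale levy_measure \<nu> by unfold_locales (rule levy)

text \<open>These meshes divide 1, the only time at which the exponent of \<open>S\<close> is
  prescribed; the law at time \<open>hs n\<close> is then reached by taking a root.\<close>

definition "hs n = 1 / real (Suc n)"

lemma hs: "0 < hs n" "hs \<longlonglongrightarrow> 0"
  unfolding hs_def using LIMSEQ_inverse_real_of_nat by (simp_all add: inverse_eq_divide del: of_nat_Suc)

lemma muJ_sets [measurable_cong, simp]: "sets \<mu>J = sets borel" and muJ_space [simp]: "space \<mu>J = UNIV"
  by (simp_all add: \<mu>J_def)

lemma muJ_prob: "prob_space \<mu>J"
  using f_int f_meas by (intro prob_spaceI) (simp add: \<mu>J_def emeasure_density)

text \<open>The paths of \<open>S\<close> are cadlag by assumption. Those of \<open>Z\<close> are
  locally constant to the right since the integer valued \<open>K\<close> is right-continuous. For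
  the lower bound, \<open>K\<close> is bounded on \<open>{0..T}\<close>, so only finitely many jumps
  can contribute there.\<close>

lemma path_right_continuous:
  assumes \<omega>: "\<omega> \<in> space M" and t: "0 \<le> t"
  shows "continuous (at_right t) (\<lambda>s. X s \<omega>)"
    and "bdd_below ((\<lambda>s. X s \<omega>) ` {0..T})"
proof -
  obtain K J where K: "poisson_process M \<mu> K"
    and Z_eq: "\<And>t \<omega>. 0 \<le> t \<Longrightarrow> \<omega> \<in> space M \<Longrightarrow> Z t \<omega> = (\<Sum>i<K t \<omega>. J i \<omega>)"
    using cpp unfolding compound_poisson_process_def by blast
  have Kc: "cadlag (\<lambda>t. real (K t \<omega>))" using K \<omega> by (auto simp: poisson_process_def levy_process_def)
  have Sc: "cadlag (\<lambda>t. S t \<omega>)" using S_levy \<omega> by (auto simp: levy_process_def)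
  have "((\<lambda>s. real (K s \<omega>)) \<longlongrightarrow> real (K t \<omega>)) (at_right t)" using Kc t
      by (auto simp: cadlag_def continuous_within)
  then have "\<forall>\<^sub>F s in at_right t. dist (real (K s \<omega>)) (real (K t \<omega>)) < 1" by (rule tendstoD) simp
  then have Z_const: "\<forall>\<^sub>F s in at_right t. Z s \<omega> = Z t \<omega>"
    using eventually_at_right_less[of t]
  proof eventually_elim
    case (elim s)
    then have "K s \<omega> = K t \<omega>" by (simp add: dist_real_def)
    then show ?case using elim t by (simp add: Z_eq[OF _ \<omega>])
  qed
  have S_lim: "((\<lambda>s. S s \<omega>) \<longlongrightarrow> S t \<omega>) (at_right t)" using Sc t by (auto simp: cadlag_def continuous_within)
  have "((\<lambda>s. c * s + Z t \<omega> - S s \<omega>) \<longlongrightarrow> c * t + Z t \<omega> - S t \<omega>) (at_right t)"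
    by (intro tendsto_intros S_lim)
  moreover have "\<forall>\<^sub>F s in at_right t. c * s + Z t \<omega> - S s \<omega> = X s \<omega>"
    using Z_const eventually_at_right_less[of t] by eventually_elim (use t in \<open>simp add: X_eq[OF _ \<omega>]\<close>)
  ultimately show "continuous (at_right t) (\<lambda>s. X s \<omega>)"
    unfolding continuous_within X_eq[OF t \<omega>] by (rule Lim_transform_eventually)
  obtain BK where BK: "\<And>s. s \<in> {0..T} \<Longrightarrow> real (K s \<omega>) \<le> BK"
    using cadlag_bounded[OF Kc, of T] unfolding bounded_iff
        by (metis (mono_tags, lifting) abs_le_D1 imageI real_norm_def)
  obtain BS where BS: "\<And>s. s \<in> {0..T} \<Longrightarrow> S s \<omega> \<le> BS"
    using cadlag_bounded[OF Sc, of T] unfolding bounded_iff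
        by (metis (mono_tags, lifting) abs_le_D1 imageI real_norm_def)
  show "bdd_below ((\<lambda>s. X s \<omega>) ` {0..T})"
  proof (rule bdd_belowI2[of _ "- (\<Sum>i<nat \<lceil>BK\<rceil>. \<bar>J i \<omega>\<bar>) - BS"])
    fix s assume s: "s \<in> {0..T}"
    have "K s \<omega> \<le> nat \<lceil>BK\<rceil>" using BK[OF s] by linarith
    then have "(\<Sum>i<K s \<omega>. \<bar>J i \<omega>\<bar>) \<le> (\<Sum>i<nat \<lceil>BK\<rceil>. \<bar>J i \<omega>\<bar>)" by (intro sum_mono2) auto
    moreover have "\<bar>\<Sum>i<K s \<omega>. J i \<omega>\<bar> \<le> (\<Sum>i<K s \<omega>. \<bar>J i \<omega>\<bar>)" by (rule sum_abs)
    moreover have "0 \<le> c * s" using c_pos s by simp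
    ultimately show "- (\<Sum>i<nat \<lceil>BK\<rceil>. \<bar>J i \<omega>\<bar>) - BS \<le> X s \<omega>"
      using BS[OF s] X_eq[OF _ \<omega>, of s] Z_eq[OF _ \<omega>, of s] s unfolding atLeastAtMost_iff by linarith
  qed
qed

definition "I \<omega> = (INF s\<in>{0..e \<omega>}. X s \<omega>)"

lemma V_tendsto: "\<omega> \<in> space M \<Longrightarrow> 0 \<le> e \<omega> \<Longrightarrow> (\<lambda>n. V (hs n) \<omega>) \<longlonglongrightarrow> I \<omega> - X 0 \<omega>"
  using running_min_increments_tendsto[where Y="\<lambda>t. X t \<omega>" and T="e \<omega>" and h=hs,
      OF path_right_continuous(1) _ path_right_continuous(2)] hs
  by (simp add: V_def W_def I_def)

lemma X_rv: "0 \<le> t \<Longrightarrow> X t \<in> borel_measurable M"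
proof -
  assume t: "0 \<le> t"
  have "path_of X \<in> measurable M path_space" using eX by (simp add: indep_rvs_def)
  from measurable_compose[OF this measurable_component_singleton[of t]] t show ?thesis by simp
qed

text \<open>The infimum runs over uncountably many times, and measurability is inherited from the
  grid approximation. If \<open>e\<close> is negative the interval is empty and \<open>I\<close>
  takes the constant value \<open>Inf {}\<close>.\<close>

lemma I_rv: "I \<in> borel_measurable M"
proof (rule borel_measurable_LIMSEQ_real)
  fix \<omega> assume \<omega>: "\<omega> \<in> space M"
  show "(\<lambda>n. if 0 \<le> e \<omega> then V (hs n) \<omega> + X 0 \<omega> else Inf {}) \<longlonglongrightarrow> I \<omega>"
  proof (cases "0 \<le> e \<omega>")
    case True
    have "(\<lambda>n. V (hs n) \<omega> + X 0 \<omega>) \<longlonglongrightarrow> (I \<omega> - X 0 \<omega>) + X 0 \<omega>"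
      by (intro tendsto_intros V_tendsto \<omega> True)
    then show ?thesis using True by simp
  next
    case False
    then show ?thesis by (simp add: I_def)
  qed
next
  fix n
  show "(\<lambda>\<omega>. if 0 \<le> e \<omega> then V (hs n) \<omega> + X 0 \<omega> else Inf {}) \<in> borel_measurable M"
    using V_rv[OF hs(1), of n] X_rv[of 0] e_rv by measurable
qed

lemma AE_e_nonneg: "AE \<omega> in M. 0 \<le> e \<omega>"
proof -
  have e_meas: "e \<in> measurable M lborel" using e_rv by simp
  have "AE t in distr M lborel e. 0 \<le> t"
    unfolding distributed_distr_eq_density[OF e_dist]
    by (subst AE_density) (auto simp: exponential_density_def erlang_density_def)
  then show ?thesis by (subst (asm) AE_distr_iff[OF e_meas]) auto
qed

lemma AE_S_0: "AE \<omega> in M. S 0 \<omega> = 0"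
  using S_levy by (simp add: levy_process_def)

lemma AE_S_nonneg: "AE \<omega> in M. \<forall>t\<ge>0. 0 \<le> S t \<omega>"
  using AE_S_0 AE_space
proof eventually_elim
  case (elim \<omega>)
  have "mono_on {0..} (\<lambda>t. S t \<omega>)" using sub elim(2) by (auto simp: driftless_subordinator_def)
  then show ?case using elim(1) by (auto dest: mono_onD[of _ _ 0])
qed

lemma AE_X_0: "AE \<omega> in M. X 0 \<omega> = 0"
proof -
  obtain K J where K: "poisson_process M \<mu> K"
    and Z_eq: "\<And>t \<omega>. 0 \<le> t \<Longrightarrow> \<omega> \<in> space M \<Longrightarrow> Z t \<omega> = (\<Sum>i<K t \<omega>. J i \<omega>)"
    using cpp unfolding compound_poisson_process_def by blast
  have "AE \<omega> in M. real (K 0 \<omega>) = 0" using K by (auto simp: poisson_process_def levy_process_def)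
  with AE_S_0 AE_space show ?thesis
    by eventually_elim (simp add: X_eq Z_eq)
qed

lemma AE_V_tendsto: "AE \<omega> in M. (\<lambda>n. V (hs n) \<omega>) \<longlonglongrightarrow> I \<omega>"
  using AE_e_nonneg AE_X_0 AE_space
proof eventually_elim
  case (elim \<omega>)
  then show ?case using V_tendsto[of \<omega>] by simp
qed

lemma V_nonpos: "V h \<omega> \<le> 0"
  unfolding V_def W_def by (rule running_min_nonpos)

lemma AE_I_nonpos: "AE \<omega> in M. I \<omega> \<le> 0"
  using AE_V_tendsto
proof eventually_elim
  case (elim \<omega>)
  then show ?case by (rule LIMSEQ_le_const2) (auto intro: V_nonpos)
qed

lemma S_tendsto: "\<omega> \<in> space M \<Longrightarrow> (\<lambda>n. S (hs n) \<omega>) \<longlonglongrightarrow> S 0 \<omega>"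
  and X_tendsto: "\<omega> \<in> space M \<Longrightarrow> (\<lambda>n. X (hs n) \<omega>) \<longlonglongrightarrow> X 0 \<omega>"
proof -
  assume \<omega>: "\<omega> \<in> space M"
  have f: "filterlim hs (at_right 0) sequentially"
    unfolding filterlim_at using hs by (auto simp: less_imp_neq[OF hs(1), symmetric])
  have "((\<lambda>t. S t \<omega>) \<longlongrightarrow> S 0 \<omega>) (at_right 0)"
    using S_levy \<omega> by (auto simp: levy_process_def cadlag_def continuous_within)
  from filterlim_compose[OF this f] show "(\<lambda>n. S (hs n) \<omega>) \<longlonglongrightarrow> S 0 \<omega>" .
  have "((\<lambda>t. X t \<omega>) \<longlongrightarrow> X 0 \<omega>) (at_right 0)"
    using path_right_continuous(1)[OF \<omega>, of 0] by (simp add: continuous_within)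
  from filterlim_compose[OF this f] show "(\<lambda>n. X (hs n) \<omega>) \<longlonglongrightarrow> X 0 \<omega>" .
qed

lemma W1_tendsto: "\<omega> \<in> space M \<Longrightarrow> (\<lambda>n. W (hs n) 1 \<omega>) \<longlonglongrightarrow> 0"
proof -
  assume \<omega>: "\<omega> \<in> space M"
  have "(\<lambda>n. min 0 (X (hs n) \<omega> - X 0 \<omega>)) \<longlonglongrightarrow> min 0 (X 0 \<omega> - X 0 \<omega>)"
    by (intro tendsto_intros X_tendsto[OF \<omega>])
  then show ?thesis by (simp add: W_def numeral_nat)
qed

text \<open>\<open>S 1\<close> is almost surely a sum of \<open>Suc n\<close> independent increments
  with the law of \<open>S (hs n)\<close>, so the transform sought is the positive root of order
  \<open>Suc n\<close> of the prescribed one.\<close>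

lemma S_transform_real:
  assumes r: "0 \<le> r"
  shows "(LINT \<omega>|M. exp (- (r * S (hs n) \<omega>))) = exp (- (subordinator_exponent \<nu> r * hs n))"
proof -
  have int: "integrable M (\<lambda>\<omega>. exp (- (r * S t \<omega>)))" if "0 \<le> t" for t
  proof (rule integrable_const_bound[where B=1])
    show "AE \<omega> in M. norm (exp (- (r * S t \<omega>))) \<le> 1"
      using AE_S_nonneg by eventually_elim (use r that in auto)
  qed (use S_rv[OF that] in measurable)
  have pos: "0 < (LINT \<omega>|M. exp (- (r * S t \<omega>)))" if "0 \<le> t" for t
    by (rule expectation_greater[OF int[OF that]]) simp
  define E where "E = (LINT \<omega>|M. exp (- (r * S (hs n) \<omega>)))"
  have sum: "(\<Sum>i<Suc n. increments (hs n) S \<omega> i) = S 1 \<omega> - S 0 \<omega>" for \<omega>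
    using sum_lessThan_telescope[of "\<lambda>i. S (real i * hs n) \<omega>" "Suc n"]
        by (simp add: hs_def del: sum.lessThan_Suc)
  have ind: "indep_vars (\<lambda>_. borel) (\<lambda>i \<omega>. exp (- (r * increments (hs n) S \<omega> i))) {..<Suc n}"
    by (rule indep_vars_subset[OF
        indep_vars_compose2[OF levy_increments_indep[OF S_levy hs(1)], where Y="\<lambda>_ x. exp (- (r * x))"]])
            auto
  have inc_rv: "(\<lambda>\<omega>. increments (hs n) S \<omega> i) \<in> borel_measurable M" for i
    by (intro borel_measurable_diff S_rv) (use hs(1)[of n] in auto)
  have each: "(LINT \<omega>|M. exp (- (r * increments (hs n) S \<omega> i))) = E" for i
  proof -
    have "(LINT \<omega>|M. exp (- (r * increments (hs n) S \<omega> i))) =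
        (LINT x|distr M borel (\<lambda>\<omega>. increments (hs n) S \<omega> i). exp (- (r * x)))"
      by (rule integral_distr[symmetric, OF inc_rv]) simp
    also have "\<dots> = E"
      unfolding levy_increments_distr[OF S_levy hs(1)] E_def
      by (rule integral_distr[OF S_rv]) (use hs(1)[of n] in auto)
    finally show ?thesis .
  qed
  have int_inc: "integrable M (\<lambda>\<omega>. exp (- (r * increments (hs n) S \<omega> i)))" for i
  proof -
    have "integrable (distr M borel (S (hs n))) (\<lambda>x. exp (- (r * x)))"
      using int[of "hs n"] hs(1)[of n] by (subst integrable_distr_eq) (auto intro: S_rv)
    then have "integrable (distr M borel (\<lambda>\<omega>. increments (hs n) S \<omega> i)) (\<lambda>x. exp (- (r * x)))"
      unfolding levy_increments_distr[OF S_levy hs(1)] .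
    then show ?thesis by (subst (asm) integrable_distr_eq[OF inc_rv]) auto
  qed
  have "(LINT \<omega>|M. exp (- (r * S 1 \<omega>))) = (LINT \<omega>|M. (\<Prod>i<Suc n. exp (- (r * increments (hs n) S \<omega> i))))"
  proof (rule integral_cong_AE)
    show "AE \<omega> in M. exp (- (r * S 1 \<omega>)) = (\<Prod>i<Suc n. exp (- (r * increments (hs n) S \<omega> i)))"
      using AE_S_0
    proof eventually_elim
      case (elim \<omega>)
      have "(\<Prod>i<Suc n. exp (- (r * increments (hs n) S \<omega> i))) =
          exp (\<Sum>i<Suc n. - (r * increments (hs n) S \<omega> i))"
        by (rule exp_sum[symmetric]) simp
      also have "(\<Sum>i<Suc n. - (r * increments (hs n) S \<omega> i)) = - (r * (\<Sum>i<Suc n. increments (hs n) S \<omega> i))"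
        by (simp only: sum_negf sum_distrib_left)
      finally show ?case unfolding sum using elim by simp
    qed
    show "(\<lambda>\<omega>. exp (- (r * S 1 \<omega>))) \<in> borel_measurable M" using S_rv[of 1] by measurable
    show "(\<lambda>\<omega>. \<Prod>i<Suc n. exp (- (r * increments (hs n) S \<omega> i))) \<in> borel_measurable M"
      by (intro borel_measurable_prod borel_measurable_integrable int_inc)
  qed
  also have "\<dots> = (\<Prod>i<Suc n. E)"
    by (subst indep_vars_lebesgue_integral[OF _ ind int_inc]) (simp_all only: each finite_lessThan)
  finally have "(LINT \<omega>|M. exp (- (r * S 1 \<omega>))) = E ^ Suc n" by (simp only: prod_constant card_lessThan)
  moreover have "(LINT \<omega>|M. exp (- (r * S 1 \<omega>))) = exp (- subordinator_exponent \<nu> r)"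
  proof -
    have "- ln (LINT \<omega>|M. exp (- (r * S 1 \<omega>))) = subordinator_exponent \<nu> r"
      using sub r by (simp add: driftless_subordinator_def)
    then have "ln (LINT \<omega>|M. exp (- (r * S 1 \<omega>))) = - subordinator_exponent \<nu> r" by simp
    then show ?thesis using exp_ln[OF pos[of 1]] by simp
  qed
  moreover have "exp (- subordinator_exponent \<nu> r) = exp (- (subordinator_exponent \<nu> r * hs n)) ^ Suc n"
    by (simp add: exp_of_nat_mult[symmetric] hs_def del: of_nat_Suc power_Suc)
  ultimately have "E ^ Suc n = exp (- (subordinator_exponent \<nu> r * hs n)) ^ Suc n" by simp
  then show ?thesis
    unfolding E_def[symmetric] using pos[of "hs n"] hs(1)[of n]
    by (intro power_eq_imp_eq_base[of E "Suc n"]) (auto simp: E_def less_imp_le)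
qed

lemma exponent_of_real: "0 \<le> r \<Longrightarrow> subordinator_exponent \<nu> (complex_of_real r) =
    of_real (subordinator_exponent \<nu> r)"
  unfolding subordinator_exponent_def
  by (subst integral_complex_of_real[symmetric]) (simp add: exp_of_real[symmetric])

lemma S_transform:
  assumes z: "0 \<le> Re z"
  shows "(LINT \<omega>|M. exp (- (z * of_real (S (hs n) \<omega>)))) =
      exp (- (subordinator_exponent \<nu> z * of_real (hs n)))"
proof (rule half_plane_eqI[OF _ _ _ _ _ z])
  have Sm: "S (hs n) \<in> borel_measurable M" by (rule S_rv) (use hs(1)[of n] in simp)
  have bd: "AE \<omega> in M. \<forall>z\<in>U. norm (exp (- (z * of_real (S (hs n) \<omega>)))) \<le> 1" if "U \<subseteq> {z. 0 \<le> Re z}" for U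
    using AE_S_nonneg by eventually_elim (use that hs(1)[of n] in \<open>auto intro!: mult_nonneg_nonneg\<close>)
  show "(\<lambda>z. LINT \<omega>|M. exp (- (z * of_real (S (hs n) \<omega>)))) holomorphic_on {z. 0 < Re z}"
  proof (rule holomorphic_on_parametric_integral[where g="\<lambda>_. 1"])
    show "AE \<omega> in M. \<forall>z\<in>{z. 0 < Re z}. norm (exp (- (z * of_real (S (hs n) \<omega>)))) \<le> 1" by (rule bd) auto
  qed (use Sm in \<open>auto intro!: holomorphic_intros Re_half_planes\<close>)
  show "continuous_on {z. 0 \<le> Re z} (\<lambda>z. LINT \<omega>|M. exp (- (z * of_real (S (hs n) \<omega>))))"
  proof (rule continuous_on_parametric_integral[where g="\<lambda>_. 1"])
    show "AE \<omega> in M. \<forall>z\<in>{z. 0 \<le> Re z}. norm (exp (- (z * of_real (S (hs n) \<omega>)))) \<le> 1" by (rule bd) auto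
  qed (use Sm in \<open>auto intro!: continuous_intros\<close>)
  show "(\<lambda>z. exp (- (subordinator_exponent \<nu> z * of_real (hs n)))) holomorphic_on {z. 0 < Re z}"
    by (intro holomorphic_intros exponent_holomorphic)
  show "continuous_on {z. 0 \<le> Re z} (\<lambda>z. exp (- (subordinator_exponent \<nu> z * of_real (hs n))))"
    by (intro continuous_intros exponent_continuous)
  fix r :: real assume r: "0 < r"
  have "(LINT \<omega>|M. exp (- (complex_of_real r * of_real (S (hs n) \<omega>)))) =
      of_real (LINT \<omega>|M. exp (- (r * S (hs n) \<omega>)))"
    by (subst integral_complex_of_real[symmetric]) (simp add: exp_of_real[symmetric])
  then show "(LINT \<omega>|M. exp (- (complex_of_real r * of_real (S (hs n) \<omega>)))) =
      exp (- (subordinator_exponent \<nu> (complex_of_real r) * of_real (hs n)))"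
    using r by (simp add: S_transform_real exponent_of_real exp_of_real[symmetric])
qed

text \<open>To second order in the mesh, a step of \<open>Z\<close> has no jump or a single jump
  with law \<open>\<mu>J\<close>.\<close>

lemma rhoZ_expansion:
  fixes F :: "real \<Rightarrow> complex"
  assumes h: "0 < h" and F [measurable]: "F \<in> borel_measurable borel" and bd: "\<And>x. norm (F x) \<le> C"
  shows "norm ((LINT x|\<rho>Z h. F x) - of_real (exp (- (\<mu> * h))) *
      (F 0 + of_real (\<mu> * h) * (LINT x|\<mu>J. F x))) \<le> C * (\<mu> * h)\<^sup>2"
proof -
  interpret C: compound_law "measure_pmf (poisson_pmf (\<mu> * h))" \<mu>J by (rule compound_law[OF h])
  define b where "b k = (LINT j|C.PJ. F (\<Sum>l<k. j l))" for k
  have sm: "(\<lambda>j. \<Sum>l<k. j l) \<in> borel_measurable C.PJ" for k :: nat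
    by (intro borel_measurable_sum C.measurable_component_real)
  have Fs: "integrable C.PJ (\<lambda>j. F (\<Sum>l<k. j l))" for k :: nat
    by (rule C.JS.P.integrable_const_bound[where B=C]) (use bd measurable_compose[OF sm F] in auto)
  have b_bd: "norm (b k) \<le> C" for k
  proof -
    have "norm (b k) \<le> (LINT j|C.PJ. C)" unfolding b_def
      by (rule order_trans[OF integral_norm_bound], rule integral_mono) (use bd Fs in auto)
    then show ?thesis using C.JS.P.prob_space by simp
  qed
  have "(LINT x|\<rho>Z h. F x) =
      (LINT p|(measure_pmf (poisson_pmf (\<mu> * h)) \<Otimes>\<^sub>M C.PJ). F ((\<lambda>(k, j). \<Sum>l<k. j l) p))"
    unfolding \<rho>Z_def C.\<rho>_def by (rule integral_distr[OF C.measurable_initial_sum]) simp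
  also have "\<dots> = (LINT k|measure_pmf (poisson_pmf (\<mu> * h)). b k)"
  proof -
    have "integrable (measure_pmf (poisson_pmf (\<mu> * h)) \<Otimes>\<^sub>M C.PJ) (\<lambda>p. F ((\<lambda>(k, j). \<Sum>l<k. j l) p))"
      by (rule C.kJ.integrable_const_bound[where B=C])
          (use bd measurable_compose[OF C.measurable_initial_sum F] in auto)
    from C.kJ.integral_fst'[OF this] show ?thesis by (simp add: b_def)
  qed
  finally have "(LINT x|\<rho>Z h. F x) = (LINT k|measure_pmf (poisson_pmf (\<mu> * h)). b k)" .
  moreover have "b 0 = F 0" using C.JS.P.prob_space by (simp add: b_def)
  moreover have "b 1 = (LINT x|\<mu>J. F x)"
  proof -
    have "(LINT x|\<mu>J. F x) = (LINT x|distr C.PJ \<mu>J (\<lambda>j. j 0). F x)"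
      using C.JS.PiM_component[of 0] by simp
    also have "\<dots> = (LINT j|C.PJ. F (j 0))"
      by (rule integral_distr) (simp_all add: measurable_cong_sets[OF muJ_sets refl] F
          measurable_component_singleton)
    finally show ?thesis by (simp add: b_def)
  qed
  ultimately show ?thesis using poisson_expansion[where b=b and C=C and x="\<mu> * h"] b_bd h mu_pos by simp
qed

end

lemma iexp_remainder: "norm (1 - iexp x + \<i> * complex_of_real x) \<le> x\<^sup>2"
proof -
  have "norm (iexp x - (1 + \<i> * complex_of_real x)) \<le> \<bar>x\<bar> ^ 2 / 2"
    using iexp_approx1[of x 1] by (simp add: numeral_2_eq_2)
  also have "\<dots> \<le> x\<^sup>2" by simp
  finally have "norm (iexp x - (1 + \<i> * complex_of_real x)) \<le> x\<^sup>2" .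
  moreover have "1 - iexp x + \<i> * complex_of_real x = - (iexp x - (1 + \<i> * complex_of_real x))" by simp
  ultimately show ?thesis by (simp only: norm_minus_cancel)
qed

text \<open>One of \<open>min 0 y\<close> and \<open>max 0 y\<close> is always 0. This additive
  splitting into a free step and an overshoot is what separates the two half-planes later.\<close>

lemma iexp_min: "iexp (t * min 0 y) = iexp (t * y) + (1 - iexp (t * max 0 y))"
  by (auto simp: min_def max_def)

lemma norm_1_minus_iexp:
  "norm (1 - iexp x) \<le> 2" "norm (1 - exp (\<i> * (complex_of_real t * complex_of_real x))) \<le> 2"
  using norm_triangle_ineq4[of 1 "iexp x"] norm_triangle_ineq4[of 1 "iexp (t * x)"] by simp_all

section \<open>A single step to first order in the mesh\<close>

context jump_model
begin

definition "phi t h = (LINT x|\<rho>X h. iexp (t * x))"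
text \<open>What reflection at 0 takes away: the correction that turns the free step into the
  reflected one in \<open>step_iexp\<close>. \<open>excess\<close> is the same quantity for a given
  jump sum \<open>z\<close> of the step.\<close>

definition "overshoot t h w = (LINT x|\<rho>X h. 1 - iexp (t * max 0 (x + w)))"
definition "excess t h w z = (LINT \<omega>|M. 1 - iexp (t * max 0 (c * h + z - S h \<omega> + w)))"

lemma S_rv' [measurable]: "0 < h \<Longrightarrow> S h \<in> borel_measurable M" by (rule S_rv) simp

lemma excess_measurable:
  assumes h: "0 < h" shows "(\<lambda>p. excess t h (fst p) (snd p)) \<in> borel_measurable (borel \<Otimes>\<^sub>M borel)"
proof -
  note [measurable] = S_rv'[OF h]
  show ?thesis unfolding excess_def by measurable
qed

lemma excess_bound:
  assumes h: "0 < h" shows "norm (excess t h w z) \<le> 2"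
proof -
  note [measurable] = S_rv'[OF h]
  have "norm (excess t h w z) \<le> (LINT \<omega>|M. 2)" unfolding excess_def
    by (rule order_trans[OF integral_norm_bound], rule integral_mono)
       (auto intro!: integrable_const_bound[where B=2] AE_I2 norm_1_minus_iexp)
  then show ?thesis using prob_space by simp
qed

lemma rhoX_integral:
  fixes G :: "real \<Rightarrow> complex"
  assumes h: "0 < h" and G [measurable]: "G \<in> borel_measurable borel" and bd: "\<And>x. norm (G x) \<le> C"
  shows "(LINT x|\<rho>X h. G x) = (LINT z|\<rho>Z h. LINT \<omega>|M. G (c * h + z - S h \<omega>))"
proof -
  interpret A: prob_space "\<rho>Z h" by (rule rho_prob[OF h])
  interpret B: prob_space "\<rho>S h" by (rule rho_prob[OF h])
  interpret AB: pair_prob_space "\<rho>Z h" "\<rho>S h" ..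
  note [measurable_cong] = rho_sets(1)[OF h] rho_sets(2)
  have "(LINT x|\<rho>X h. G x) = (LINT p|(\<rho>Z h \<Otimes>\<^sub>M \<rho>S h). G ((\<lambda>(z, s). c * h + z - s) p))"
    unfolding \<rho>X_def by (rule integral_distr) measurable
  also have "\<dots> = (LINT z|\<rho>Z h. LINT s|\<rho>S h. G (c * h + z - s))"
  proof -
    have "integrable (\<rho>Z h \<Otimes>\<^sub>M \<rho>S h) (\<lambda>p. G ((\<lambda>(z, s). c * h + z - s) p))"
      by (rule AB.integrable_const_bound[where B=C]) (use bd in auto)
    from AB.integral_fst'[OF this] show ?thesis by simp
  qed
  also have "\<dots> = (LINT z|\<rho>Z h. LINT \<omega>|M. G (c * h + z - S h \<omega>))"
    unfolding \<rho>S_def using h by (subst integral_distr[OF S_rv']) auto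
  finally show ?thesis .
qed

lemma step_iexp:
  assumes h: "0 < h"
  shows "step h (\<lambda>x. iexp (t * x)) w = phi t h * iexp (t * w) + overshoot t h w"
proof -
  interpret R: prob_space "\<rho>X h" by (rule rhoX_prob[OF h])
  note [measurable_cong] = rho_sets(3)
  have 1: "integrable (\<rho>X h) (\<lambda>x. iexp (t * x) * iexp (t * w))"
    by (rule R.integrable_const_bound[where B=1]) (auto simp: norm_mult)
  have 2: "integrable (\<rho>X h) (\<lambda>x. 1 - iexp (t * max 0 (x + w)))"
    by (rule R.integrable_const_bound[where B=2]) (auto intro!: AE_I2 norm_1_minus_iexp)
  have "step h (\<lambda>x. iexp (t * x)) w =
      (LINT x|\<rho>X h. iexp (t * x) * iexp (t * w) + (1 - iexp (t * max 0 (x + w))))"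
    unfolding step_def
  proof (intro Bochner_Integration.integral_cong refl)
    fix x
    have "iexp (t * (x + w)) = iexp (t * x) * iexp (t * w)"
      by (simp add: ring_distribs exp_add)
    then show "iexp (t * min 0 (x + w)) = iexp (t * x) * iexp (t * w) + (1 - iexp (t * max 0 (x + w)))"
      unfolding iexp_min by simp
  qed
  also have "\<dots> = phi t h * iexp (t * w) + overshoot t h w"
    unfolding phi_def overshoot_def
        by (subst Bochner_Integration.integral_add[OF 1 2]) (simp only: integral_mult_left_zero)
  finally show ?thesis .
qed

lemma overshoot_eq: "0 < h \<Longrightarrow> overshoot t h w = (LINT z|\<rho>Z h. excess t h w z)"
  unfolding overshoot_def excess_def
  by (subst rhoX_integral[where C=2]) (auto intro!: AE_I2 norm_1_minus_iexp)

lemma overshoot_expansion: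
  assumes h: "0 < h"
  shows "norm (overshoot t h w - of_real (exp (- (\<mu> * h))) *
      (excess t h w 0 + of_real (\<mu> * h) * (LINT x|\<mu>J. excess t h w x))) \<le> 2 * (\<mu> * h)\<^sup>2"
proof -
  have "(\<lambda>z. (\<lambda>p. excess t h (fst p) (snd p)) (w, z)) \<in> borel_measurable borel"
    by (rule measurable_compose[OF measurable_Pair1' excess_measurable[OF h]]) simp
  then have "excess t h w \<in> borel_measurable borel" by simp
  from rhoZ_expansion[OF h this excess_bound[OF h]] show ?thesis unfolding overshoot_eq[OF h] .
qed

text \<open>Mean corrections for steps without a jump and with one jump. \<open>Y\<close> is the
  mean real overshoot in the jumpless case, which only the drift can cause.\<close>

definition "T0 t h = (LINT \<omega>|M. excess t h (V h \<omega>) 0)"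
definition "T1 t h = (LINT \<omega>|M. LINT x|\<mu>J. excess t h (V h \<omega>) x)"
definition "Y h = (LINT \<omega>|M. LINT \<omega>'|M. max 0 (c * h - S h \<omega>' + V h \<omega>))"

lemma muJ_excess:
  assumes h: "0 < h"
  shows "(\<lambda>w. LINT x|\<mu>J. excess t h w x) \<in> borel_measurable borel" "norm (LINT x|\<mu>J. excess t h w x) \<le> 2"
    "(\<lambda>w. excess t h w z) \<in> borel_measurable borel"
proof -
  interpret J: prob_space \<mu>J by (rule muJ_prob)
  have "(\<lambda>p. excess t h (fst p) (snd p)) \<in> borel_measurable (borel \<Otimes>\<^sub>M \<mu>J)"
    using excess_measurable[OF h] by measurable
  from J.borel_measurable_lebesgue_integral[of "\<lambda>w x. excess t h w x" borel] this
  show "(\<lambda>w. LINT x|\<mu>J. excess t h w x) \<in> borel_measurable borel" by (simp add: case_prod_beta)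
  have "(\<lambda>w. (\<lambda>p. excess t h (fst p) (snd p)) (w, z)) \<in> borel_measurable borel" for z
    by (rule measurable_compose[OF measurable_Pair2' excess_measurable[OF h]]) simp
  then show "(\<lambda>w. excess t h w z) \<in> borel_measurable borel" by simp
  have "(\<lambda>z. (\<lambda>p. excess t h (fst p) (snd p)) (w, z)) \<in> borel_measurable borel"
    by (rule measurable_compose[OF measurable_Pair1' excess_measurable[OF h]]) simp
  then have "integrable \<mu>J (\<lambda>x. excess t h w x)"
    by (intro J.integrable_const_bound[where B=2]) (auto simp: excess_bound[OF h])
  then have "norm (LINT x|\<mu>J. excess t h w x) \<le> (LINT x|\<mu>J. 2)"
    by (intro order_trans[OF integral_norm_bound] integral_mono) (auto simp: excess_bound[OF h])
  then show "norm (LINT x|\<mu>J. excess t h w x) \<le> 2" using J.prob_space by simp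
qed

lemma overshoot_props:
  assumes h: "0 < h"
  shows "overshoot t h \<in> borel_measurable borel" "norm (overshoot t h w) \<le> 2"
proof -
  interpret R: prob_space "\<rho>X h" by (rule rhoX_prob[OF h])
  note [measurable_cong] = rho_sets(3)
  show "overshoot t h \<in> borel_measurable borel" unfolding overshoot_def[abs_def] by measurable
  have "norm (overshoot t h w) \<le> (LINT x|\<rho>X h. 2)" unfolding overshoot_def
    by (rule order_trans[OF integral_norm_bound], rule integral_mono)
       (auto intro!: R.integrable_const_bound[where B=2] AE_I2 norm_1_minus_iexp)
  then show "norm (overshoot t h w) \<le> 2" using R.prob_space by simp
qed

lemma expected_overshoot:
  assumes h: "0 < h"
  shows "norm ((LINT \<omega>|M. overshoot t h (V h \<omega>)) - of_real (exp (- (\<mu> * h))) *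
      (T0 t h + of_real (\<mu> * h) * T1 t h)) \<le> 2 * (\<mu> * h)\<^sup>2"
proof -
  have i0: "integrable M (\<lambda>\<omega>. overshoot t h (V h \<omega>))"
    by (rule integrable_const_bound[where B=2])
       (use overshoot_props[OF h] measurable_compose[OF V_rv[OF h] overshoot_props(1)[OF h]] in auto)
  have i1: "integrable M (\<lambda>\<omega>. excess t h (V h \<omega>) 0)"
    by (rule integrable_const_bound[where B=2])
       (use excess_bound[OF h] measurable_compose[OF V_rv[OF h] muJ_excess(3)[OF h]] in auto)
  have i2: "integrable M (\<lambda>\<omega>. LINT x|\<mu>J. excess t h (V h \<omega>) x)"
    by (rule integrable_const_bound[where B=2])
       (use muJ_excess(2)[OF h] measurable_compose[OF V_rv[OF h] muJ_excess(1)[OF h]] in auto)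
  define r where "r \<omega> = overshoot t h (V h \<omega>) - of_real (exp (- (\<mu> * h))) *
      (excess t h (V h \<omega>) 0 + of_real (\<mu> * h) * (LINT x|\<mu>J. excess t h (V h \<omega>) x))" for \<omega>
  have ir: "integrable M r"
    unfolding r_def by (intro Bochner_Integration.integrable_diff Bochner_Integration.integrable_add
        integrable_mult_right i0 i1 i2)
  have "(LINT \<omega>|M. overshoot t h (V h \<omega>)) - of_real (exp (- (\<mu> * h))) *
      (T0 t h + of_real (\<mu> * h) * T1 t h) = (LINT \<omega>|M. r \<omega>)"
    unfolding r_def T0_def T1_def
    by (subst Bochner_Integration.integral_diff[OF i0
        integrable_mult_right[OF Bochner_Integration.integrable_add[OF i1 integrable_mult_right[OF i2]]]],
        subst integral_mult_right_zero,
            subst Bochner_Integration.integral_add[OF i1 integrable_mult_right[OF i2]],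
        subst integral_mult_right_zero) (rule refl)
  also have "norm \<dots> \<le> (LINT \<omega>|M. 2 * (\<mu> * h)\<^sup>2)"
  proof (rule order_trans[OF integral_norm_bound], rule integral_mono[OF integrable_norm[OF ir]])
    show "norm (r \<omega>) \<le> 2 * (\<mu> * h)\<^sup>2" for \<omega> unfolding r_def by (rule overshoot_expansion[OF h])
  qed simp
  finally show ?thesis using prob_space by simp
qed

text \<open>Without a jump the overshoot lies almost surely between 0 and \<open>c h\<close>,
  because \<open>S\<close> is nonnegative and \<open>V\<close> is nonpositive. Linearising the
  character costs only an error of order \<open>h\<^sup>2\<close> and leaves a term proportional to
  \<open>t\<close>: the origin of the linear term in the limiting identity.\<close>

lemma T0_expansion:
  assumes h: "0 < h"
  shows "norm (T0 t h + \<i> * of_real t * of_real (Y h)) \<le> (t * (c * h))\<^sup>2"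
proof -
  note [measurable] = S_rv'[OF h] V_rv[OF h]
  define y where "y \<omega> \<omega>' = max 0 (c * h - S h \<omega>' + V h \<omega>)" for \<omega> \<omega>'
  have ch: "0 \<le> c * h" using c_pos h by simp
  have y_bd: "AE \<omega>' in M. 0 \<le> y \<omega> \<omega>' \<and> y \<omega> \<omega>' \<le> c * h" for \<omega>
    using AE_S_nonneg
  proof eventually_elim
    case (elim \<omega>')
    have "0 \<le> S h \<omega>'" using elim h by simp
    then show ?case using V_nonpos[of h \<omega>] ch unfolding y_def max_def by auto
  qed
  have y_meas: "(\<lambda>p. y (fst p) (snd p)) \<in> borel_measurable (M \<Otimes>\<^sub>M M)" unfolding y_def by measurable
  have y_m [measurable]: "y \<omega> \<in> borel_measurable M" if "\<omega> \<in> space M" for \<omega> unfolding y_def[abs_def]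
      by measurable
  have y_int: "integrable M (y \<omega>)" for \<omega>
    unfolding y_def[abs_def]
    by (rule integrable_const_bound[where B="c * h"])
        (use y_bd[of \<omega>] in \<open>auto simp: y_def elim: eventually_mono\<close>)
  define m where "m \<omega> = (LINT \<omega>'|M. y \<omega> \<omega>')" for \<omega>
  have m_bd: "0 \<le> m \<omega>" "m \<omega> \<le> c * h" for \<omega>
  proof -
    show "0 \<le> m \<omega>" unfolding m_def by (rule integral_nonneg_AE) (simp add: y_def)
    have "m \<omega> \<le> (LINT \<omega>'|M. c * h)" unfolding m_def
      by (rule integral_mono_AE) (use y_int y_bd[of \<omega>] in \<open>auto elim: eventually_mono\<close>)
    then show "m \<omega> \<le> c * h" using prob_space by simp
  qed
  have m_meas: "m \<in> borel_measurable M" unfolding m_def[abs_def] y_def by measurable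
  have m_int: "integrable M m"
    by (rule integrable_const_bound[where B="c * h"]) (use m_bd m_meas in auto)
  have k_int: "integrable M (\<lambda>\<omega>'. 1 - iexp (t * y \<omega> \<omega>'))" for \<omega>
    unfolding y_def by (rule integrable_const_bound[where B=2]) (auto intro!: AE_I2 norm_1_minus_iexp)
  have pt: "norm (excess t h (V h \<omega>) 0 + \<i> * of_real t * of_real (m \<omega>)) \<le> (t * (c * h))\<^sup>2" for \<omega>
  proof -
    have "excess t h (V h \<omega>) 0 + \<i> * of_real t * of_real (m \<omega>) =
        (LINT \<omega>'|M. (1 - iexp (t * y \<omega> \<omega>')) + \<i> * of_real t * of_real (y \<omega> \<omega>'))"
      unfolding m_def integral_complex_of_real[symmetric]
      by (subst Bochner_Integration.integral_add[OF k_int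
          integrable_mult_right[OF integrable_of_real[OF y_int]]])
         (simp add: excess_def y_def)
    also have "norm \<dots> \<le> (LINT \<omega>'|M. (t * (c * h))\<^sup>2)"
    proof (rule order_trans[OF integral_norm_bound], rule integral_mono_AE)
      show "integrable M (\<lambda>\<omega>'. norm ((1 - iexp (t * y \<omega> \<omega>')) + \<i> * of_real t * of_real (y \<omega> \<omega>')))"
        by (intro integrable_norm Bochner_Integration.integrable_add k_int integrable_mult_right
            integrable_of_real y_int)
      show "AE \<omega>' in M. norm ((1 - iexp (t * y \<omega> \<omega>')) + \<i> * of_real t * of_real (y \<omega> \<omega>')) \<le> (t * (c * h))\<^sup>2"
        using y_bd[of \<omega>]
      proof eventually_elim
        case (elim \<omega>')
        have "norm ((1 - iexp (t * y \<omega> \<omega>')) + \<i> * of_real (t * y \<omega> \<omega>')) \<le> (t * y \<omega> \<omega>')\<^sup>2"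
          by (rule iexp_remainder)
        also have "\<dots> \<le> (t * (c * h))\<^sup>2"
          unfolding power_mult_distrib[of t] using elim by (intro mult_left_mono power_mono) auto
        finally show ?case by (simp add: mult.assoc)
      qed
    qed simp
    finally show ?thesis using prob_space by simp
  qed
  have i1: "integrable M (\<lambda>\<omega>. excess t h (V h \<omega>) 0)"
    by (rule integrable_const_bound[where B=2])
       (use excess_bound[OF h] measurable_compose[OF V_rv[OF h] muJ_excess(3)[OF h]] in auto)
  have "T0 t h + \<i> * of_real t * of_real (Y h) =
      (LINT \<omega>|M. excess t h (V h \<omega>) 0 + \<i> * of_real t * of_real (m \<omega>))"
    unfolding T0_def Y_def y_def[symmetric] m_def[symmetric] integral_complex_of_real[symmetric]
    by (subst Bochner_Integration.integral_add) (use i1 m_int in auto)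
  also have "norm \<dots> \<le> (LINT \<omega>|M. (t * (c * h))\<^sup>2)"
    by (rule order_trans[OF integral_norm_bound], rule integral_mono)
       (use i1 m_int pt in \<open>auto intro!: integrable_norm Bochner_Integration.integrable_add
           integrable_mult_right\<close>)
  finally show ?thesis using prob_space by simp
qed

lemma fixed_point_identity:
  fixes t h :: real
  assumes h: "0 < h"
  defines "p \<equiv> exp (- (q * h))"
  shows "(1 - of_real p * phi t h) * (LINT \<omega>|M. iexp (t * V h \<omega>)) =
    of_real (1 - p) * (LINT \<omega>|M. iexp (t * W h 1 \<omega>)) + of_real p * (LINT \<omega>|M. overshoot t h (V h \<omega>))"
proof -
  note [measurable] = V_rv[OF h]
  have i0: "integrable M (\<lambda>\<omega>. overshoot t h (V h \<omega>))"
    by (rule integrable_const_bound[where B=2])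
       (use overshoot_props[OF h] measurable_compose[OF V_rv[OF h] overshoot_props(1)[OF h]] in auto)
  have i1: "integrable M (\<lambda>\<omega>. phi t h * iexp (t * V h \<omega>))"
    by (intro integrable_mult_right integrable_const_bound[where B=1]) auto
  have "(LINT \<omega>|M. step h (\<lambda>x. iexp (t * x)) (V h \<omega>)) =
      phi t h * (LINT \<omega>|M. iexp (t * V h \<omega>)) + (LINT \<omega>|M. overshoot t h (V h \<omega>))"
    unfolding step_iexp[OF h] Bochner_Integration.integral_add[OF i1 i0]
        by (simp only: integral_mult_right_zero)
  with V_fixed_point[OF h, of "\<lambda>x. iexp (t * x)" 1] show ?thesis
    by (simp add: p_def algebra_simps)
qed

text \<open>The limit is the characteristic exponent of \<open>X\<close>. Conditioning on the jump
  part exhibits \<open>phi\<close> as a product of three factors, each with its own rate.\<close>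

lemma phi_quotient_tendsto:
  "(\<lambda>n. (phi t (hs n) - 1) / of_real (hs n)) \<longlonglongrightarrow>
    of_real c * (\<i> * of_real t) + of_real \<mu> * ((LINT x|\<mu>J. iexp (t * x)) - 1) - subordinator_exponent \<nu>
        (\<i> * of_real t)"
proof -
  define A where "A n = exp ((of_real c * (\<i> * of_real t)) * complex_of_real (hs n))" for n
  define B where "B n = (LINT z|\<rho>Z (hs n). iexp (t * z))" for n
  define C where "C n = exp (- subordinator_exponent \<nu> (\<i> * of_real t) * complex_of_real (hs n))" for n
  define j where "j = (LINT x|\<mu>J. iexp (t * x))"
  have phi: "phi t (hs n) = A n * B n * C n" for n
  proof -
    have "phi t (hs n) = (LINT z|\<rho>Z (hs n). LINT \<omega>|M. iexp (t * (c * hs n + z - S (hs n) \<omega>)))"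
      unfolding phi_def by (rule rhoX_integral[OF hs(1), where C=1]) auto
    also have "\<dots> = (LINT z|\<rho>Z (hs n). LINT \<omega>|M. (A n * iexp (t * z)) *
        exp (- ((\<i> * of_real t) * of_real (S (hs n) \<omega>))))"
      by (intro Bochner_Integration.integral_cong refl) (simp add: A_def exp_add[symmetric] algebra_simps)
    also have "\<dots> = (LINT z|\<rho>Z (hs n). (A n * iexp (t * z)) * C n)"
      by (subst integral_mult_right_zero, subst S_transform) (simp_all add: C_def)
    also have "\<dots> = A n * B n * C n"
      by (simp add: B_def integral_mult_left_zero integral_mult_right_zero)
    finally show ?thesis .
  qed
  have Alim: "(\<lambda>n. (A n - 1) / of_real (hs n)) \<longlonglongrightarrow> of_real c * (\<i> * of_real t)"
    unfolding A_def by (rule exp_minus_1_quotient_tendsto[OF hs])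
  have Clim: "(\<lambda>n. (C n - 1) / of_real (hs n)) \<longlonglongrightarrow> - subordinator_exponent \<nu> (\<i> * of_real t)"
    unfolding C_def by (rule exp_minus_1_quotient_tendsto[OF hs])
  have Blim: "(\<lambda>n. (B n - 1) / of_real (hs n)) \<longlonglongrightarrow> of_real \<mu> * (j - 1)"
  proof -
    define E where "E n = of_real (exp (- (\<mu> * hs n))) * (1 + of_real (\<mu> * hs n) * j)" for n
    have "norm (B n - E n) \<le> 1 * (\<mu> * hs n)\<^sup>2" for n
      using rhoZ_expansion[OF hs(1), of "\<lambda>x. iexp (t * x)" 1 n] by (simp add: B_def E_def j_def)
    then have err: "norm ((B n - E n) / of_real (hs n)) \<le> \<mu>\<^sup>2 * hs n" for n
      using hs(1)[of n] by (simp add: norm_divide divide_le_eq power2_eq_square mult_ac)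
    have "(\<lambda>n. \<mu>\<^sup>2 * hs n) \<longlonglongrightarrow> \<mu>\<^sup>2 * 0" by (intro tendsto_intros hs)
    then have "(\<lambda>n. \<mu>\<^sup>2 * hs n) \<longlonglongrightarrow> 0" by simp
    then have err0: "(\<lambda>n. (B n - E n) / of_real (hs n)) \<longlonglongrightarrow> 0"
      by (rule Lim_null_comparison[rotated]) (intro always_eventually allI err)
    have e1: "(\<lambda>n. (exp ((- of_real \<mu>) * complex_of_real (hs n)) - 1) / of_real (hs n)) \<longlonglongrightarrow> - of_real \<mu>"
      by (rule exp_minus_1_quotient_tendsto[OF hs])
    have e2: "(\<lambda>n. ((1 + of_real (\<mu> * hs n) * j) - 1) / complex_of_real (hs n)) \<longlonglongrightarrow> of_real \<mu> * j"
      using hs(1) by (simp add: less_imp_neq[symmetric] mult.assoc)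
    have "(\<lambda>n. (E n - 1) / of_real (hs n)) \<longlonglongrightarrow> - of_real \<mu> + of_real \<mu> * j"
    proof -
      have ex: "exp ((- of_real \<mu>) * complex_of_real (hs n)) = of_real (exp (- (\<mu> * hs n)))" for n
        by (simp flip: exp_of_real)
      show ?thesis unfolding E_def by (rule quotient_mult_tendsto[OF e1[unfolded ex] e2 hs])
    qed
    from tendsto_add[OF err0 this] show ?thesis
      by (simp add: algebra_simps flip: add_divide_distrib)
  qed
  from quotient_mult_tendsto[OF quotient_mult_tendsto[OF Alim Blim hs] Clim hs]
  show ?thesis unfolding phi j_def by simp
qed

text \<open>Drift and subordinator vanish from a step as the mesh shrinks, so the jump meets the
  limiting infimum alone. Three nested applications of dominated convergence, all with the bound
  2.\<close>

lemma T1_tendsto: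
  "(\<lambda>n. T1 t (hs n)) \<longlonglongrightarrow> (LINT \<omega>|M. LINT x|\<mu>J. 1 - iexp (t * max 0 (x + I \<omega>)))"
proof -
  interpret J: prob_space \<mu>J by (rule muJ_prob)
  note [measurable] = I_rv
  have inner: "(\<lambda>n. excess t (hs n) (V (hs n) \<omega>) x) \<longlonglongrightarrow> 1 - iexp (t * max 0 (x + I \<omega>))"
    if V: "(\<lambda>n. V (hs n) \<omega>) \<longlonglongrightarrow> I \<omega>" for \<omega> x
  proof -
    have "(\<lambda>n. excess t (hs n) (V (hs n) \<omega>) x) \<longlonglongrightarrow> (LINT \<omega>'|M. 1 - iexp (t * max 0 (x + I \<omega>)))"
      unfolding excess_def
    proof (rule integral_dominated_convergence[where w="\<lambda>_. 2"])
      show "AE \<omega>' in M. (\<lambda>n. 1 - iexp (t * max 0 (c * hs n + x - S (hs n) \<omega>' + V (hs n) \<omega>))) \<longlonglongrightarrow>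
          1 - iexp (t * max 0 (x + I \<omega>))"
        using AE_S_0 AE_space
      proof eventually_elim
        case (elim \<omega>')
        have "(\<lambda>n. 1 - iexp (t * max 0 (c * hs n + x - S (hs n) \<omega>' + V (hs n) \<omega>))) \<longlonglongrightarrow>
            1 - iexp (t * max 0 (c * 0 + x - S 0 \<omega>' + I \<omega>))"
          by (intro tendsto_intros hs V S_tendsto elim(2))
        then show ?case using elim(1) by simp
      qed
      show "(\<lambda>\<omega>'. 1 - iexp (t * max 0 (c * hs n + x - S (hs n) \<omega>' + V (hs n) \<omega>))) \<in> borel_measurable M"
          for n
        using S_rv'[OF hs(1), of n] by measurable
    qed (auto intro!: AE_I2 norm_1_minus_iexp)
    then show ?thesis using prob_space by simp
  qed
  show ?thesis unfolding T1_def
  proof (rule integral_dominated_convergence[where w="\<lambda>_. 2"])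
    show "AE \<omega> in M. (\<lambda>n. LINT x|\<mu>J. excess t (hs n) (V (hs n) \<omega>) x) \<longlonglongrightarrow>
        (LINT x|\<mu>J. 1 - iexp (t * max 0 (x + I \<omega>)))"
      using AE_V_tendsto
    proof eventually_elim
      case (elim \<omega>)
      show ?case
      proof (rule integral_dominated_convergence[where w="\<lambda>_. 2"])
        show "AE x in \<mu>J. (\<lambda>n. excess t (hs n) (V (hs n) \<omega>) x) \<longlonglongrightarrow> 1 - iexp (t * max 0 (x + I \<omega>))"
          by (intro AE_I2 inner elim)
        show "(\<lambda>x. excess t (hs n) (V (hs n) \<omega>) x) \<in> borel_measurable \<mu>J" for n
        proof -
          have "(\<lambda>x. (\<lambda>p. excess t (hs n) (fst p) (snd p)) (V (hs n) \<omega>, x)) \<in> borel_measurable borel"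
            by (rule measurable_compose[OF measurable_Pair1' excess_measurable[OF hs(1)]]) simp
          then show ?thesis by (simp add: measurable_cong_sets[OF muJ_sets refl])
        qed
      qed (auto intro!: AE_I2 excess_bound hs(1))
    qed
    show "(\<lambda>\<omega>. LINT x|\<mu>J. excess t (hs n) (V (hs n) \<omega>) x) \<in> borel_measurable M" for n
      by (rule measurable_compose[OF V_rv[OF hs(1)] muJ_excess(1)[OF hs(1)]])
    show "(\<lambda>\<omega>. LINT x|\<mu>J. 1 - iexp (t * max 0 (x + I \<omega>))) \<in> borel_measurable M" by measurable
  qed (auto intro!: muJ_excess(2) hs(1))
qed

lemma iexp_tendsto:
  assumes "AE \<omega> in M. (\<lambda>n. U n \<omega>) \<longlonglongrightarrow> L \<omega>" "\<And>n. U n \<in> borel_measurable M" "L \<in> borel_measurable M"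
  shows "(\<lambda>n. LINT \<omega>|M. iexp (t * U n \<omega>)) \<longlonglongrightarrow> (LINT \<omega>|M. iexp (t * L \<omega>))"
proof (rule integral_dominated_convergence[where w="\<lambda>_. 1"])
  note [measurable] = assms(2,3)
  show "(\<lambda>\<omega>. iexp (t * L \<omega>)) \<in> borel_measurable M" "(\<lambda>\<omega>. iexp (t * U n \<omega>)) \<in> borel_measurable M" for n
      by measurable
  show "AE \<omega> in M. (\<lambda>n. iexp (t * U n \<omega>)) \<longlonglongrightarrow> iexp (t * L \<omega>)"
    using assms(1) by eventually_elim (intro tendsto_intros)
qed auto

lemma killing_quotient: "(\<lambda>n. hs n / (1 - exp (- (q * hs n)))) \<longlonglongrightarrow> 1 / q"
  and killing_tendsto: "(\<lambda>n. exp (- (q * hs n))) \<longlonglongrightarrow> 1"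
  and killing_pos: "0 < 1 - exp (- (q * hs n))"
proof -
  have "(\<lambda>n. exp (- (q * hs n))) \<longlonglongrightarrow> exp (- (q * 0))" by (intro tendsto_intros hs)
  then show "(\<lambda>n. exp (- (q * hs n))) \<longlonglongrightarrow> 1" by simp
  show "0 < 1 - exp (- (q * hs n))" using q_pos hs(1)[of n] by simp
  have "((\<lambda>x. exp (- q * x)) has_real_derivative - q) (at 0)" by (auto intro!: derivative_eq_intros)
  then have *: "(\<lambda>x. (exp (- q * x) - 1) / x) \<midarrow>0\<rightarrow> - q" by (simp add: DERIV_def)
  have "filterlim hs (at 0) sequentially" unfolding filterlim_at using hs
      by (auto simp: less_imp_neq[OF hs(1), symmetric])
  from filterlim_compose[OF * this] have "(\<lambda>n. (exp (- q * hs n) - 1) / hs n) \<longlonglongrightarrow> - q" .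
  then have "(\<lambda>n. inverse (- ((exp (- q * hs n) - 1) / hs n))) \<longlonglongrightarrow> inverse (- (- q))"
    by (intro tendsto_intros) (use q_pos in auto)
  then show "(\<lambda>n. hs n / (1 - exp (- (q * hs n)))) \<longlonglongrightarrow> 1 / q"
    by (simp add: inverse_eq_divide minus_divide_left)
qed

text \<open>Divided by the killing probability, every term of \<open>fixed_point_identity\<close>
  has an evident limit except the jumpless overshoot. Up to a vanishing error that term is
  \<open>- \<i> t\<close> times a real sequence \<open>D n\<close> that does not depend on
  \<open>t\<close>, so its convergence at \<open>t = 1\<close> settles all \<open>t\<close> at
  once.\<close>

theorem minimum_transform:
  "\<exists>d. \<forall>t::real. (of_real q - (of_real c * (\<i> * of_real t) + of_real \<mu> * ((LINT x|\<mu>J. iexp (t * x)) - 1)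
        - subordinator_exponent \<nu> (\<i> * of_real t))) * (LINT \<omega>|M. iexp (t * I \<omega>)) =
     of_real q - d * (\<i> * of_real t) + of_real \<mu> * (LINT \<omega>|M. LINT x|\<mu>J. 1 - iexp (t * max 0 (x + I \<omega>)))"
proof -
  define p where "p n = exp (- (q * hs n))" for n
  define \<kappa> where "\<kappa> n = 1 - p n" for n
  define D where "D n = p n / \<kappa> n * exp (- (\<mu> * hs n)) * Y (hs n)" for n
  define \<psi> where "\<psi> t = of_real c * (\<i> * of_real t) + of_real \<mu> * ((LINT x|\<mu>J. iexp (t * x)) - 1)
        - subordinator_exponent \<nu> (\<i> * of_real t)" for t :: real
  define T where "T t = (LINT \<omega>|M. LINT x|\<mu>J. 1 - iexp (t * max 0 (x + I \<omega>)))" for t :: real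
  \<comment> \<open>The limit that the jumpless term must have, read off from the limits of the
    other terms.\<close>
  define A where "A t = (1 - \<psi> t / of_real q) * (LINT \<omega>|M. iexp (t * I \<omega>)) - 1 - of_real (\<mu> / q) * T t"
      for t
  have \<kappa>: "0 < \<kappa> n" for n using killing_pos[of n] by (simp add: \<kappa>_def p_def)
  have p1: "p \<longlonglongrightarrow> 1" using killing_tendsto by (simp add: p_def[abs_def])
  define r where "r n = hs n / \<kappa> n" for n
  have hk: "r \<longlonglongrightarrow> 1 / q" using killing_quotient by (simp add: r_def[abs_def] \<kappa>_def p_def)
  have e1: "(\<lambda>n. exp (- (\<mu> * hs n))) \<longlonglongrightarrow> 1"
  proof -
    have "(\<lambda>n. exp (- (\<mu> * hs n))) \<longlonglongrightarrow> exp (- (\<mu> * 0))" by (intro tendsto_intros hs)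
    then show ?thesis by simp
  qed
  have lim: "(\<lambda>n. - (\<i> * of_real t) * of_real (D n)) \<longlonglongrightarrow> A t" for t
  proof -
    define O' where "O' n = (LINT \<omega>|M. overshoot t (hs n) (V (hs n) \<omega>))" for n
    define L where "L n = (1 - of_real (p n) * phi t (hs n)) / of_real (\<kappa> n) *
        (LINT \<omega>|M. iexp (t * V (hs n) \<omega>))
        - (LINT \<omega>|M. iexp (t * W (hs n) 1 \<omega>)) - of_real (p n * exp (- (\<mu> * hs n)) * \<mu> * r n) *
            T1 t (hs n)" for n
    have L_eq: "L n = of_real (p n / \<kappa> n) *
        (O' n - of_real (exp (- (\<mu> * hs n))) * (of_real (\<mu> * hs n) * T1 t (hs n)))" for n
    proof -
      have "(1 - of_real (p n) * phi t (hs n)) * (LINT \<omega>|M. iexp (t * V (hs n) \<omega>)) =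
          of_real (\<kappa> n) * (LINT \<omega>|M. iexp (t * W (hs n) 1 \<omega>)) + of_real (p n) * O' n"
        unfolding O'_def \<kappa>_def p_def by (rule fixed_point_identity[OF hs(1)])
      then have "(1 - of_real (p n) * phi t (hs n)) / of_real (\<kappa> n) * (LINT \<omega>|M. iexp (t * V (hs n) \<omega>)) =
          (LINT \<omega>|M. iexp (t * W (hs n) 1 \<omega>)) + of_real (p n) * O' n / of_real (\<kappa> n)"
        using \<kappa>[of n] by (simp add: add_divide_distrib)
      then show ?thesis unfolding L_def r_def by (simp add: right_diff_distrib)
    qed
    have err: "norm (- (\<i> * of_real t) * of_real (D n) - L n) \<le> (2 * \<mu>\<^sup>2 + (t * c)\<^sup>2) * (hs n * r n)" for n
    proof -
      have pn: "0 < p n" "p n \<le> 1" using q_pos hs(1)[of n] by (auto simp: p_def)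
      have en: "0 < exp (- (\<mu> * hs n))" "exp (- (\<mu> * hs n)) \<le> 1" using mu_pos hs(1)[of n] by auto
      \<comment> \<open>\<open>R1\<close> is the error of the Poisson expansion and
        \<open>R2\<close> that of the linearisation. Both are quadratic in \<open>hs n\<close>, and
        division by \<open>\<kappa> n\<close> costs only one order.\<close>
      define R1 where "R1 = O' n - of_real (exp (- (\<mu> * hs n))) *
          (T0 t (hs n) + of_real (\<mu> * hs n) * T1 t (hs n))"
      define R2 where "R2 = T0 t (hs n) + \<i> * of_real t * of_real (Y (hs n))"
      have "- (\<i> * of_real t) * of_real (D n) - L n =
          - of_real (p n / \<kappa> n) * (R1 + of_real (exp (- (\<mu> * hs n))) * R2)"
        unfolding L_eq R1_def R2_def D_def by (simp add: algebra_simps)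
      also have "norm \<dots> = p n / \<kappa> n * norm (R1 + of_real (exp (- (\<mu> * hs n))) * R2)"
        using pn \<kappa>[of n] by (simp add: norm_mult norm_divide)
      also have "\<dots> \<le> 1 / \<kappa> n * (2 * (\<mu> * hs n)\<^sup>2 + (t * (c * hs n))\<^sup>2)"
      proof (intro mult_mono divide_right_mono)
        have "norm R1 \<le> 2 * (\<mu> * hs n)\<^sup>2" unfolding R1_def O'_def by (rule expected_overshoot[OF hs(1)])
        moreover have "norm R2 \<le> (t * (c * hs n))\<^sup>2" unfolding R2_def by (rule T0_expansion[OF hs(1)])
        moreover have "norm (of_real (exp (- (\<mu> * hs n))) * R2) \<le> 1 * norm R2"
          unfolding norm_mult using en by (intro mult_right_mono) auto
        ultimately show "norm (R1 + of_real (exp (- (\<mu> * hs n))) * R2) \<le>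
            2 * (\<mu> * hs n)\<^sup>2 + (t * (c * hs n))\<^sup>2"
          using norm_triangle_ineq[of R1 "of_real (exp (- (\<mu> * hs n))) * R2"] by linarith
      qed (use pn \<kappa>[of n] in auto)
      also have "\<dots> = (2 * \<mu>\<^sup>2 + (t * c)\<^sup>2) * (hs n * r n)"
        by (simp add: r_def power2_eq_square algebra_simps add_divide_distrib)
      finally show ?thesis .
    qed
    have "(\<lambda>n. (2 * \<mu>\<^sup>2 + (t * c)\<^sup>2) * (hs n * r n)) \<longlonglongrightarrow> (2 * \<mu>\<^sup>2 + (t * c)\<^sup>2) * (0 * (1 / q))"
      by (intro tendsto_intros hs hk)
    then have "(\<lambda>n. (2 * \<mu>\<^sup>2 + (t * c)\<^sup>2) * (hs n * r n)) \<longlonglongrightarrow> 0" by simp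
    then have err0: "(\<lambda>n. - (\<i> * of_real t) * of_real (D n) - L n) \<longlonglongrightarrow> 0"
      by (rule Lim_null_comparison[rotated]) (intro always_eventually allI err)
    have quot: "(1 - of_real (p n) * phi t (hs n)) / of_real (\<kappa> n) =
        1 - of_real (p n) * ((phi t (hs n) - 1) / of_real (hs n)) * of_real (r n)" for n
    proof -
      have nz: "complex_of_real (hs n) \<noteq> 0" "complex_of_real (\<kappa> n) \<noteq> 0" using hs(1)[of n] \<kappa>[of n] by auto
      have k1: "complex_of_real (\<kappa> n) = 1 - of_real (p n)" by (simp add: \<kappa>_def)
      show ?thesis unfolding r_def using nz by (simp add: divide_simps) (simp add: k1 algebra_simps)
    qed
    have "L \<longlonglongrightarrow> (1 - of_real 1 * \<psi> t * of_real (1 / q)) * (LINT \<omega>|M. iexp (t * I \<omega>)) -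
        (LINT \<omega>|M. iexp (t * 0))
        - of_real (1 * 1 * \<mu> * (1 / q)) * T t"
      unfolding L_def quot T_def \<psi>_def
    proof (intro tendsto_intros p1 e1 hk T1_tendsto phi_quotient_tendsto)
      show "(\<lambda>n. LINT \<omega>|M. iexp (t * V (hs n) \<omega>)) \<longlonglongrightarrow> (LINT \<omega>|M. iexp (t * I \<omega>))"
        by (rule iexp_tendsto[OF AE_V_tendsto V_rv[OF hs(1)] I_rv])
      show "(\<lambda>n. LINT \<omega>|M. iexp (t * W (hs n) 1 \<omega>)) \<longlonglongrightarrow> (LINT \<omega>|M. iexp (t * 0))"
        by (rule iexp_tendsto[OF AE_I2[OF W1_tendsto] W_rv[OF hs(1)]]) simp_all
    qed
    then have "L \<longlonglongrightarrow> A t" unfolding A_def using prob_space by simp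
    from tendsto_add[OF err0 this] show ?thesis by simp
  qed
  \<comment> \<open>At \<open>t = 1\<close> the factor in front of \<open>D n\<close> is the
    invertible constant \<open>- \<i>\<close>.\<close>
  have "(\<lambda>n. \<i> * (- (\<i> * of_real 1) * of_real (D n))) \<longlonglongrightarrow> \<i> * A 1" by (intro tendsto_intros lim)
  then have D: "(\<lambda>n. complex_of_real (D n)) \<longlonglongrightarrow> \<i> * A 1" by simp
  have A: "A t = - (\<i> * of_real t) * (\<i> * A 1)" for t
    by (rule LIMSEQ_unique[OF lim]) (intro tendsto_intros D)
  have "(of_real q - \<psi> t) * (LINT \<omega>|M. iexp (t * I \<omega>)) =
      of_real q - of_real q * (\<i> * A 1) * (\<i> * of_real t) + of_real \<mu> * T t" for t
  proof -
    have q0: "complex_of_real q \<noteq> 0" using q_pos by simp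
    have E: "of_real q * A t = (of_real q - \<psi> t) * (LINT \<omega>|M. iexp (t * I \<omega>)) - of_real q - of_real \<mu> * T t"
      unfolding A_def using q0 by (simp add: right_diff_distrib left_diff_distrib)
    have "(of_real q - \<psi> t) * (LINT \<omega>|M. iexp (t * I \<omega>)) = of_real q + of_real q * A t + of_real \<mu> * T t"
      unfolding E by simp
    also have "of_real q * A t = - (of_real q * (\<i> * A 1) * (\<i> * of_real t))"
      unfolding A[of t] by (simp only: mult_ac mult_minus_left mult_minus_right)
    finally show ?thesis by simp
  qed
  then show ?thesis unfolding \<psi>_def T_def by blast
qed

end

section \<open>Wiener--Hopf factorisation and tail asymptotics\<close>

lemma poly_map_poly_of_real: "poly (map_poly of_real p) (of_real x) = (of_real (poly p x) :: complex)"
  by (induction p) (auto simp: map_poly_pCons)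

text \<open>For \<open>w\<close> and \<open>z\<close> on opposite sides of the axis, a linear factor
  is comparable to \<open>1 + norm z\<close>. The lower constant combines
  \<open>Re w \<le> norm (w - z)\<close> with
  \<open>norm z \<le> norm w + norm (w - z)\<close>.\<close>

lemma linear_factor_bounds:
  fixes w z :: complex
  shows "norm (w - z) \<le> (1 + norm w) * (1 + norm z)"
    and "0 < Re w \<Longrightarrow> Re z \<le> 0 \<Longrightarrow> Re w / (1 + Re w + norm w) * (1 + norm z) \<le> norm (w - z)"
proof -
  have "norm (w - z) \<le> norm w + norm z" by (rule norm_triangle_ineq4)
  also have "\<dots> \<le> (1 + norm w) * (1 + norm z)" by (simp add: ring_distribs)
  finally show "norm (w - z) \<le> (1 + norm w) * (1 + norm z)" .
  assume w: "0 < Re w" and z: "Re z \<le> 0"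
  have re: "Re w \<le> norm (w - z)" using complex_Re_le_cmod[of "w - z"] z by simp
  have "norm z \<le> norm w + norm (w - z)" using norm_triangle_ineq4[of w "w - z"] by simp
  then have "Re w * (1 + norm z) \<le> Re w * (1 + norm w + norm (w - z))" using w
      by (intro mult_left_mono) auto
  also have "\<dots> \<le> (1 + Re w + norm w) * norm (w - z)"
    using mult_right_mono[OF re, of "1 + norm w"] by (simp add: algebra_simps)
  finally show "Re w / (1 + Re w + norm w) * (1 + norm z) \<le> norm (w - z)"
    using w by (simp add: divide_le_eq mult.commute add_pos_nonneg)
qed

text \<open>Here \<open>a\<close> will be the normalised \<open>\<chi>\<close>, whose sign is not
  visible from its formula. Agreement on tails extends to all Borel sets by a Dynkin argument for
  the signed measure with density \<open>a\<close>, and testing it on the set where \<open>a\<close>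
  is negative shows that this set is null.\<close>

lemma density_from_tails:
  fixes D :: "real measure" and a :: "real \<Rightarrow> real"
  assumes D: "real_distribution D" and a: "integrable lborel a"
    and tails: "\<And>u. measure D {u<..} = (LINT x|lborel. indicator {u<..} x * a x)"
    and total: "(LINT x|lborel. a x) = 1"
  shows "D = density lborel (\<lambda>x. ennreal (a x))" "AE x in lborel. 0 \<le> a x"
proof -
  interpret D: real_distribution D by fact
  have int: "integrable lborel (\<lambda>x. indicator A x * a x)" if "A \<in> sets borel" for A
    using integrable_mult_indicator[OF _ a, of A] that by simp
  have eq: "measure D A = (LINT x|lborel. indicator A x * a x)" if "A \<in> sets borel" for A
  proof -
    have stable: "Int_stable (range greaterThan :: real set set)"
    proof (rule Int_stableI)
      fix A B :: "real set" assume "A \<in> range greaterThan" "B \<in> range greaterThan"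
      then obtain x y where "A = {x<..}" "B = {y<..}" by auto
      then have "A \<inter> B = {max x y<..}" by auto
      then show "A \<inter> B \<in> range greaterThan" by auto
    qed
    have sub: "range greaterThan \<subseteq> Pow (UNIV :: real set)" by auto
    have borel_sets: "sigma_sets UNIV (range greaterThan) = sets (borel :: real measure)"
      unfolding borel_Ioi by (rule sets_measure_of[OF sub, symmetric])
    have A: "A \<in> sigma_sets UNIV (range greaterThan)"
      using that by (simp only: borel_sets)
    from stable sub A show ?thesis
    proof (induction rule: sigma_sets_induct_disjoint)
      case (basic A)
      then show ?case using tails by auto
    next
      case empty
      show ?case by simp
    next
      case (compl A)
      then have A: "A \<in> sets borel" by (simp only: borel_sets)
      have "measure D (UNIV - A) = 1 - measure D A" using D.prob_compl[of A] A by simp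
      also have "\<dots> = (LINT x|lborel. a x - indicator A x * a x)"
        using compl a int[OF A] total by simp
      also have "\<dots> = (LINT x|lborel. indicator (UNIV - A) x * a x)"
        by (intro Bochner_Integration.integral_cong refl) (auto simp: indicator_def)
      finally show ?case .
    next
      case (union F)
      have F: "F i \<in> sets borel" for i using union(2) by (auto simp only: borel_sets)
      have "measure D (\<Union>i. F i) = (\<Sum>i. measure D (F i))"
        by (rule sums_unique[OF D.finite_measure_UNION]) (use F union(1) in auto)
      also have "\<dots> = (\<Sum>i. LINT x:F i|lborel. a x)"
        using union by (simp add: set_lebesgue_integral_def)
      also have "\<dots> = (LINT x:(\<Union>i. F i)|lborel. a x)"
      proof (rule lebesgue_integral_countable_add[symmetric])
        show "set_integrable lborel (\<Union>i. F i) a"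
          unfolding set_integrable_def using int[of "\<Union>i. F i"] F by auto
      qed (use F union(1) in \<open>auto simp: disjoint_family_on_def\<close>)
      finally show ?case by (simp add: set_lebesgue_integral_def)
    qed
  qed
  have a_meas [measurable]: "a \<in> borel_measurable borel" using borel_measurable_integrable[OF a] by simp
  define N where "N = {x. a x < 0}"
  have N: "N \<in> sets borel" unfolding N_def by measurable
  have "(LINT x|lborel. - (indicator N x * a x)) = 0"
  proof -
    have "0 \<le> (LINT x|lborel. - (indicator N x * a x))"
        by (rule integral_nonneg_AE) (auto simp: N_def indicator_def)
    moreover have "0 \<le> (LINT x|lborel. indicator N x * a x)" unfolding eq[OF N, symmetric] by simp
    ultimately show ?thesis by simp
  qed
  then have "AE x in lborel. - (indicator N x * a x) = 0"
    by (subst (asm) integral_nonneg_eq_0_iff_AE) (use int[OF N] in \<open>auto simp: N_def indicator_def\<close>)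
  then show nonneg: "AE x in lborel. 0 \<le> a x"
    by eventually_elim (auto simp: N_def indicator_def split: if_splits)
  show "D = density lborel (\<lambda>x. ennreal (a x))"
  proof (rule measure_eqI)
    fix A assume "A \<in> sets D"
    then have A: "A \<in> sets borel" by simp
    have "emeasure D A = ennreal (LINT x|lborel. indicator A x * a x)"
      by (simp add: D.emeasure_eq_measure eq[OF A])
    also have "\<dots> = (\<integral>\<^sup>+ x. ennreal (indicator A x * a x) \<partial>lborel)"
      by (rule nn_integral_eq_integral[symmetric, OF int[OF A]]) (use nonneg in eventually_elim, simp)
    also have "\<dots> = emeasure (density lborel (\<lambda>x. ennreal (a x))) A"
      using A by (subst emeasure_density) (auto intro!: nn_integral_cong simp: indicator_def)
    finally show "emeasure D A = emeasure (density lborel (\<lambda>x. ennreal (a x))) A" .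
  qed simp
qed

text \<open>The equation for the characteristic functions says that \<open>M\<close> is the mixture
  of \<open>M \<star> D\<close> with weight \<open>p\<close> and of the point mass at 0 with weight
  \<open>1 - p\<close>. Tails at \<open>0 \<le> u\<close> do not see the point mass.\<close>

lemma geometric_mixture_tail:
  fixes M D :: "real measure"
  assumes M: "real_distribution M" and D: "real_distribution D" and p: "0 < p" "p < 1"
    and char: "\<And>t. (1 - of_real p * char D t) * char M t = of_real (1 - p)"
    and u: "0 \<le> u"
  shows "measure M {u<..} = p * measure (M \<star> D) {u<..}"
proof -
  interpret M: real_distribution M by fact
  interpret D: real_distribution D by fact
  interpret MD: pair_prob_space M D ..
  have MD_meas: "(\<lambda>(x, y). x + y) \<in> borel_measurable (M \<Otimes>\<^sub>M D)" by measurable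
  interpret N: real_distribution "M \<star> D"
    unfolding convolution_def by (rule MD.real_distribution_distr) (rule MD_meas)
  interpret b: prob_space "measure_pmf (bernoulli_pmf p)" by (rule measure_pmf.prob_space_axioms)
  interpret bN: pair_prob_space "measure_pmf (bernoulli_pmf p)" "M \<star> D" ..
  \<comment> \<open>A coin with bias \<open>p\<close> decides between a sample of
    \<open>M \<star> D\<close> and 0, which realises the mixture as an image measure.\<close>
  define g :: "bool \<times> real \<Rightarrow> real" where "g = (\<lambda>(b, x). if b then x else 0)"
  have g: "g \<in> borel_measurable (measure_pmf (bernoulli_pmf p) \<Otimes>\<^sub>M (M \<star> D))"
    unfolding g_def by measurable
  define \<nu> where "\<nu> = distr (measure_pmf (bernoulli_pmf p) \<Otimes>\<^sub>M (M \<star> D)) borel g"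
  interpret \<nu>: real_distribution \<nu> unfolding \<nu>_def by (rule bN.real_distribution_distr) (rule g)
  have mix: "(LINT x|\<nu>. F x) = of_real p * (LINT x|(M \<star> D). F x) + of_real (1 - p) * F 0"
    if F [measurable]: "F \<in> borel_measurable borel" and bd: "\<And>x. norm (F x) \<le> 1" for F :: "real \<Rightarrow> complex"
  proof -
    have "(LINT x|\<nu>. F x) = (LINT q|(measure_pmf (bernoulli_pmf p) \<Otimes>\<^sub>M (M \<star> D)). F (g q))"
      unfolding \<nu>_def by (rule integral_distr[OF g F])
    also have "\<dots> = (LINT b|measure_pmf (bernoulli_pmf p). LINT x|(M \<star> D). F (g (b, x)))"
      by (rule bN.integral_fst'[symmetric], rule bN.integrable_const_bound[where B=1])
         (use bd measurable_compose[OF g F] in auto)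
    also have "\<dots> = (\<Sum>b\<in>UNIV. pmf (bernoulli_pmf p) b *\<^sub>R (LINT x|(M \<star> D). F (g (b, x))))"
      by (rule integral_measure_pmf) auto
    also have "\<dots> = of_real p * (LINT x|(M \<star> D). F x) + of_real (1 - p) * F 0"
      using p N.prob_space by (simp add: UNIV_bool g_def scaleR_conv_of_real)
    finally show ?thesis .
  qed
  have "char (M \<star> D) t = char M t * char D t" for t
  proof -
    have "char (M \<star> D) t = (LINT q|(M \<Otimes>\<^sub>M D). iexp (t * ((\<lambda>(x, y). x + y) q)))"
      unfolding char_def convolution_def by (rule integral_distr[OF MD_meas]) simp
    also have "\<dots> = (LINT x|M. LINT y|D. iexp (t * (x + y)))"
      by (subst MD.integral_fst'[symmetric], rule MD.integrable_const_bound[where B=1])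
         (use measurable_compose[OF MD_meas, of "\<lambda>x. iexp (t * x)"] in \<open>auto simp: case_prod_beta\<close>)
    also have "\<dots> = (LINT x|M. LINT y|D. iexp (t * x) * iexp (t * y))"
      by (simp add: ring_distribs exp_add)
    finally show ?thesis by (simp only: integral_mult_right_zero integral_mult_left_zero char_def)
  qed
  moreover have "char \<nu> t = of_real p * char (M \<star> D) t + of_real (1 - p)" for t
    using mix[of "\<lambda>x. iexp (t * x)"] by (simp add: char_def)
  moreover have "char M t = of_real p * (char M t * char D t) + of_real (1 - p)" for t
  proof -
    have "char M t = of_real p * (char M t * char D t) + (1 - of_real p * char D t) * char M t"
      by (simp add: algebra_simps)
    then show ?thesis unfolding char .
  qed
  ultimately have "char \<nu> = char M" by (metis ext)
  then have "\<nu> = M" by (intro Levy_uniqueness \<nu>.real_distribution_axioms M)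
  then have "complex_of_real (measure M {u<..}) = of_real p * of_real (measure (M \<star> D) {u<..})"
    using mix[of "\<lambda>x. of_real (indicator {u<..} x)"] u
    by (simp add: indicator_def[of "{u<..}" 0] integral_complex_of_real)
  then show ?thesis by (simp only: of_real_mult[symmetric] of_real_eq_iff)
qed

section \<open>The Wiener--Hopf identity on the two half-planes\<close>

locale levy_model = jump_model M X Z S e c \<mu> q f \<nu> + roots: levy_roots \<nu> c \<mu> q Q N R \<alpha> n k \<beta>
  for M :: "'a measure" and X Z S e c \<mu> q f \<nu> Q N R \<alpha> n k \<beta> +
  assumes f_transform: "\<And>r. 0 \<le> r \<Longrightarrow>
    (LINT x|lborel. exp (- (r * x)) * f x) = poly Q r / (\<Prod>i=1..N. (\<alpha> i + r) ^ n i)"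
begin

abbreviation "chi_q \<equiv> chi N \<alpha> n R \<beta> k \<nu>"
abbreviation "P \<equiv> poly roots.pP"
abbreviation "B \<equiv> poly roots.pB"

sublocale J: prob_space \<mu>J by (rule muJ_prob)
sublocale MJ: pair_prob_space M \<mu>J ..

lemma AE_J_nonneg: "AE x in \<mu>J. 0 \<le> x"
  unfolding \<mu>J_def using f_meas f_neg
  by (subst AE_density) (auto intro!: AE_I2 simp: not_le[symmetric] intro: ccontr)

lemma P_nonzero: "Re z \<le> 0 \<Longrightarrow> P z \<noteq> 0" and B_nonzero: "Re z \<le> 0 \<Longrightarrow> B z \<noteq> 0"
proof -
  assume z: "Re z \<le> 0"
  have "of_real (\<alpha> l) - z \<noteq> 0" if "l \<in> {1..N}" for l using roots.\<alpha>_pos[OF that] z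
      by (auto simp: complex_eq_iff)
  then show "P z \<noteq> 0" unfolding roots.poly_pP by (subst prod_zero_iff) auto
  have "\<beta> j - z \<noteq> 0" if "j \<in> {1..R}" for j using roots.Re_beta[OF that] z by (auto simp: complex_eq_iff)
  then show "B z \<noteq> 0" unfolding roots.poly_pB by (subst prod_zero_iff) auto
qed

text \<open>The rational form is known at real arguments and is needed on the imaginary axis. The
  zeros of \<open>P (- z)\<close> lie in the open left half-plane, so both sides are continuous up
  to that axis.\<close>

lemma J_transform:
  assumes z: "0 \<le> Re z"
  shows "(LINT x|\<mu>J. exp (- z * of_real x)) = poly (map_poly of_real Q) z / P (- z)"
proof -
  have P_eq: "P (- z) = (\<Prod>i=1..N. (of_real (\<alpha> i) + z) ^ n i)" for z by (simp add: roots.poly_pP)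
  have bd: "AE x in \<mu>J. \<forall>z\<in>U. norm (exp (- z * of_real x)) \<le> 1" if "U \<subseteq> {z. 0 \<le> Re z}" for U
    using AE_J_nonneg by eventually_elim (use that in \<open>auto intro!: mult_nonneg_nonneg\<close>)
  show ?thesis
  proof (rule half_plane_eqI[OF _ _ _ _ _ z])
    show "(\<lambda>z. LINT x|\<mu>J. exp (- z * of_real x)) holomorphic_on {z. 0 < Re z}"
    proof (rule holomorphic_on_parametric_integral[where g="\<lambda>_. 1"])
      show "AE x in \<mu>J. \<forall>z\<in>{z. 0 < Re z}. norm (exp (- z * of_real x)) \<le> 1" by (rule bd) auto
    qed (auto intro!: holomorphic_intros Re_half_planes)
    show "continuous_on {z. 0 \<le> Re z} (\<lambda>z. LINT x|\<mu>J. exp (- z * of_real x))"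
    proof (rule continuous_on_parametric_integral[where g="\<lambda>_. 1"])
      show "AE x in \<mu>J. \<forall>z\<in>{z. 0 \<le> Re z}. norm (exp (- z * of_real x)) \<le> 1" by (rule bd) auto
    qed (auto intro!: continuous_intros)
    show "(\<lambda>z. poly (map_poly of_real Q) z / P (- z)) holomorphic_on {z. 0 < Re z}"
      by (intro holomorphic_intros) (use P_nonzero in auto)
    show "continuous_on {z. 0 \<le> Re z} (\<lambda>z. poly (map_poly of_real Q) z / P (- z))"
      by (intro continuous_intros) (use P_nonzero in auto)
    fix r :: real assume r: "0 < r"
    have "(LINT x|\<mu>J. exp (- (complex_of_real r) * of_real x)) =
        (LINT x|lborel. f x *\<^sub>R exp (- (complex_of_real r) * of_real x))"
      unfolding \<mu>J_def using f_meas f_nonneg by (intro integral_density) auto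
    also have "\<dots> = (LINT x|lborel. complex_of_real (exp (- (r * x)) * f x))"
      by (intro Bochner_Integration.integral_cong refl)
          (simp add: scaleR_conv_of_real exp_of_real[symmetric])
    also have "\<dots> = of_real (poly Q r / (\<Prod>i=1..N. (\<alpha> i + r) ^ n i))"
      unfolding integral_complex_of_real using r by (subst f_transform) auto
    also have "\<dots> = poly (map_poly of_real Q) (of_real r) / P (- of_real r)"
      unfolding P_eq by (simp add: poly_map_poly_of_real)
    finally show "(LINT x|\<mu>J. exp (- (complex_of_real r) * of_real x)) =
      poly (map_poly of_real Q) (of_real r) / P (- of_real r)" .
  qed
qed

definition "U z = (of_real c - roots.hat z) * (LINT \<omega>|M. exp (z * of_real (I \<omega>)))"
text \<open>The right-hand side of \<open>minimum_transform\<close> with \<open>z\<close> for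
  \<open>\<i> t\<close>. The overshoot \<open>max 0\<close> is nonnegative, which is why the
  integral continues to make sense for \<open>Re z \<le> 0\<close>.\<close>

definition "Lt d z = of_real q - d * z + of_real \<mu> *
    (LINT p|(M \<Otimes>\<^sub>M \<mu>J). 1 - exp (z * of_real (max 0 (snd p + I (fst p)))))"

lemma hat_int: "integrable lborel (\<lambda>u. indicator {0<..} u *\<^sub>R chi_q u)"
  using roots.chi_integrable by (simp add: set_integrable_def)

lemma hat_bound:
  "AE u in lborel. \<forall>z\<in>{z. 0 \<le> Re z}.
      norm (indicator {0<..} u *\<^sub>R (exp (- z * of_real u) * complex_of_real (chi_q u))) \<le>
          norm (indicator {0<..} u *\<^sub>R chi_q u)"
  by (intro AE_I2) (auto simp: indicator_def norm_mult intro!: mult_left_le_one_le)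

lemma hat_measurable:
  "(\<lambda>u. indicator {0<..} u *\<^sub>R (exp (- z * of_real u) * complex_of_real (chi_q u))) \<in>
      borel_measurable lborel"
proof -
  have "(\<lambda>u. exp (- z * of_real u) * complex_of_real (indicator {0<..} u *\<^sub>R chi_q u)) \<in>
      borel_measurable lborel"
    using borel_measurable_integrable[OF hat_int] by measurable
  also have "(\<lambda>u. exp (- z * of_real u) * complex_of_real (indicator {0<..} u *\<^sub>R chi_q u)) =
      (\<lambda>u. indicator {0<..} u *\<^sub>R (exp (- z * of_real u) * complex_of_real (chi_q u)))"
    by (auto simp: indicator_def)
  finally show ?thesis .
qed

lemma hat_continuous: "continuous_on {z. 0 \<le> Re z} roots.hat"
  unfolding roots.hat_def set_lebesgue_integral_def
  by (rule continuous_on_parametric_integral[OF hat_measurable _ integrable_norm[OF hat_int] hat_bound])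
     (auto intro!: continuous_intros)

lemma hat_holomorphic: "roots.hat holomorphic_on {z. 0 < Re z}"
  unfolding roots.hat_def set_lebesgue_integral_def
proof (rule holomorphic_on_parametric_integral[OF _ hat_measurable _ integrable_norm[OF hat_int]])
  show "AE u in lborel. \<forall>z\<in>{z. 0 < Re z}.
      norm (indicator {0<..} u *\<^sub>R (exp (- z * of_real u) * complex_of_real (chi_q u))) \<le>
          norm (indicator {0<..} u *\<^sub>R chi_q u)"
    using hat_bound by eventually_elim auto
qed (auto intro!: holomorphic_intros Re_half_planes)

lemma hat_norm: "0 \<le> Re z \<Longrightarrow> norm (roots.hat z) \<le> (LINT u|lborel. norm (indicator {0<..} u *\<^sub>R chi_q u))"
  unfolding roots.hat_def set_lebesgue_integral_def
proof (rule order_trans[OF integral_norm_bound], rule integral_mono_AE)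
  assume z: "0 \<le> Re z"
  have le: "AE u in lborel.
      norm (indicator {0<..} u *\<^sub>R (exp (- z * of_real u) * complex_of_real (chi_q u))) \<le>
          norm (indicator {0<..} u *\<^sub>R chi_q u)"
    using hat_bound by eventually_elim (use z in auto)
  show "integrable lborel (\<lambda>u.
      norm (indicator {0<..} u *\<^sub>R (exp (- z * of_real u) * complex_of_real (chi_q u))))"
    by (rule integrable_norm,
        rule Bochner_Integration.integrable_bound[OF integrable_norm[OF hat_int] hat_measurable])
       (use le in eventually_elim, simp)
  show "AE u in lborel. norm (indicator {0<..} u *\<^sub>R (exp (- z * of_real u) * complex_of_real (chi_q u)))
      \<le> norm (indicator {0<..} u *\<^sub>R chi_q u)"
    by (rule le)
qed (rule integrable_norm[OF hat_int])

lemma I_transform: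
  "continuous_on {z. 0 \<le> Re z} (\<lambda>z. LINT \<omega>|M. exp (z * of_real (I \<omega>)))"
  "(\<lambda>z. LINT \<omega>|M. exp (z * of_real (I \<omega>))) holomorphic_on {z. 0 < Re z}"
  "0 \<le> Re z \<Longrightarrow> norm (LINT \<omega>|M. exp (z * of_real (I \<omega>))) \<le> 1"
proof -
  note [measurable] = I_rv
  have bd: "AE \<omega> in M. \<forall>z\<in>U. norm (exp (z * of_real (I \<omega>))) \<le> 1" if "U \<subseteq> {z. 0 \<le> Re z}" for U
    using AE_I_nonpos by eventually_elim (use that in \<open>auto intro!: mult_nonneg_nonpos\<close>)
  show "continuous_on {z. 0 \<le> Re z} (\<lambda>z. LINT \<omega>|M. exp (z * of_real (I \<omega>)))"
  proof (rule continuous_on_parametric_integral[where g="\<lambda>_. 1"])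
    show "AE \<omega> in M. \<forall>z\<in>{z. 0 \<le> Re z}. norm (exp (z * of_real (I \<omega>))) \<le> 1" by (rule bd) auto
  qed (auto intro!: continuous_intros)
  show "(\<lambda>z. LINT \<omega>|M. exp (z * of_real (I \<omega>))) holomorphic_on {z. 0 < Re z}"
  proof (rule holomorphic_on_parametric_integral[where g="\<lambda>_. 1"])
    show "AE \<omega> in M. \<forall>z\<in>{z. 0 < Re z}. norm (exp (z * of_real (I \<omega>))) \<le> 1" by (rule bd) auto
  qed (auto intro!: holomorphic_intros Re_half_planes)
  assume z: "0 \<le> Re z"
  have b: "AE \<omega> in M. norm (exp (z * of_real (I \<omega>))) \<le> 1" using bd[of "{z}"] z by simp
  have "norm (LINT \<omega>|M. exp (z * of_real (I \<omega>))) \<le> (LINT \<omega>|M. 1)"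
    by (rule order_trans[OF integral_norm_bound], rule integral_mono_AE)
       (use b in \<open>auto intro!: integrable_const_bound[where B=1]\<close>)
  then show "norm (LINT \<omega>|M. exp (z * of_real (I \<omega>))) \<le> 1" using prob_space by simp
qed

lemma Lt_props:
  "continuous_on {z. Re z \<le> 0} (Lt d)" "Lt d holomorphic_on {z. Re z < 0}" "Lt d 0 = of_real q"
  "Re z \<le> 0 \<Longrightarrow> norm (Lt d z) \<le> (q + norm d + 2 * \<mu>) * (1 + norm z)"
proof -
  define y where "y p = max 0 (snd p + I (fst p))" for p
  have y_meas [measurable]: "y \<in> borel_measurable (M \<Otimes>\<^sub>M \<mu>J)"
    using I_rv unfolding y_def[abs_def] by measurable
  have y0: "0 \<le> y p" for p by (simp add: y_def)
  have bd: "norm (1 - exp (z * of_real (y p))) \<le> 2" if "Re z \<le> 0" for z p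
    using norm_exp_minus_1_le(2)[of "z * of_real (y p)"] that y0[of p]
        by (simp add: norm_minus_commute mult_nonpos_nonneg)
  have Lt_eq: "Lt d = (\<lambda>z. of_real q - d * z + of_real \<mu> *
      (LINT p|(M \<Otimes>\<^sub>M \<mu>J). 1 - exp (z * of_real (y p))))"
    by (simp add: Lt_def[abs_def] y_def)
  have "continuous_on {z. Re z \<le> 0} (\<lambda>z. LINT p|(M \<Otimes>\<^sub>M \<mu>J). 1 - exp (z * of_real (y p)))"
    by (rule continuous_on_parametric_integral[where g="\<lambda>_. 2"]) (auto intro!: continuous_intros AE_I2 bd)
  then show "continuous_on {z. Re z \<le> 0} (Lt d)" unfolding Lt_eq by (intro continuous_intros)
  have "(\<lambda>z. LINT p|(M \<Otimes>\<^sub>M \<mu>J). 1 - exp (z * of_real (y p))) holomorphic_on {z. Re z < 0}"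
    by (rule holomorphic_on_parametric_integral[where g="\<lambda>_. 2"])
       (auto intro!: holomorphic_intros AE_I2 bd open_halfspace_Re_lt)
  then show "Lt d holomorphic_on {z. Re z < 0}" unfolding Lt_eq by (intro holomorphic_intros)
  show "Lt d 0 = of_real q" by (simp add: Lt_def)
  assume z: "Re z \<le> 0"
  have "norm (LINT p|(M \<Otimes>\<^sub>M \<mu>J). 1 - exp (z * of_real (y p))) \<le> (LINT p|(M \<Otimes>\<^sub>M \<mu>J). 2)"
    by (rule order_trans[OF integral_norm_bound], rule integral_mono)
       (auto intro!: MJ.integrable_const_bound[where B=2] AE_I2 bd z)
  then have int: "norm (LINT p|(M \<Otimes>\<^sub>M \<mu>J). 1 - exp (z * of_real (y p))) \<le> 2" using MJ.prob_space by simp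
  have "norm (Lt d z) \<le> norm (of_real q - d * z) +
      norm (of_real \<mu> * (LINT p|(M \<Otimes>\<^sub>M \<mu>J). 1 - exp (z * of_real (y p))))"
    unfolding Lt_eq by (rule norm_triangle_ineq)
  also have "\<dots> \<le> (q + norm d * norm z) + \<mu> * 2"
    using norm_triangle_ineq4[of "of_real q" "d * z"] q_pos mu_pos int
        by (intro add_mono) (auto simp: norm_mult)
  also have "\<dots> \<le> (q + norm d + 2 * \<mu>) * (1 + norm z)"
  proof -
    have "0 \<le> (q + 2 * \<mu>) * norm z" "0 \<le> norm d" using q_pos mu_pos by auto
    then show ?thesis by (simp add: algebra_simps)
  qed
  finally show "norm (Lt d z) \<le> (q + norm d + 2 * \<mu>) * (1 + norm z)" .
qed

text \<open>Every linear factor of \<open>P\<close> and \<open>B\<close> is comparable to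
  \<open>1 + norm z\<close> on the left half-plane, and \<open>B\<close> has one factor more. The
  surplus compensates the linear growth of \<open>Lt d\<close>.\<close>

lemma rational_bound: "\<exists>C. \<forall>z. Re z \<le> 0 \<longrightarrow> norm (P z / B z) * (1 + norm z) \<le> C"
proof -
  define a where "a l = 1 + norm (complex_of_real (\<alpha> l))" for l
  define b where "b j = Re (\<beta> j) / (1 + Re (\<beta> j) + norm (\<beta> j))" for j
  define A where "A = (\<Prod>l=1..N. a l ^ n l)"
  define D where "D = (\<Prod>j=1..R. b j ^ k j)"
  have b0: "0 < b j" if "j \<in> {1..R}" for j
    using roots.Re_beta[OF that] by (simp add: b_def add_pos_nonneg)
  have D0: "0 < D" unfolding D_def using b0 by (intro prod_pos) auto
  have A0: "0 \<le> A" unfolding A_def a_def by (intro prod_nonneg) auto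
  have "norm (P z / B z) * (1 + norm z) \<le> A / D" if z: "Re z \<le> 0" for z
  proof -
    let ?y = "1 + norm z"
    have y: "0 < ?y" by (simp add: add_pos_nonneg)
    have "norm (P z) = (\<Prod>l=1..N. norm (of_real (\<alpha> l) - z) ^ n l)"
      by (simp add: roots.poly_pP prod_norm[symmetric] norm_power)
    also have "\<dots> \<le> (\<Prod>l=1..N. (a l * ?y) ^ n l)"
    proof (intro prod_mono conjI power_mono)
      show "norm (of_real (\<alpha> l) - z) \<le> a l * ?y" for l unfolding a_def by (rule linear_factor_bounds(1))
    qed auto
    also have "\<dots> = A * ?y ^ (\<Sum>l=1..N. n l)"
      by (simp add: A_def power_mult_distrib prod.distrib power_sum)
    finally have Pb: "norm (P z) \<le> A * ?y ^ (\<Sum>l=1..N. n l)" .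
    have "D * ?y ^ Suc (\<Sum>l=1..N. n l) = (\<Prod>j=1..R. (b j * ?y) ^ k j)"
      unfolding roots.card[symmetric] by (simp add: D_def power_mult_distrib prod.distrib power_sum)
    also have "\<dots> \<le> (\<Prod>j=1..R. norm (\<beta> j - z) ^ k j)"
    proof (intro prod_mono conjI power_mono)
      fix j assume j: "j \<in> {1..R}"
      show "b j * ?y \<le> norm (\<beta> j - z)" unfolding b_def
          by (rule linear_factor_bounds(2)[OF roots.Re_beta[OF j] z])
    qed (use b0 y in \<open>auto intro!: zero_le_power mult_nonneg_nonneg less_imp_le\<close>)
    also have "\<dots> = norm (B z)" by (simp add: roots.poly_pB prod_norm[symmetric] norm_power)
    finally have Bb: "D * ?y ^ Suc (\<Sum>l=1..N. n l) \<le> norm (B z)" .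
    have Dy: "0 < D * ?y ^ Suc (\<Sum>l=1..N. n l)" using D0 y by simp
    have "norm (P z / B z) * ?y = norm (P z) * ?y / norm (B z)" by (simp add: norm_divide)
    also have "\<dots> \<le> (A * ?y ^ (\<Sum>l=1..N. n l)) * ?y / (D * ?y ^ Suc (\<Sum>l=1..N. n l))"
      using Pb Bb Dy y A0 by (intro frac_le mult_right_mono) auto
    also have "\<dots> = A / D"
    proof -
      have "A * Y * x / (D * (x * Y)) = A / D" if "x \<noteq> 0" "Y \<noteq> 0" for x Y :: real using that by simp
      from this[of ?y "?y ^ (\<Sum>l=1..N. n l)"] show ?thesis using y by simp
    qed
    finally show ?thesis .
  qed
  then show ?thesis by blast
qed

theorem wiener_hopf: "0 \<le> Re z \<Longrightarrow> U z = P 0 / B 0 * of_real q"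
proof -
  assume z: "0 \<le> Re z"
  obtain d where d: "\<And>t::real.
      (of_real q - (of_real c * (\<i> * of_real t) + of_real \<mu> * ((LINT x|\<mu>J. iexp (t * x)) - 1)
        - subordinator_exponent \<nu> (\<i> * of_real t))) * (LINT \<omega>|M. iexp (t * I \<omega>)) =
     of_real q - d * (\<i> * of_real t) + of_real \<mu> * (LINT \<omega>|M. LINT x|\<mu>J. 1 - iexp (t * max 0 (x + I \<omega>)))"
    using minimum_transform by blast
  define V where "V z = P z / B z * Lt d z" for z
  obtain C1 where C1: "\<And>z. Re z \<le> 0 \<Longrightarrow> norm (P z / B z) * (1 + norm z) \<le> C1"
    using rational_bound by blast
  define C2 where "C2 = (c + (LINT u|lborel. norm (indicator {0<..} u *\<^sub>R chi_q u)))"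
  define C3 where "C3 = (q + norm d + 2 * \<mu>) * C1"
  have "U z = V 0"
  proof (rule bounded_half_planes_constant[where U=U and V=V and C="max C2 C3"])
    show "continuous_on {z. 0 \<le> Re z} U" unfolding U_def
      by (intro continuous_intros hat_continuous I_transform)
    show "U holomorphic_on {z. 0 < Re z}" unfolding U_def
      by (intro holomorphic_intros hat_holomorphic I_transform)
    show "continuous_on {z. Re z \<le> 0} V" unfolding V_def
      by (intro continuous_intros Lt_props) (use B_nonzero in auto)
    show "V holomorphic_on {z. Re z < 0}" unfolding V_def
      by (intro holomorphic_intros Lt_props) (use B_nonzero in auto)
    show "norm (U w) \<le> max C2 C3" if w: "0 \<le> Re w" for w
    proof -
      have "norm (of_real c - roots.hat w) \<le> C2"
        unfolding C2_def using norm_triangle_ineq4[of "of_real c" "roots.hat w"] hat_norm[OF w] c_pos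
            by simp
      moreover have "0 \<le> C2" unfolding C2_def using c_pos
          by (intro add_nonneg_nonneg integral_nonneg_AE) auto
      ultimately have "norm (U w) \<le> C2 * 1"
        unfolding U_def norm_mult using I_transform(3)[OF w] by (intro mult_mono) auto
      then show ?thesis by simp
    qed
    show "norm (V w) \<le> max C2 C3" if w: "Re w \<le> 0" for w
    proof -
      have "norm (V w) \<le> norm (P w / B w) * ((q + norm d + 2 * \<mu>) * (1 + norm w))"
        unfolding V_def norm_mult using Lt_props(4)[OF w] by (intro mult_left_mono) auto
      also have "\<dots> = (q + norm d + 2 * \<mu>) * (norm (P w / B w) * (1 + norm w))" by simp
      also have "\<dots> \<le> C3" unfolding C3_def using C1[OF w] q_pos mu_pos by (intro mult_left_mono) auto
      finally show ?thesis by simp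
    qed
    \<comment> \<open>Multiplied by \<open>P w\<close>, the identity of
      \<open>minimum_transform\<close> has \<open>Lam w\<close> on its left-hand side, and
      \<open>Lam_factor\<close> splits off \<open>B w\<close>.\<close>
    show "U w = V w" if w: "Re w = 0" for w
    proof -
      define t where "t = Im w"
      have wt: "w = \<i> * of_real t" using w by (simp add: t_def complex_eq_iff)
      have P0: "P w \<noteq> 0" and B0: "B w \<noteq> 0" using P_nonzero B_nonzero w by auto
      have J: "(LINT x|\<mu>J. iexp (t * x)) = poly (map_poly of_real Q) (- w) / P w"
        using J_transform[of "- w"] w by (simp add: wt mult_ac)
      have Lt: "Lt d w = of_real q - d * w + of_real \<mu> *
          (LINT \<omega>|M. LINT x|\<mu>J. 1 - iexp (t * max 0 (x + I \<omega>)))"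
      proof -
        note [measurable] = I_rv
        have "integrable (M \<Otimes>\<^sub>M \<mu>J) (\<lambda>p. 1 - exp (w * of_real (max 0 (snd p + I (fst p)))))"
        proof (rule MJ.integrable_const_bound[where B=2])
          show "AE p in M \<Otimes>\<^sub>M \<mu>J. norm (1 - exp (w * of_real (max 0 (snd p + I (fst p))))) \<le> 2"
            using norm_1_minus_iexp(2) by (intro AE_I2) (simp add: wt mult.assoc)
        qed measurable
        from MJ.integral_fst'[OF this] show ?thesis
          unfolding Lt_def by (simp add: wt mult.assoc)
      qed
      have "Lt d w = (of_real q - (of_real c * w + of_real \<mu> * (poly (map_poly of_real Q) (- w) / P w - 1)
        - subordinator_exponent \<nu> w)) * (LINT \<omega>|M. exp (w * of_real (I \<omega>)))"
        using d[of t] unfolding Lt J by (simp add: wt mult.assoc)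
      then have "P w * Lt d w = roots.Lam w * (LINT \<omega>|M. exp (w * of_real (I \<omega>)))"
        unfolding roots.Lam_def using P0 by (simp add: field_simps)
      also have "\<dots> = B w * U w" unfolding U_def using roots.Lam_factor[of w] w by simp
      finally show ?thesis unfolding V_def using B0 by (simp add: field_simps)
    qed
  qed (rule z)
  \<comment> \<open>At 0 both the term with \<open>d\<close> and the integral vanish, leaving
    \<open>Lt d 0 = q\<close>.\<close>
  then show ?thesis by (simp add: V_def Lt_props)
qed


section \<open>The infimum as a geometric compound\<close>

definition "chi_bar u = (LINT x:{u<..}|lborel. chi_q x)"

lemma hat_0: "roots.hat 0 = of_real (chi_bar 0)"
  unfolding roots.hat_def chi_bar_def set_lebesgue_integral_def
  by (subst integral_complex_of_real[symmetric]) (simp add: scaleR_conv_of_real)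

text \<open>Evaluation at 0 expresses the defect \<open>c - chi_bar 0\<close> through the roots. Its
  reciprocal is the limit that the theorem asserts.\<close>

lemma wiener_hopf_0: "of_real (c - chi_bar 0) = P 0 / B 0 * of_real q"
  using wiener_hopf[of 0] prob_space by (simp add: U_def hat_0)

lemma wiener_hopf': "0 \<le> Re z \<Longrightarrow>
    (of_real c - roots.hat z) * (LINT \<omega>|M. exp (z * of_real (I \<omega>))) = of_real (c - chi_bar 0)"
  using wiener_hopf[of z] unfolding wiener_hopf_0 U_def .

text \<open>As \<open>z\<close> tends to infinity along the integers, the transform of
  \<open>\<chi>\<close> vanishes and that of \<open>I\<close> tends to the mass at 0. Hence
  \<open>chi_bar 0 / c\<close> is the probability of a nonzero infimum, which bounds
  \<open>chi_bar 0\<close> from both sides.\<close>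

lemma atom_identity: "c * measure M {\<omega> \<in> space M. I \<omega> = 0} = c - chi_bar 0"
proof -
  note [measurable] = I_rv
  define z where "z n = complex_of_real (real n)" for n
  have hat: "(\<lambda>n. roots.hat (z n)) \<longlonglongrightarrow> (LINT u|(lborel :: real measure). (0 :: complex))"
    unfolding roots.hat_def set_lebesgue_integral_def
  proof (rule integral_dominated_convergence[where w="\<lambda>u. norm (indicator {0<..} u *\<^sub>R chi_q u)"])
    show "(\<lambda>u. indicator {0<..} u *\<^sub>R (exp (- z n * of_real u) * complex_of_real (chi_q u))) \<in>
        borel_measurable lborel" for n
      by (rule hat_measurable)
    show "AE u in lborel. (\<lambda>n.
        indicator {0<..} u *\<^sub>R (exp (- z n * of_real u) * complex_of_real (chi_q u))) \<longlonglongrightarrow> 0"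
    proof (rule AE_I2)
      fix u :: real
      show "(\<lambda>n. indicator {0<..} u *\<^sub>R (exp (- z n * of_real u) * complex_of_real (chi_q u))) \<longlonglongrightarrow> 0"
      proof (cases "0 < u")
        case True
        have "(\<lambda>n. exp (- (real n * u))) \<longlonglongrightarrow> 0" using True by real_asymp
        then have "(\<lambda>n. complex_of_real (exp (- (real n * u))) * of_real (chi_q u)) \<longlonglongrightarrow>
            of_real 0 * of_real (chi_q u)"
          by (intro tendsto_intros)
        then show ?thesis using True by (simp add: z_def exp_of_real[symmetric])
      qed simp
    qed
    show "AE u in lborel. norm
        (indicator {0<..} u *\<^sub>R (exp (- z n * of_real u) * complex_of_real (chi_q u))) \<le>
            norm (indicator {0<..} u *\<^sub>R chi_q u)" for n
      using hat_bound by eventually_elim (simp add: z_def)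
  qed (use integrable_norm[OF hat_int] in auto)
  have I: "(\<lambda>n. LINT \<omega>|M. exp (z n * of_real (I \<omega>))) \<longlonglongrightarrow> (LINT \<omega>|M. indicator {\<omega> \<in> space M. I \<omega> = 0} \<omega>)"
  proof (rule integral_dominated_convergence[where w="\<lambda>_. 1"])
    show "AE \<omega> in M. (\<lambda>n. exp (z n * of_real (I \<omega>))) \<longlonglongrightarrow> indicator {\<omega> \<in> space M. I \<omega> = 0} \<omega>"
      using AE_I_nonpos AE_space
    proof eventually_elim
      case (elim \<omega>)
      show ?case
      proof (cases "I \<omega> = 0")
        case False
        then have neg: "I \<omega> < 0" using elim by simp
        define v where "v = - I \<omega>"
        have "0 < v" using neg by (simp add: v_def)
        then have "(\<lambda>n. exp (- (real n * v))) \<longlonglongrightarrow> 0" by real_asymp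
        then have "(\<lambda>n. exp (real n * I \<omega>)) \<longlonglongrightarrow> 0" by (simp add: v_def)
        then have "(\<lambda>n. complex_of_real (exp (real n * I \<omega>))) \<longlonglongrightarrow> of_real 0" by (intro tendsto_intros)
        then show ?thesis using False by (simp add: z_def exp_of_real[symmetric])
      qed (use elim in simp)
    qed
    show "AE \<omega> in M. norm (exp (z n * of_real (I \<omega>))) \<le> 1" for n
      using AE_I_nonpos by eventually_elim (auto simp: z_def intro: mult_nonneg_nonpos)
  qed auto
  have "(\<lambda>n. (of_real c - roots.hat (z n)) * (LINT \<omega>|M. exp (z n * of_real (I \<omega>)))) \<longlonglongrightarrow>
      (of_real c - (LINT u|(lborel :: real measure). (0 :: complex))) *
          (LINT \<omega>|M. indicator {\<omega> \<in> space M. I \<omega> = 0} \<omega>)"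
    by (intro tendsto_intros hat I)
  also have "(\<lambda>n. (of_real c - roots.hat (z n)) * (LINT \<omega>|M. exp (z n * of_real (I \<omega>)))) =
      (\<lambda>n. of_real (c - chi_bar 0))"
    by (intro ext wiener_hopf') (simp add: z_def)
  finally have "complex_of_real (c - chi_bar 0) =
      of_real c * (LINT \<omega>|M. indicator {\<omega> \<in> space M. I \<omega> = 0} \<omega>)"
    by (simp add: LIMSEQ_const_iff)
  also have "(LINT \<omega>|M. indicator {\<omega> \<in> space M. I \<omega> = 0} \<omega>) =
      complex_of_real (measure M {\<omega> \<in> space M. I \<omega> = 0})"
  proof -
    have "(LINT \<omega>|M. complex_of_real (indicator {\<omega> \<in> space M. I \<omega> = 0} \<omega>)) =
        of_real (LINT \<omega>|M. indicator {\<omega> \<in> space M. I \<omega> = 0} \<omega>)"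
      by (rule integral_complex_of_real)
    also have "(LINT \<omega>|M. indicator {\<omega> \<in> space M. I \<omega> = 0} \<omega> :: real) =
        measure M ({\<omega> \<in> space M. I \<omega> = 0} \<inter> space M)"
      by (rule Bochner_Integration.integral_indicator)
    also have "{\<omega> \<in> space M. I \<omega> = 0} \<inter> space M = {\<omega> \<in> space M. I \<omega> = 0}" by auto
    finally show ?thesis by (simp only: of_real_indicator)
  qed
  finally show ?thesis by (simp only: of_real_mult[symmetric] of_real_eq_iff)
qed

text \<open>\<open>- I\<close> is a geometric compound with parameter \<open>p = \<chi>0 / c\<close>
  of the law \<open>D\<close> with density \<open>\<chi> / \<chi>0\<close>. The ratio
  \<open>p / (1 - p)\<close> refers to the normalised tail; against \<open>chi_bar\<close> it
  becomes \<open>1 / (c - \<chi>0)\<close>.\<close>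

theorem infimum_tail_asymptotics:
  assumes subexp: "subexponential_df (\<lambda>u. if u < 0 then 0 else 1 - chi_bar u / chi_bar 0)"
  shows "((\<lambda>u. complex_of_real (measure M {\<omega> \<in> space M. I \<omega> < - u} / chi_bar u)) \<longlongrightarrow>
      (B 0 / P 0) / of_real q) at_top"
proof -
  obtain D where D: "real_distribution D" "measure D {..<0} = 0"
    and cdf: "cdf D = (\<lambda>u. if u < 0 then 0 else 1 - chi_bar u / chi_bar 0)"
    and lim: "((\<lambda>x. (1 - cdf (D \<star> D) x) / (1 - (if x < 0 then 0 else 1 - chi_bar x / chi_bar 0))) \<longlongrightarrow>
        2) at_top"
    using subexp unfolding subexponential_df_def by blast
  interpret D: real_distribution D by (rule D)
  define \<chi>0 where "\<chi>0 = chi_bar 0"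
  define p where "p = \<chi>0 / c"
  have tail: "measure D {u<..} = (if u < 0 then 1 else chi_bar u / \<chi>0)" for u
  proof -
    have "{u<..} = UNIV - {..u}" by auto
    then have "measure D {u<..} = 1 - cdf D u" using D.prob_compl[of "{..u}"] by (simp add: cdf_def)
    then show ?thesis unfolding cdf by (simp add: \<chi>0_def)
  qed
  \<comment> \<open>With total mass 0 the quotients in \<open>lim\<close> would have denominator 0
    for \<open>0 \<le> x\<close> and hence value 0, against the limit 2.\<close>
  have "\<chi>0 \<noteq> 0"
  proof
    assume z: "\<chi>0 = 0"
    have "\<forall>\<^sub>F x in at_top. (1 - cdf (D \<star> D) x) / (1 - (if x < 0 then 0 else 1 - chi_bar x / chi_bar 0)) = 0"
      using eventually_ge_at_top[of "0::real"] by eventually_elim (use z in \<open>simp add: \<chi>0_def\<close>)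
    then have "((\<lambda>x. (1 - cdf (D \<star> D) x) / (1 - (if x < 0 then 0 else 1 - chi_bar x / chi_bar 0))) \<longlongrightarrow>
        0) at_top"
      by (rule tendsto_eventually)
    from tendsto_unique[OF trivial_limit_at_top_linorder this lim] show False by simp
  qed
  have P0: "P 0 \<noteq> 0" "B 0 \<noteq> 0" using P_nonzero[of 0] B_nonzero[of 0] by auto
  \<comment> \<open>Positivity of the killing rate \<open>q\<close> excludes \<open>p = 1\<close>,
    since the defect is a nonzero multiple of \<open>q\<close>.\<close>
  have "complex_of_real (c - \<chi>0) \<noteq> 0" unfolding \<chi>0_def wiener_hopf_0 using P0 q_pos by simp
  then have "c \<noteq> \<chi>0" by auto
  have p: "0 < p" "p < 1"
  proof -
    have "p = 1 - measure M {\<omega> \<in> space M. I \<omega> = 0}"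
      using atom_identity c_pos by (simp add: p_def \<chi>0_def field_simps)
    then have "0 \<le> p" "p \<le> 1" by simp_all
    moreover have "p \<noteq> 0" "p \<noteq> 1" using \<open>\<chi>0 \<noteq> 0\<close> \<open>c \<noteq> \<chi>0\<close> c_pos by (auto simp: p_def)
    ultimately show "0 < p" "p < 1" by auto
  qed
  define a where "a x = indicator {0<..} x * chi_q x / \<chi>0" for x :: real
  have a_int: "integrable lborel a"
    using integrable_divide_zero[OF hat_int, of \<chi>0] by (simp add: a_def[abs_def])
  have a_tail: "(LINT x|lborel. indicator {u<..} x * a x) = chi_bar (max 0 u) / \<chi>0" for u
  proof -
    have "(LINT x|lborel. indicator {u<..} x * a x) =
        (LINT x|lborel. (indicator {max 0 u<..} x *\<^sub>R chi_q x) / \<chi>0)"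
      by (intro Bochner_Integration.integral_cong refl) (auto simp: a_def indicator_def)
    then show ?thesis by (simp add: chi_bar_def set_lebesgue_integral_def)
  qed
  have a_total: "(LINT x|lborel. a x) = 1"
  proof -
    have "(LINT x|lborel. a x) = (LINT x|lborel. indicator {-1<..} x * a x)"
      by (intro Bochner_Integration.integral_cong refl) (auto simp: a_def indicator_def)
    then show ?thesis unfolding a_tail using \<open>\<chi>0 \<noteq> 0\<close> by (simp add: \<chi>0_def)
  qed
  have dens: "D = density lborel (\<lambda>x. ennreal (a x))" and a0: "AE x in lborel. 0 \<le> a x"
  proof -
    have t: "measure D {u<..} = (LINT x|lborel. indicator {u<..} x * a x)" for u
      unfolding tail a_tail using \<open>\<chi>0 \<noteq> 0\<close> by (auto simp: \<chi>0_def max_def)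
    show "D = density lborel (\<lambda>x. ennreal (a x))" "AE x in lborel. 0 \<le> a x"
      by (rule density_from_tails[OF D(1) a_int t a_total])+
  qed
  have charD: "of_real \<chi>0 * char D t = roots.hat (- (\<i> * of_real t))" for t
  proof -
    have "char D t = (LINT x|lborel. a x *\<^sub>R iexp (t * x))"
      unfolding char_def by (subst dens, rule integral_density)
          (use a0 borel_measurable_integrable[OF a_int] in auto)
    then have "of_real \<chi>0 * char D t = (LINT x|lborel. of_real \<chi>0 * (a x *\<^sub>R iexp (t * x)))"
      by (simp only: integral_mult_right_zero)
    also have "\<dots> = roots.hat (- (\<i> * of_real t))"
      unfolding roots.hat_def set_lebesgue_integral_def
    proof (intro Bochner_Integration.integral_cong refl)
      fix x
      have "- (- (\<i> * complex_of_real t)) * of_real x = \<i> * of_real (t * x)" by (simp add: mult.assoc)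
      then show "of_real \<chi>0 * (a x *\<^sub>R iexp (t * x)) =
          indicator {0<..} x *\<^sub>R (exp (- (- (\<i> * complex_of_real t)) * of_real x) * of_real (chi_q x))"
        using \<open>\<chi>0 \<noteq> 0\<close> by (simp only: a_def) (simp add: scaleR_conv_of_real indicator_def)
    qed
    finally show ?thesis .
  qed
  define mu where "mu = distr M borel (\<lambda>\<omega>. - I \<omega>)"
  have I_meas: "(\<lambda>\<omega>. - I \<omega>) \<in> borel_measurable M" using I_rv by simp
  interpret mu: real_distribution mu unfolding mu_def by (rule real_distribution_distr) (rule I_meas)
  have mu_meas: "measure mu A = measure M {\<omega> \<in> space M. - I \<omega> \<in> A}" if "A \<in> sets borel" for A
    unfolding mu_def using that
        by (subst measure_distr[OF I_meas]) (auto intro!: arg_cong[where f="measure M"])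
  have mu0: "measure mu {..<0} = 0"
  proof -
    have "AE \<omega> in M. \<not> (- I \<omega> \<in> {..<0})" using AE_I_nonpos by eventually_elim simp
    then show ?thesis using I_rv by (subst mu_meas) (auto intro!: prob_eq_0_AE)
  qed
  have char_mu: "(1 - of_real p * char D t) * char mu t = of_real (1 - p)" for t
  proof -
    have "char mu t = (LINT \<omega>|M. iexp (t * (- I \<omega>)))"
      unfolding char_def mu_def by (rule integral_distr[OF I_meas]) simp
    then have cm: "char mu t = (LINT \<omega>|M. exp (- (\<i> * of_real t) * of_real (I \<omega>)))"
        by (simp add: mult.assoc)
    have "(of_real c - of_real \<chi>0 * char D t) * char mu t = of_real (c - \<chi>0)"
      unfolding cm charD unfolding \<chi>0_def by (rule wiener_hopf') simp
    moreover have "of_real c - of_real \<chi>0 * char D t = of_real c * (1 - of_real p * char D t)"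
      using c_pos by (simp add: p_def right_diff_distrib)
    moreover have "complex_of_real (c - \<chi>0) = of_real c * of_real (1 - p)"
      using c_pos by (simp add: p_def right_diff_distrib)
    ultimately have "of_real c * ((1 - of_real p * char D t) * char mu t) = of_real c * of_real (1 - p)"
      by (simp only: mult.assoc)
    then show ?thesis using c_pos by (simp only: mult_cancel_left of_real_eq_0_iff) simp
  qed
  have lim': "((\<lambda>u. (1 - cdf (D \<star> D) u) / (1 - cdf D u)) \<longlongrightarrow> 2) at_top"
    using lim unfolding cdf .
  have "((\<lambda>u. measure mu {u<..} / measure D {u<..}) \<longlongrightarrow> p / (1 - p)) at_top"
    by (rule compound_geometric_tail_asymptotics[OF mu.real_distribution_axioms D(1) mu0 D(2) p
          geometric_mixture_tail[OF mu.real_distribution_axioms D(1) p char_mu] lim'])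
  then have "((\<lambda>u. measure mu {u<..} / measure D {u<..} / \<chi>0) \<longlongrightarrow> p / (1 - p) / \<chi>0) at_top"
    by (rule tendsto_divide[OF _ tendsto_const \<open>\<chi>0 \<noteq> 0\<close>])
  moreover have "\<forall>\<^sub>F u in at_top. measure mu {u<..} / measure D {u<..} / \<chi>0 =
      measure M {\<omega> \<in> space M. I \<omega> < - u} / chi_bar u"
    using eventually_ge_at_top[of 0]
  proof eventually_elim
    case (elim u)
    have "measure mu {u<..} = measure M {\<omega> \<in> space M. I \<omega> < - u}"
      by (subst mu_meas) (auto intro!: arg_cong[where f="measure M"])
    then show ?case using elim \<open>\<chi>0 \<noteq> 0\<close> by (simp add: tail)
  qed
  ultimately have "((\<lambda>u. measure M {\<omega> \<in> space M. I \<omega> < - u} / chi_bar u) \<longlongrightarrow> p / (1 - p) / \<chi>0) at_top"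
    by (rule Lim_transform_eventually)
  also have "p / (1 - p) / \<chi>0 = 1 / (c - \<chi>0)"
  proof -
    have "1 - p = (c - \<chi>0) / c" using c_pos by (simp add: p_def field_simps)
    then show ?thesis using c_pos \<open>\<chi>0 \<noteq> 0\<close> by (simp add: p_def)
  qed
  finally have "((\<lambda>u. complex_of_real (measure M {\<omega> \<in> space M. I \<omega> < - u} / chi_bar u)) \<longlongrightarrow>
      of_real (1 / (c - \<chi>0))) at_top"
    by (rule tendsto_of_real)
  also have "complex_of_real (1 / (c - \<chi>0)) = (B 0 / P 0) / of_real q"
    unfolding of_real_divide \<chi>0_def wiener_hopf_0 using P0 by (simp add: field_simps)
  finally show ?thesis .
qed

end

theorem proposition2:
  fixes M :: "'a measure"
    and X Z S :: "real \<Rightarrow> 'a \<Rightarrow> real"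
    and e :: "'a \<Rightarrow> real"
    and c \<mu> q b :: real
    and f\<^sub>1 :: "real \<Rightarrow> real"
    and Q :: "real poly"
    and N m R :: nat
    and \<alpha> :: "nat \<Rightarrow> real"
    and n k :: "nat \<Rightarrow> nat"
    and \<beta> :: "nat \<Rightarrow> complex"
    and \<nu> :: "real measure"
  defines "\<Psi> \<equiv> Psi c \<mu> Q N \<alpha> n \<nu>"
    and "\<kappa> \<equiv> kappa N \<alpha> n R \<beta> k"
    and "chi_q \<equiv> chi N \<alpha> n R \<beta> k \<nu>"
  defines "chi_bar \<equiv> \<lambda>u::real. LINT x:{u<..}|lborel. chi_q x"
    and "chi_hat0 \<equiv> LINT x:{0<..}|lborel. chi_q x"
  assumes "prob_space M"
    and "f\<^sub>1 \<in> borel_measurable borel" and "\<And>x. 0 \<le> f\<^sub>1 x" and "\<And>x. x \<le> 0 \<Longrightarrow> f\<^sub>1 x = 0"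
    and "(\<integral>\<^sup>+ x. ennreal (f\<^sub>1 x) \<partial>lborel) = 1"
    and "0 < \<alpha> 1" and "strict_mono_on {1..N} \<alpha>"
    and "\<And>i. i \<in> {1..N} \<Longrightarrow> 1 \<le> n i"
    and "m = (\<Sum>i=1..N. n i)" and "degree Q < m"
    and "\<And>r. 0 \<le> r \<Longrightarrow>
           (LINT x|lborel. exp (- (r * x)) * f\<^sub>1 x) = poly Q r / (\<Prod>i=1..N. (\<alpha> i + r) ^ n i)"
    and "0 < c" and "0 < \<mu>"
    and "compound_poisson_process M \<mu> f\<^sub>1 Z"
    and "driftless_subordinator M \<nu> S"
    and "indep_rvs M path_space (path_of Z) path_space (path_of S)"
    and "\<And>t \<omega>. 0 \<le> t \<Longrightarrow> \<omega> \<in> space M \<Longrightarrow> X t \<omega> = c * t + Z t \<omega> - S t \<omega>"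
    and "0 < q"
    and "distributed M lborel e (\<lambda>x. ennreal (exponential_density q x))"
    and "indep_rvs M borel e path_space (path_of X)"
    \<comment> \<open>the points \<open>\<alpha> i\<close> are the poles of \<open>\<Psi>\<close>, not roots\<close>
    and "inj_on \<beta> {1..R}"
    and "\<beta> ` {1..R} = {z. 0 < Re z \<and> z \<notin> (\<lambda>i. of_real (\<alpha> i)) ` {1..N} \<and> \<Psi> z - of_real q = 0}"
    and "\<And>j. j \<in> {1..R} \<Longrightarrow> int (k j) = zorder (\<lambda>z. \<Psi> z - of_real q) (\<beta> j)"
    and "(\<Sum>j=1..R. k j) = m + 1"
    and "{x. 0 < x \<and> x < \<alpha> 1 \<and> \<Psi> (of_real x) - of_real q = 0} = {b}" and "\<beta> 1 = of_real b"
    and "k 1 = 1"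
    and "subexponential_df (\<lambda>u. if u < 0 then 0 else 1 - chi_bar u / chi_hat0)"
  shows "((\<lambda>u. complex_of_real
             (measure M {\<omega> \<in> space M. (INF s\<in>{0..e \<omega>}. X s \<omega>) < - u} / chi_bar u))
           \<longlongrightarrow> \<kappa> 0 / of_real q) at_top"
proof -
  have \<alpha>_pos: "0 < \<alpha> l" if l: "l \<in> {1..N}" for l
  proof (cases "l = 1")
    case False
    have "\<alpha> 1 < \<alpha> l"
      by (rule strict_mono_onD[OF \<open>strict_mono_on {1..N} \<alpha>\<close>]) (use l False in auto)
    then show ?thesis using \<open>0 < \<alpha> 1\<close> by simp
  qed (use \<open>0 < \<alpha> 1\<close> in simp)
  have "subordinator_levy_measure \<nu>" using \<open>driftless_subordinator M \<nu> S\<close>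
      by (simp add: driftless_subordinator_def)
  interpret lm: levy_model M X Z S e c \<mu> q f\<^sub>1 \<nu> Q N R \<alpha> n k \<beta>
  proof (intro levy_model.intro jump_model.intro jump_model_axioms.intro levy_roots.intro levy_measure.intro
      levy_roots_axioms.intro levy_model_axioms.intro)
    show "degree Q < (\<Sum>l=1..N. n l)" "(\<Sum>j=1..R. k j) = Suc (\<Sum>l=1..N. n l)"
      using \<open>degree Q < m\<close> \<open>m = _\<close> \<open>(\<Sum>j=1..R. k j) = m + 1\<close> by simp_all
    show "\<beta> ` {1..R} = {z. 0 < Re z \<and> z \<notin> (\<lambda>i. of_real (\<alpha> i)) ` {1..N} \<and> Psi c \<mu> Q N \<alpha> n \<nu> z - of_real q =
        0}"
      using assms(27) unfolding \<Psi>_def .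
    show "int (k j) = zorder (\<lambda>z. Psi c \<mu> Q N \<alpha> n \<nu> z - of_real q) (\<beta> j)" if "j \<in> {1..R}" for j
      using assms(28)[OF that] unfolding \<Psi>_def .
  qed (fact | rule \<alpha>_pos assms; assumption?)+
  have bar: "chi_bar = lm.chi_bar" and hat0: "chi_hat0 = lm.chi_bar 0"
    unfolding chi_bar_def chi_hat0_def chi_q_def lm.chi_bar_def by simp_all
  have "subexponential_df (\<lambda>u. if u < 0 then 0 else 1 - lm.chi_bar u / lm.chi_bar 0)"
    using \<open>subexponential_df _\<close> unfolding bar hat0 .
  \<comment> \<open>At the argument 0 the factors \<open>\<beta> j + r\<close> of
    \<open>kappa\<close> and \<open>\<beta> j - z\<close> of \<open>B\<close> coincide, and likewise
    those with \<open>\<alpha> l\<close>, so that \<open>kappa\<close> there is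
    \<open>B 0 / P 0\<close>.\<close>
  from lm.infimum_tail_asymptotics[OF this] show ?thesis
    unfolding bar lm.I_def \<kappa>_def kappa_def lm.roots.poly_pB lm.roots.poly_pP by simp
qed

end
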